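(* Let $n\ge 1$ and let $D_X=\mathbf C\langle x_{ij},\partial_{x_{ij}} : 1\le i,j\le n\rangle$ be the Weyl algebra in the $n^2$ variables $x_{ij}$. The left ideal of $D_X$ generated by $$\sum_{k=1}^n (x_{ki}\partial_{x_{kj}}-x_{kj}\partial_{x_{ki}}) \quad (1\leq i < j \leq n),$$ $$\delta_{ij}-\sum_{k=1}^n \partial_{x_{ki}}\partial_{x_{kj}},\qquad \delta_{ij}-\sum_{k=1}^n \partial_{x_{ik}}\partial_{x_{jk}}\quad (1\leq i\leq j \leq n),$$ $$1-\det \partial_x$$ is a maximal left ideal of $D_X$, and it is a holonomic ideal of $D_X$.
   Context: $D_X$ is the ring of linear differential operators with complex polynomial coefficients in the variables $x_{ij}$, where $\partial_{x_{ij}}=\partial/\partial x_{ij}$. $\delta_{ij}$ is the Kronecker symbol. $\det\partial_x$ denotes the determinant of the matrix whose $(i,j)$ entry is $\partial_{x_{ij}}$ (these entries commute). Holonomicity: let $D$ be the Weyl algebra in $N$ variables $x_1,\dots,x_N$ over $\mathbf C$ (here $N=n^2$). Every nonzero $p\in D$ is written uniquely as a finite sum $p=\sum c_{\alpha\beta}x^\alpha\partial^\beta$ with multi-indices $\alpha,\beta\in\mathbf Z_{\ge 0}^N$; put $m=\max\{|\beta| : c_{\alpha\beta}\ne 0\}$ and $\mathrm{in}_{(0,1)}(p)=\sum_{|\beta|=m}c_{\alpha\beta}x^\alpha\xi^\beta\in\mathbf C[x,\xi]=\mathbf C[x_1,\dots,x_N,\xi_1,\dots,\xi_N]$; put $\mathrm{in}_{(0,1)}(0)=0$.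 For a left ideal $I$ of $D$, its characteristic ideal $\mathrm{in}_{(0,1)}(I)$ is the ideal of $\mathbf C[x,\xi]$ generated by $\{\mathrm{in}_{(0,1)}(p) : p\in I\}$, and its characteristic variety is the zero set of $\mathrm{in}_{(0,1)}(I)$ in $\mathbf C^{2N}$. A proper left ideal $I\neq D$ is holonomic if its characteristic variety has Krull dimension $N$. *)

theory Defs
  imports "HOL-Library.Poly_Mapping" "HOL-Library.Extended_Nat" "HOL-Analysis.Determinants"
begin

section \<open>Polynomials in finitely many variables\<close>

type_synonym 'v mpoly = "('v \<Rightarrow>\<^sub>0 nat) \<Rightarrow>\<^sub>0 complex"

lemma pm_induct [case_names single add]:
  assumes s: "\<And>k v. P (Poly_Mapping.single k v)"
    and a: "\<And>p q. P p \<Longrightarrow> P q \<Longrightarrow> P (p + q)"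
  shows "P (p :: 'k \<Rightarrow>\<^sub>0 'c::comm_monoid_add)"
proof -
  have "P (\<Sum>k\<in>S. Poly_Mapping.single k (Poly_Mapping.lookup p k))" if "finite S" for S
    using that
  proof induction
    case empty
    show ?case using s[of undefined 0] by simp
  next
    case (insert x F)
    then show ?case by (simp add: s a)
  qed
  moreover have "(\<Sum>k\<in>Poly_Mapping.keys p. Poly_Mapping.single k (Poly_Mapping.lookup p k)) = p"
    by (rule poly_mapping_eqI)
       (auto simp: lookup_sum lookup_single when_def in_keys_iff sum.delta')
  ultimately show ?thesis by (metis finite_keys)
qed

lemma pm_sum_add:
  fixes p q :: "'k \<Rightarrow>\<^sub>0 'c::comm_monoid_add" and h :: "'k \<Rightarrow> 'c \<Rightarrow> 'b::comm_monoid_add"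
  assumes z: "\<And>k. h k 0 = 0" and a: "\<And>k x y. h k (x + y) = h k x + h k y"
  shows "(\<Sum>k\<in>Poly_Mapping.keys (p + q). h k (Poly_Mapping.lookup (p + q) k))
       = (\<Sum>k\<in>Poly_Mapping.keys p. h k (Poly_Mapping.lookup p k))
       + (\<Sum>k\<in>Poly_Mapping.keys q. h k (Poly_Mapping.lookup q k))"
proof -
  let ?S = "Poly_Mapping.keys p \<union> Poly_Mapping.keys q"
  have e: "(\<Sum>k\<in>Poly_Mapping.keys r. h k (Poly_Mapping.lookup r k))
         = (\<Sum>k\<in>?S. h k (Poly_Mapping.lookup r k))" if "Poly_Mapping.keys r \<subseteq> ?S" for r
    using that by (intro sum.mono_neutral_left) (auto simp: in_keys_iff z)
  show ?thesis
    using keys_add[of p q]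
    by (subst (1 2 3) e) (auto simp: lookup_add a sum.distrib)
qed

lemma pm_sum_single:
  assumes "h k 0 = 0"
  shows "(\<Sum>j\<in>Poly_Mapping.keys (Poly_Mapping.single k v).
           h j (Poly_Mapping.lookup (Poly_Mapping.single k v) j)) = h k v"
  using assms by (cases "v = 0") auto

definition mvar :: "'v \<Rightarrow> 'v mpoly"
  where "mvar i = Poly_Mapping.single (Poly_Mapping.single i 1) 1"

definition mconst :: "complex \<Rightarrow> 'v mpoly"
  where "mconst c = Poly_Mapping.single 0 c"

definition mpderiv :: "'v \<Rightarrow> 'v mpoly \<Rightarrow> 'v mpoly"
  where "mpderiv i p = (\<Sum>m\<in>Poly_Mapping.keys p.
     Poly_Mapping.single (m - Poly_Mapping.single i 1)
       (of_nat (Poly_Mapping.lookup m i) * Poly_Mapping.lookup p m))"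

definition meval :: "('v::finite \<Rightarrow> complex) \<Rightarrow> 'v mpoly \<Rightarrow> complex"
  where "meval a p = (\<Sum>m\<in>Poly_Mapping.keys p.
     Poly_Mapping.lookup p m * (\<Prod>i\<in>UNIV. a i ^ Poly_Mapping.lookup m i))"

lemma single_mult_left: "Poly_Mapping.single a c * (Poly_Mapping.single b d * f)
   = Poly_Mapping.single (a + b) (c * d) * (f :: 'v mpoly)"
  by (simp only: mult.assoc[symmetric] mult_single)

lemma mpderiv_add: "mpderiv i (p + q) = mpderiv i p + mpderiv i q"
  unfolding mpderiv_def
  by (rule pm_sum_add) (auto simp: algebra_simps single_add)

lemma mpderiv_single: "mpderiv i (Poly_Mapping.single m c)
   = Poly_Mapping.single (m - Poly_Mapping.single i 1) (of_nat (Poly_Mapping.lookup m i) * c)"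
  unfolding mpderiv_def
  by (rule pm_sum_single[where h = "\<lambda>m c. Poly_Mapping.single (m - Poly_Mapping.single i 1)
       (of_nat (Poly_Mapping.lookup m i) * c)"]) simp

lemma mpderiv_zero: "mpderiv i 0 = 0"
  by (simp add: mpderiv_def)

lemma mpderiv_mult: "mpderiv i (p * q) = mpderiv i p * q + p * mpderiv i q"
proof (induction p rule: pm_induct)
  case (single k v)
  show ?case
  proof (induction q rule: pm_induct)
    case (single l w)
    have 1: "k + l - Poly_Mapping.single i 1 = (k - Poly_Mapping.single i 1) + l"
      if "Poly_Mapping.lookup k i \<noteq> 0"
      using that by (intro poly_mapping_eqI) (auto simp: lookup_add lookup_minus lookup_single when_def)
    have 2: "k + l - Poly_Mapping.single i 1 = k + (l - Poly_Mapping.single i 1)"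
      if "Poly_Mapping.lookup l i \<noteq> 0"
      using that by (intro poly_mapping_eqI) (auto simp: lookup_add lookup_minus lookup_single when_def)
    show ?case
      using 1 2
      by (cases "Poly_Mapping.lookup k i = 0"; cases "Poly_Mapping.lookup l i = 0")
         (simp_all add: mpderiv_single mult_single lookup_add single_add[symmetric] algebra_simps)
  next
    case (add p q)
    then show ?case by (simp add: mpderiv_add algebra_simps)
  qed
next
  case (add p q)
  then show ?case by (simp add: mpderiv_add algebra_simps)
qed

section \<open>The Weyl algebra\<close>

text \<open>In characteristic zero the Weyl algebra is the subalgebra of \<open>End\<^sub>\<complex>(\<complex>[x])\<close> generated by
  the multiplications by the variables and the partial derivatives.\<close>

inductive_set weyl_ops :: "('v mpoly \<Rightarrow> 'v mpoly) set" where
  const: "(\<lambda>f. mconst c * f) \<in> weyl_ops"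
| var: "(\<lambda>f. mvar i * f) \<in> weyl_ops"
| deriv: "mpderiv i \<in> weyl_ops"
| add: "S \<in> weyl_ops \<Longrightarrow> T \<in> weyl_ops \<Longrightarrow> (\<lambda>f. S f + T f) \<in> weyl_ops"
| comp: "S \<in> weyl_ops \<Longrightarrow> T \<in> weyl_ops \<Longrightarrow> (\<lambda>f. S (T f)) \<in> weyl_ops"

lemma weyl_ops_add: "T \<in> weyl_ops \<Longrightarrow> T (f + g) = T f + T g"
  by (induction arbitrary: f g rule: weyl_ops.induct)
     (simp_all add: mpderiv_add algebra_simps)

lemma weyl_ops_0: "T \<in> weyl_ops \<Longrightarrow> T 0 = 0"
  using weyl_ops_add[of T 0 0] by simp

lemma weyl_ops_diff: "T \<in> weyl_ops \<Longrightarrow> T (f - g) = T f - T g"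
  using weyl_ops_add[of T "f - g" g] by (simp add: algebra_simps)

typedef 'v weyl = "weyl_ops :: ('v mpoly \<Rightarrow> 'v mpoly) set"
  morphisms weyl_apply Abs_weyl
  by (rule exI, rule weyl_ops.deriv)

setup_lifting type_definition_weyl

lemma weyl_ops_zero [simp]: "(\<lambda>f. 0) \<in> weyl_ops"
proof -
  have e: "(\<lambda>f. mconst 0 * f) = (\<lambda>f. 0)" by (simp add: mconst_def)
  show ?thesis using weyl_ops.const[of 0] unfolding e .
qed

lemma weyl_ops_id [simp]: "(\<lambda>f. f) \<in> weyl_ops"
proof -
  have e: "(\<lambda>f. mconst 1 * f) = (\<lambda>f. f)" by (simp add: mconst_def)
  show ?thesis using weyl_ops.const[of 1] unfolding e .
qed

lemma weyl_ops_uminus: "S \<in> weyl_ops \<Longrightarrow> (\<lambda>f. - S f) \<in> weyl_ops"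
  using weyl_ops.comp[OF weyl_ops.const[of "-1"], of S]
  by (simp add: mconst_def single_uminus)

instantiation weyl :: (type) ring_1
begin

lift_definition zero_weyl :: "'a weyl" is "\<lambda>f. 0" by simp
lift_definition one_weyl :: "'a weyl" is "\<lambda>f. f" by simp
lift_definition plus_weyl :: "'a weyl \<Rightarrow> 'a weyl \<Rightarrow> 'a weyl" is "\<lambda>S T f. S f + T f"
  by (rule weyl_ops.add)
lift_definition uminus_weyl :: "'a weyl \<Rightarrow> 'a weyl" is "\<lambda>S f. - S f"
  by (rule weyl_ops_uminus)
lift_definition minus_weyl :: "'a weyl \<Rightarrow> 'a weyl \<Rightarrow> 'a weyl" is "\<lambda>S T f. S f - T f"
  using weyl_ops.add[OF _ weyl_ops_uminus] by fastforce
lift_definition times_weyl :: "'a weyl \<Rightarrow> 'a weyl \<Rightarrow> 'a weyl" is "\<lambda>S T f. S (T f)"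
  by (rule weyl_ops.comp)

instance
proof
  fix a b c :: "'a weyl"
  show "a + b + c = a + (b + c)" by transfer (simp add: add.assoc)
  show "a + b = b + a" by transfer (simp add: add.commute)
  show "0 + a = a" by transfer simp
  show "- a + a = 0" by transfer simp
  show "a - b = a + - b" by transfer simp
  show "a * b * c = a * (b * c)" by transfer simp
  show "1 * a = a" by transfer simp
  show "a * 1 = a" by transfer simp
  show "(a + b) * c = a * c + b * c" by transfer simp
  show "a * (b + c) = a * b + a * c" by transfer (simp add: weyl_ops_add)
  show "(0 :: 'a weyl) \<noteq> 1" by transfer (metis zero_neq_one)
qed

end

lift_definition weyl_const :: "complex \<Rightarrow> 'v weyl" is "\<lambda>c f. mconst c * f"
  by (rule weyl_ops.const)
lift_definition weyl_x :: "'v \<Rightarrow> 'v weyl" is "\<lambda>i f. mvar i * f"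
  by (rule weyl_ops.var)
lift_definition weyl_d :: "'v \<Rightarrow> 'v weyl" is mpderiv
  by (rule weyl_ops.deriv)

text \<open>Product of pairwise commuting elements of a noncommutative ring; only meaningful under
  that hypothesis.\<close>

definition cprod :: "('i \<Rightarrow> 'a::monoid_mult) \<Rightarrow> 'i set \<Rightarrow> 'a"
  where "cprod f A = Finite_Set.fold (\<lambda>i y. f i * y) 1 A"

lemma cprod_empty [simp]: "cprod f {} = 1"
  by (simp add: cprod_def)

lemma cprod_insert:
  assumes c: "\<And>i j. f i * f j = f j * f i" and "finite A" "a \<notin> A"
  shows "cprod f (insert a A) = f a * cprod f A"
proof -
  interpret comp_fun_commute "\<lambda>i y. f i * y"
    by standard (simp add: fun_eq_iff mult.assoc[symmetric] c)
  show ?thesis using assms by (simp add: cprod_def)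
qed

lemma cprod_eq_prod: "cprod f A = prod f A" for f :: "'i \<Rightarrow> 'a::comm_monoid_mult"
  by (simp add: cprod_def prod.eq_fold comp_def)

definition cdet :: "('n::finite \<Rightarrow> 'n \<Rightarrow> 'a::ring_1) \<Rightarrow> 'a"
  where "cdet A = (\<Sum>\<sigma> | \<sigma> permutes UNIV. of_int (sign \<sigma>) * cprod (\<lambda>i. A i (\<sigma> i)) UNIV)"

lemma cdet_eq_det: "cdet A = det (\<chi> i j. A i j)" for A :: "'n::finite \<Rightarrow> 'n \<Rightarrow> 'a::comm_ring_1"
  by (simp add: cdet_def det_def cprod_eq_prod)

section \<open>Normally ordered expressions and initial forms\<close>

text \<open>The commutative ring \<open>\<complex>[x,\<xi>]\<close> is \<open>('v + 'v) mpoly\<close>, with \<open>x\<^sub>i\<close> indexed by \<open>Inl i\<close> and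
  \<open>\<xi>\<^sub>i\<close> by \<open>Inr i\<close>. Replacing each \<open>x\<^sup>\<alpha>\<xi>\<^sup>\<beta>\<close> by \<open>x\<^sup>\<alpha>\<partial>\<^sup>\<beta>\<close> is a linear bijection onto the
  Weyl algebra, shown below.\<close>

definition weyl_monom :: "('v + 'v \<Rightarrow>\<^sub>0 nat) \<Rightarrow> ('v::finite) weyl"
  where "weyl_monom m = cprod (\<lambda>i. weyl_x i ^ Poly_Mapping.lookup m (Inl i)) UNIV
                      * cprod (\<lambda>i. weyl_d i ^ Poly_Mapping.lookup m (Inr i)) UNIV"

definition normal_ordered :: "('v + 'v) mpoly \<Rightarrow> ('v::finite) weyl"
  where "normal_ordered p = (\<Sum>m\<in>Poly_Mapping.keys p.
     weyl_const (Poly_Mapping.lookup p m) * weyl_monom m)"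

lemma weyl_x_commute: "weyl_x i * weyl_x j = weyl_x j * weyl_x i"
  by transfer (simp add: fun_eq_iff mult.left_commute)

lemma mpderiv_commute: "mpderiv i (mpderiv j p) = mpderiv j (mpderiv i p)"
proof (induction p rule: pm_induct)
  case (single k v)
  have "k - Poly_Mapping.single j 1 - Poly_Mapping.single i 1
      = k - Poly_Mapping.single i 1 - Poly_Mapping.single j (1::nat)"
    by (rule poly_mapping_eqI) (simp add: lookup_minus)
  then show ?case
    by (cases "i = j") (simp_all add: mpderiv_single lookup_minus lookup_single mult.left_commute)
next
  case (add p q)
  then show ?case by (simp add: mpderiv_add)
qed

lemma weyl_d_commute: "weyl_d i * weyl_d j = weyl_d j * weyl_d i"
  by transfer (simp add: fun_eq_iff mpderiv_commute)

lemma weyl_const_commute: "weyl_const c * T = T * weyl_const c"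
proof -
  have "T (mconst c * f) = mconst c * T f" if "T \<in> weyl_ops" for T :: "'a mpoly \<Rightarrow> 'a mpoly" and f
    using that
  proof (induction arbitrary: f rule: weyl_ops.induct)
    case (deriv i)
    have "mpderiv i (mconst c) = 0" by (simp add: mconst_def mpderiv_single)
    then show ?case by (simp add: mpderiv_mult)
  qed (simp_all add: algebra_simps)
  then show ?thesis by transfer (auto simp: fun_eq_iff)
qed

lemma weyl_const_add: "weyl_const (a + b) = weyl_const a + weyl_const b"
  by transfer (simp add: fun_eq_iff mconst_def single_add algebra_simps)

lemma weyl_const_mult: "weyl_const (a * b) = weyl_const a * weyl_const b"
  by transfer (simp add: fun_eq_iff mconst_def mult_single mult.assoc[symmetric])

lemma weyl_const_0 [simp]: "weyl_const 0 = 0"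
  by transfer (simp add: mconst_def)

lemma weyl_const_1 [simp]: "weyl_const 1 = 1"
  by transfer (simp add: mconst_def)

lemma normal_ordered_add: "normal_ordered (p + q) = normal_ordered p + normal_ordered q"
  unfolding normal_ordered_def
  by (rule pm_sum_add) (auto simp: weyl_const_add algebra_simps)

lemma normal_ordered_single:
  "normal_ordered (Poly_Mapping.single m c) = weyl_const c * weyl_monom m"
  unfolding normal_ordered_def
  by (rule pm_sum_single[where h = "\<lambda>m c. weyl_const c * weyl_monom m"]) simp

lemma power_commutes2:
  fixes a b :: "'a::monoid_mult"
  assumes "a * b = b * a" shows "a ^ m * b ^ n = b ^ n * a ^ m"
proof -
  have 1: "a ^ m * b = b * a ^ m" for m
    by (induction m) (simp_all, metis assms mult.assoc)
  show ?thesis by (induction n) (simp_all, metis 1 mult.assoc)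
qed

lemma cprod_power_Suc:
  fixes g :: "'i::finite \<Rightarrow> 'a::monoid_mult"
  assumes c: "\<And>i j. g i * g j = g j * g i"
  shows "g i * cprod (\<lambda>j. g j ^ e j) UNIV = cprod (\<lambda>j. g j ^ (e j + (if j = i then Suc 0 else 0))) UNIV"
proof -
  let ?e = "\<lambda>j. e j + (if j = i then Suc 0 else 0)"
  have ins: "cprod (\<lambda>j. g j ^ e j) (insert a A) = g a ^ e a * cprod (\<lambda>j. g j ^ e j) A"
    if "a \<notin> A" for A a e
    using that by (intro cprod_insert power_commutes2 c) auto
  have 0: "cprod (\<lambda>j. g j ^ ?e j) A = cprod (\<lambda>j. g j ^ e j) A" if "i \<notin> A" for A
    using finite[of A] that
  proof induction
    case (insert x F)
    have "cprod (\<lambda>j. g j ^ ?e j) (insert x F) = g x ^ ?e x * cprod (\<lambda>j. g j ^ ?e j) F"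
      using insert by (intro cprod_insert power_commutes2 c) auto
    moreover have "x \<noteq> i" "i \<notin> F" using insert by auto
    ultimately show ?case using insert by (simp add: ins)
  qed simp
  have U: "(UNIV :: 'i set) = insert i (UNIV - {i})" by auto
  have "cprod (\<lambda>j. g j ^ ?e j) (insert i (UNIV - {i})) = g i ^ ?e i * cprod (\<lambda>j. g j ^ ?e j) (UNIV - {i})"
    by (intro cprod_insert power_commutes2 c) auto
  moreover have "cprod (\<lambda>j. g j ^ e j) (insert i (UNIV - {i})) = g i ^ e i * cprod (\<lambda>j. g j ^ e j) (UNIV - {i})"
    by (rule ins) auto
  ultimately show ?thesis
    using 0[of "UNIV - {i}"] by (simp add: U[symmetric] mult.assoc)
qed

lemma weyl_apply_add: "weyl_apply (S + T) f = weyl_apply S f + weyl_apply T f"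
  by transfer simp

lemma weyl_apply_mult: "weyl_apply (S * T) f = weyl_apply S (weyl_apply T f)"
  by transfer simp

lemma weyl_apply_1 [simp]: "weyl_apply 1 f = f"
  by transfer simp

lemma weyl_apply_0 [simp]: "weyl_apply 0 f = 0"
  by transfer simp

lemma weyl_apply_x: "weyl_apply (weyl_x i) f = mvar i * f"
  by transfer simp

lemma weyl_apply_d: "weyl_apply (weyl_d i) f = mpderiv i f"
  by transfer simp

lemma weyl_apply_const: "weyl_apply (weyl_const c) f = mconst c * f"
  by transfer simp

lemma weyl_apply_sum: "weyl_apply (\<Sum>k\<in>S. T k) f = (\<Sum>k\<in>S. weyl_apply (T k) f)"
  by (induction S rule: infinite_finite_induct) (simp_all add: weyl_apply_add)

lemma weyl_eqI: "(\<And>f. weyl_apply S f = weyl_apply T f) \<Longrightarrow> S = T"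
  by transfer auto

lemma weyl_apply_power_x: "weyl_apply (weyl_x i ^ n) f = Poly_Mapping.single (Poly_Mapping.single i n) 1 * f"
proof (induction n)
  case (Suc n)
  have "weyl_apply (weyl_x i ^ Suc n) f = (mvar i * Poly_Mapping.single (Poly_Mapping.single i n) 1) * f"
    by (simp only: power_Suc weyl_apply_mult weyl_apply_x Suc mult.assoc)
  also have "mvar i * Poly_Mapping.single (Poly_Mapping.single i n) 1
      = Poly_Mapping.single (Poly_Mapping.single i (Suc n)) (1 :: complex)"
    using single_add[of i 1 n] by (simp add: mvar_def mult_single)
  finally show ?case .
qed simp

lemma weyl_apply_cprod_x:
  "weyl_apply (cprod (\<lambda>i. weyl_x i ^ e i) A) f
   = Poly_Mapping.single (\<Sum>i\<in>A. Poly_Mapping.single i (e i)) 1 * f"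
  if "finite A" for A :: "'v::finite set"
  using that
proof (induction A arbitrary: f)
  case (insert a A)
  have "cprod (\<lambda>i. weyl_x i ^ e i) (insert a A) = weyl_x a ^ e a * cprod (\<lambda>i. weyl_x i ^ e i) A"
    using insert by (intro cprod_insert power_commutes2 weyl_x_commute) auto
  with insert show ?case
    by (simp add: weyl_apply_mult weyl_apply_power_x single_mult_left)
qed simp

lemma pm_sum_expand: "(\<Sum>i\<in>UNIV. Poly_Mapping.single i (Poly_Mapping.lookup m i)) = m"
  for m :: "'v::finite \<Rightarrow>\<^sub>0 nat"
  by (rule poly_mapping_eqI) (simp add: lookup_sum lookup_single when_def)

lift_definition pm_left :: "('a + 'b \<Rightarrow>\<^sub>0 nat) \<Rightarrow> ('a::finite) \<Rightarrow>\<^sub>0 nat" is "\<lambda>m i. m (Inl i)"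
  by simp

lift_definition pm_right :: "('a + 'b \<Rightarrow>\<^sub>0 nat) \<Rightarrow> ('b::finite) \<Rightarrow>\<^sub>0 nat" is "\<lambda>m i. m (Inr i)"
  by simp

lemma weyl_apply_xmonom:
  "weyl_apply (cprod (\<lambda>i. weyl_x i ^ Poly_Mapping.lookup m (Inl i)) UNIV) f
     = Poly_Mapping.single (pm_left m) 1 * f" for m :: "'v + 'v::finite \<Rightarrow>\<^sub>0 nat"
proof -
  have "(\<Sum>i\<in>UNIV. Poly_Mapping.single i (Poly_Mapping.lookup m (Inl i))) = pm_left m"
    by (rule poly_mapping_eqI) (simp add: lookup_sum lookup_single when_def pm_left.rep_eq)
  then show ?thesis by (simp add: weyl_apply_cprod_x)
qed

subsection \<open>Every operator has a normally ordered expression\<close>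

lemma x_weyl_monom:
  "weyl_x i * weyl_monom m = weyl_monom (m + Poly_Mapping.single (Inl i) 1)"
  unfolding weyl_monom_def
  by (subst mult.assoc[symmetric], subst cprod_power_Suc[OF weyl_x_commute])
     (simp add: lookup_add lookup_single when_def eq_commute)

lemma d_weyl_monom:
  "weyl_d i * weyl_monom m = weyl_monom (m + Poly_Mapping.single (Inr i) 1)
     + of_nat (Poly_Mapping.lookup m (Inl i)) * weyl_monom (m - Poly_Mapping.single (Inl i) 1)"
proof -
  define U where "U m = cprod (\<lambda>i. weyl_x i ^ Poly_Mapping.lookup m (Inl i)) UNIV" for m :: "'a + 'a \<Rightarrow>\<^sub>0 nat"
  define V where "V m = cprod (\<lambda>i. weyl_d i ^ Poly_Mapping.lookup m (Inr i)) UNIV" for m :: "'a + 'a \<Rightarrow>\<^sub>0 nat"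
  have wm: "weyl_monom m = U m * V m" for m by (simp add: weyl_monom_def U_def V_def)
  have on: "of_nat n = weyl_const (of_nat n)" for n
    by (induction n) (simp_all add: weyl_const_add)
  have s: "of_nat n * (Poly_Mapping.single a 1 * f) = Poly_Mapping.single a (of_nat n) * f"
    for n a and f :: "'a mpoly"
    using single_mult_left[of 0 "of_nat n" a 1 f] by simp
  have l: "pm_left (m - Poly_Mapping.single (Inl i) (Suc 0)) = pm_left m - Poly_Mapping.single i (Suc 0)"
    by (rule poly_mapping_eqI)
       (simp add: pm_left.rep_eq lookup_minus lookup_single when_def)
  have 1: "weyl_d i * U m = U m * weyl_d i
     + of_nat (Poly_Mapping.lookup m (Inl i)) * U (m - Poly_Mapping.single (Inl i) 1)"
    by (rule weyl_eqI)
       (simp add: on weyl_apply_add weyl_apply_mult weyl_apply_d U_def weyl_apply_xmonom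
         weyl_apply_const mpderiv_mult mpderiv_single mconst_def single_mult_left l s
         pm_left.rep_eq)
  have 2: "weyl_d i * V m = V (m + Poly_Mapping.single (Inr i) 1)"
    unfolding V_def by (subst cprod_power_Suc[OF weyl_d_commute])
      (simp add: lookup_add lookup_single when_def eq_commute)
  have 3: "V (m - Poly_Mapping.single (Inl i) 1) = V m"
    unfolding V_def by (simp add: lookup_minus lookup_single when_def)
  have 4: "U (m + Poly_Mapping.single (Inr i) 1) = U m"
    unfolding U_def by (simp add: lookup_add lookup_single when_def)
  show ?thesis
    by (simp only: wm 3 4 1 2[symmetric] mult.assoc[symmetric] distrib_right)
qed

lemma normal_ordered_ideal:
  fixes p :: "('v::finite + 'v) mpoly"
  shows "T \<in> weyl_ops \<Longrightarrow> \<exists>q. Abs_weyl T * normal_ordered p = normal_ordered q"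
proof (induction arbitrary: p rule: weyl_ops.induct)
  case (const c)
  have "Abs_weyl (\<lambda>f. mconst c * f) = (weyl_const c :: 'v weyl)" by (simp add: weyl_const.abs_eq)
  moreover have "\<exists>q. weyl_const c * normal_ordered p = normal_ordered q"
  proof (induction p rule: pm_induct)
    case (single k v)
    show ?case by (metis normal_ordered_single weyl_const_mult mult.assoc)
  qed (metis normal_ordered_add distrib_left)
  ultimately show ?case by simp
next
  case (var i)
  have "Abs_weyl (\<lambda>f. mvar i * f) = (weyl_x i :: 'v weyl)" by (simp add: weyl_x.abs_eq)
  moreover have "\<exists>q. weyl_x i * normal_ordered p = normal_ordered q"
  proof (induction p rule: pm_induct)
    case (single k v)
    show ?case by (metis normal_ordered_single weyl_const_commute x_weyl_monom mult.assoc)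
  qed (metis normal_ordered_add distrib_left)
  ultimately show ?case by simp
next
  case (deriv i)
  have "Abs_weyl (mpderiv i) = (weyl_d i :: 'v weyl)" by (simp add: weyl_d.abs_eq)
  moreover have "\<exists>q. weyl_d i * normal_ordered p = normal_ordered q"
  proof (induction p rule: pm_induct)
    case (single k v)
    have on: "of_nat n = weyl_const (of_nat n)" for n
      by (induction n) (simp_all add: weyl_const_add)
    have "weyl_d i * normal_ordered (Poly_Mapping.single k v)
      = weyl_const v * (weyl_d i * weyl_monom k)"
      by (metis normal_ordered_single weyl_const_commute mult.assoc)
    also have "\<dots> = normal_ordered (Poly_Mapping.single (k + Poly_Mapping.single (Inr i) 1) v
       + Poly_Mapping.single (k - Poly_Mapping.single (Inl i) 1) (v * of_nat (Poly_Mapping.lookup k (Inl i))))"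
      by (simp add: d_weyl_monom normal_ordered_add normal_ordered_single weyl_const_mult on
          algebra_simps)
    finally show ?case by blast
  qed (metis normal_ordered_add distrib_left)
  ultimately show ?case by simp
next
  case (add S T)
  then have "Abs_weyl (\<lambda>f. S f + T f) = Abs_weyl S + Abs_weyl T"
    by (simp add: plus_weyl.abs_eq eq_onp_def)
  with add.IH[of p] show ?case by (metis distrib_right normal_ordered_add)
next
  case (comp S T)
  then have "Abs_weyl (\<lambda>f. S (T f)) = Abs_weyl S * Abs_weyl T"
    by (simp add: times_weyl.abs_eq eq_onp_def)
  with comp.IH show ?case by (metis mult.assoc)
qed

lemma cprod_1: "cprod (\<lambda>i. 1) A = 1" if "finite A" for A :: "'i set"
  using that by induction (auto simp: cprod_insert)

lemma surj_normal_ordered: "surj normal_ordered"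
proof -
  have 1: "normal_ordered (1 :: ('v::finite + 'v) mpoly) = 1"
    unfolding single_one[symmetric] normal_ordered_single weyl_monom_def
    by (simp add: cprod_1)
  have "\<exists>q. T = normal_ordered q" for T :: "('v::finite) weyl"
    using normal_ordered_ideal[OF weyl_apply[of T], of "1"] by (simp add: weyl_apply_inverse 1)
  then show ?thesis by (auto simp: surj_def)
qed

subsection \<open>Uniqueness of the normally ordered expression\<close>

text \<open>\<open>\<partial>\<^sup>\<beta> x\<^sup>\<gamma>\<close> is zero if \<open>\<beta>\<^sub>i > \<gamma>\<^sub>i\<close> for some \<open>i\<close>, and is a nonzero constant if \<open>\<beta> = \<gamma>\<close>.\<close>

definition dcoef :: "nat \<Rightarrow> nat \<Rightarrow> nat"
  where "dcoef n k = (\<Prod>l<n. k - l)"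

lemma dcoef_0: "n > k \<Longrightarrow> dcoef n k = 0"
  by (auto simp: dcoef_def)

lemma dcoef_self: "dcoef n n \<noteq> 0"
  by (auto simp: dcoef_def)

lemma mpderiv_power_monom:
  "weyl_apply (weyl_d i ^ n) (Poly_Mapping.single g c)
   = Poly_Mapping.single (g - Poly_Mapping.single i n) (of_nat (dcoef n (Poly_Mapping.lookup g i)) * c)"
proof (induction n)
  case (Suc n)
  have "g - Poly_Mapping.single i n - Poly_Mapping.single i 1 = g - Poly_Mapping.single i (Suc n)"
    by (rule poly_mapping_eqI) (simp add: lookup_minus lookup_single when_def)
  with Suc show ?case
    by (simp add: weyl_apply_mult weyl_apply_d mpderiv_single lookup_minus dcoef_def mult_ac)
qed (simp add: dcoef_def)

lemma cprod_d_monom: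
  assumes "finite A"
  shows "weyl_apply (cprod (\<lambda>i. weyl_d i ^ e i) A) (Poly_Mapping.single g c)
   = Poly_Mapping.single (g - (\<Sum>i\<in>A. Poly_Mapping.single i (e i)))
       (of_nat (\<Prod>i\<in>A. dcoef (e i) (Poly_Mapping.lookup g i)) * c)"
  using assms
proof (induction A)
  case (insert a A)
  have c: "cprod (\<lambda>i. weyl_d i ^ e i) (insert a A) = weyl_d a ^ e a * cprod (\<lambda>i. weyl_d i ^ e i) A"
    using insert by (intro cprod_insert power_commutes2 weyl_d_commute) auto
  have "g - (\<Sum>i\<in>A. Poly_Mapping.single i (e i)) - Poly_Mapping.single a (e a)
      = g - (\<Sum>i\<in>insert a A. Poly_Mapping.single i (e i))"
    using insert by (intro poly_mapping_eqI) (simp add: lookup_minus lookup_add)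
  moreover have "(\<Sum>i\<in>A. Poly_Mapping.lookup (Poly_Mapping.single i (e i)) a) = 0"
    using insert by (intro sum.neutral) (auto simp: lookup_single when_def)
  ultimately show ?case
    using insert
    by (simp add: c weyl_apply_mult mpderiv_power_monom lookup_minus lookup_sum algebra_simps)
qed simp

lemma weyl_monom_apply:
  "weyl_apply (weyl_monom m) (Poly_Mapping.single g 1)
   = Poly_Mapping.single (pm_left m + (g - pm_right m))
       (of_nat (\<Prod>i\<in>UNIV. dcoef (Poly_Mapping.lookup m (Inr i)) (Poly_Mapping.lookup g i)))"
  for m :: "'v + 'v::finite \<Rightarrow>\<^sub>0 nat"
proof -
  have "(\<Sum>i\<in>UNIV. Poly_Mapping.single i (Poly_Mapping.lookup m (Inr i))) = pm_right m"
    by (rule poly_mapping_eqI) (simp add: lookup_sum lookup_single when_def pm_right.rep_eq)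
  then show ?thesis
    by (simp add: weyl_monom_def weyl_apply_mult cprod_d_monom weyl_apply_xmonom mult_single)
qed

definition xi_degree :: "('v + 'v::finite \<Rightarrow>\<^sub>0 nat) \<Rightarrow> nat"
  where "xi_degree m = (\<Sum>i\<in>UNIV. Poly_Mapping.lookup m (Inr i))"

lemma normal_ordered_eq_0:
  assumes "normal_ordered p = 0"
  shows "p = (0 :: ('v::finite + 'v) mpoly)"
proof (rule ccontr)
  assume "p \<noteq> 0"
  then have "Poly_Mapping.keys p \<noteq> {}" by simp
  then obtain m0 where m0: "m0 \<in> Poly_Mapping.keys p"
    and min: "\<And>m. m \<in> Poly_Mapping.keys p \<Longrightarrow> xi_degree m0 \<le> xi_degree m"
    using arg_min_if_finite[of "Poly_Mapping.keys p" xi_degree] finite_keys[of p]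
    by (meson not_le)
  define g where "g = pm_right m0"
  define K where "K m = (\<Prod>i\<in>UNIV. dcoef (Poly_Mapping.lookup m (Inr i)) (Poly_Mapping.lookup g i))"
    for m :: "'v + 'v \<Rightarrow>\<^sub>0 nat"
  have K0: "K m = 0" if m: "m \<in> Poly_Mapping.keys p" and ne: "pm_right m \<noteq> g" for m
  proof -
    have "\<exists>i. Poly_Mapping.lookup g i < Poly_Mapping.lookup m (Inr i)"
    proof (rule ccontr)
      assume "\<not> ?thesis"
      then have le: "Poly_Mapping.lookup m (Inr i) \<le> Poly_Mapping.lookup g i" for i
        by (simp add: not_less)
      obtain i where "Poly_Mapping.lookup m (Inr i) \<noteq> Poly_Mapping.lookup g i"
        using ne by (metis poly_mapping_eqI pm_right.rep_eq)
      then have "xi_degree m < xi_degree m0"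
        unfolding xi_degree_def using le
        by (intro sum_strict_mono_ex1) (auto simp: g_def pm_right.rep_eq intro!: exI[of _ i] le_neq_trans)
      with min[OF m] show False by simp
    qed
    then show ?thesis by (auto simp: K_def intro: dcoef_0)
  qed
  have inj: "m = m0" if "pm_right m = g" "pm_left m = pm_left m0" for m
  proof (rule poly_mapping_eqI)
    fix k show "Poly_Mapping.lookup m k = Poly_Mapping.lookup m0 k"
      using that by (cases k) (metis pm_left.rep_eq, metis pm_right.rep_eq g_def)
  qed
  have "0 = weyl_apply (normal_ordered p) (Poly_Mapping.single g 1)" using assms by simp
  also have "\<dots> = (\<Sum>m\<in>Poly_Mapping.keys p.
      Poly_Mapping.single (pm_left m + (g - pm_right m)) (Poly_Mapping.lookup p m * of_nat (K m)))"
    by (simp add: normal_ordered_def weyl_apply_sum weyl_apply_mult weyl_monom_apply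
        weyl_apply_const mconst_def mult_single K_def)
  finally have "0 = Poly_Mapping.lookup (\<Sum>m\<in>Poly_Mapping.keys p.
      Poly_Mapping.single (pm_left m + (g - pm_right m)) (Poly_Mapping.lookup p m * of_nat (K m)))
      (pm_left m0)" by (metis lookup_zero)
  also have "\<dots> = (\<Sum>m\<in>Poly_Mapping.keys p.
       if m = m0 then Poly_Mapping.lookup p m * of_nat (K m) else 0)"
    unfolding lookup_sum
  proof (rule sum.cong[OF refl])
    fix m assume m: "m \<in> Poly_Mapping.keys p"
    show "Poly_Mapping.lookup (Poly_Mapping.single (pm_left m + (g - pm_right m))
            (Poly_Mapping.lookup p m * of_nat (K m))) (pm_left m0)
        = (if m = m0 then Poly_Mapping.lookup p m * of_nat (K m) else 0)"
      using inj[of m] K0[OF m] by (cases "pm_right m = g") (auto simp: lookup_single when_def g_def)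
  qed
  also have "\<dots> = Poly_Mapping.lookup p m0 * of_nat (K m0)"
    using m0 by (simp add: sum.delta)
  finally have "K m0 = 0" using m0 by (simp add: in_keys_iff)
  then show False by (simp add: K_def g_def pm_right.rep_eq dcoef_self)
qed

lemma inj_normal_ordered: "inj normal_ordered"
proof (rule injI)
  fix p q :: "('v::finite + 'v) mpoly"
  assume "normal_ordered p = normal_ordered q"
  then have "normal_ordered (p - q) + normal_ordered q = 0 + normal_ordered q"
    by (metis add_0 diff_add_cancel normal_ordered_add)
  then show "p = q" using normal_ordered_eq_0[of "p - q"] by simp
qed

lemma bij_normal_ordered: "bij normal_ordered"
  using inj_normal_ordered surj_normal_ordered by (simp add: bij_def)

subsection \<open>Initial forms for the weight \<open>(0,1)\<close>\<close>

text \<open>For \<open>P = 0\<close> the sum is empty, so the value is \<open>0\<close>.\<close>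

definition in01 :: "('v::finite) weyl \<Rightarrow> ('v + 'v) mpoly"
  where "in01 P = (let p = inv normal_ordered P; r = Max (xi_degree ` Poly_Mapping.keys p)
     in \<Sum>m\<in>{m \<in> Poly_Mapping.keys p. xi_degree m = r}. Poly_Mapping.single m (Poly_Mapping.lookup p m))"

section \<open>Left ideals and holonomicity\<close>

definition left_ideal :: "'a::ring_1 set \<Rightarrow> bool"
  where "left_ideal I \<longleftrightarrow> 0 \<in> I \<and> (\<forall>a\<in>I. \<forall>b\<in>I. a + b \<in> I) \<and> (\<forall>r. \<forall>a\<in>I. r * a \<in> I)"

definition maximal_left_ideal :: "'a::ring_1 set \<Rightarrow> bool"
  where "maximal_left_ideal I \<longleftrightarrow> left_ideal I \<and> I \<noteq> UNIV \<and>
     (\<forall>J. left_ideal J \<and> I \<subseteq> J \<longrightarrow> J = I \<or> J = UNIV)"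

lemma left_ideal_hull: "left_ideal (left_ideal hull S)"
  by (rule hull_in) (auto simp: left_ideal_def)

definition zero_set :: "('w::finite) mpoly set \<Rightarrow> ('w \<Rightarrow> complex) set"
  where "zero_set S = {a. \<forall>p\<in>S. meval a p = 0}"

definition zariski_closed :: "(('w::finite) \<Rightarrow> complex) set \<Rightarrow> bool"
  where "zariski_closed Z \<longleftrightarrow> (\<exists>S. Z = zero_set S)"

definition zariski_irreducible :: "(('w::finite) \<Rightarrow> complex) set \<Rightarrow> bool"
  where "zariski_irreducible Z \<longleftrightarrow> zariski_closed Z \<and> Z \<noteq> {} \<and>
     (\<forall>A B. zariski_closed A \<and> zariski_closed B \<and> Z = A \<union> B \<longrightarrow> Z = A \<or> Z = B)"

text \<open>Krull dimension of a Zariski closed set \<open>V\<close>: the supremum of the lengths \<open>d\<close> of strict chains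
  \<open>Z\<^sub>0 \<subset> \<dots> \<subset> Z\<^sub>d\<close> of irreducible closed subsets of \<open>V\<close>. The empty set gets the value \<open>0\<close>, which is
  harmless here since only positive dimensions are compared with it.\<close>

definition krull_dim :: "(('w::finite) \<Rightarrow> complex) set \<Rightarrow> enat"
  where "krull_dim V = Sup {enat d |d. \<exists>Z :: nat \<Rightarrow> ('w \<Rightarrow> complex) set.
     (\<forall>i\<le>d. zariski_irreducible (Z i) \<and> Z i \<subseteq> V) \<and> (\<forall>i<d. Z i \<subset> Z (Suc i))}"

text \<open>In the commutative ring \<open>\<complex>[x,\<xi>]\<close> the left ideals are the ideals.\<close>

definition char_ideal :: "('v::finite) weyl set \<Rightarrow> ('v + 'v) mpoly set"
  where "char_ideal I = left_ideal hull (in01 ` I)"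

definition char_variety :: "('v::finite) weyl set \<Rightarrow> ('v + 'v \<Rightarrow> complex) set"
  where "char_variety I = zero_set (char_ideal I)"

definition holonomic :: "('v::finite) weyl set \<Rightarrow> bool"
  where "holonomic I \<longleftrightarrow> left_ideal I \<and> I \<noteq> UNIV \<and> krull_dim (char_variety I) = enat CARD('v)"

end

theory Submission
  imports Defs "HOL-Computational_Algebra.Polynomial"
begin

text \<open>
Write \<open>y = \<partial>\<close>, so that \<open>x\<close> acts as \<open>-\<partial>\<^sub>y\<close>. The ideal then describes the module supported on
\<open>SO\<^sub>n\<close> in the space of matrices \<open>y\<close> that is generated by a section \<open>u\<close> killed by the equations
\<open>J\<close> of \<open>SO\<^sub>n\<close> and by the right rotations.

Properness: the adjoints of the elements of the ideal map into \<open>J\<close> plus the image of the rotation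
fields. This space does not contain \<open>1\<close>, because the fields are skew for the Fischer inner product
and hence every element of \<open>J\<close> has an invariant part in \<open>J\<close>. The same argument shows that the
ideal contains no nonzero polynomial in \<open>x\<close>, so the zero section lies in the characteristic variety.

Maximality: the filtration of the module by words in the fields \<open>\<Sum>\<^sub>k y\<^sub>k\<^sub>a \<partial>\<^sub>k\<^sub>b\<close> is lowered by the
equations \<open>\<delta> - y\<^sup>T y\<close>, and an Euler operator acts on its layers by nonzero scalars. So every nonzero
submodule contains some \<open>f u\<close> with \<open>f \<notin> J\<close>. The rotation invariant ideals containing \<open>J\<close> are \<open>J\<close>
and the unit ideal: in a Cayley chart the rotations span all coordinate derivations, the charts
\<open>det (1 + \<epsilon> y) \<noteq> 0\<close> for sign matrices \<open>\<epsilon>\<close> of determinant \<open>1\<close> cover \<open>SO\<^sub>n\<close>, and any two of them meet.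

Dimension: the elements of degree at most \<open>k\<close> applied to \<open>u\<close> span a space of dimension \<open>O(k\<^sup>N)\<close>
with \<open>N = n\<^sup>2\<close>, since the coordinate ring of \<open>SO\<^sub>n\<close> has \<open>n(n-1)/2\<close> chart coordinates and the words
can be sorted in \<open>n(n+1)/2\<close> symmetric fields. The same bound holds for the functions of degree at
most \<open>k\<close> on the characteristic variety, and a chain of \<open>d + 1\<close> irreducible closed subsets forces
growth of order \<open>k\<^sup>d\<close>.
\<close>

text \<open>The equations of SO_n are never shown to generate a prime or radical ideal. Stability
  under rotations takes the place of integrality: the elements killed by a power of a chart
  determinant form a rotation-stable ideal, and the dichotomy for such ideals makes the determinants
  with sign product 1 nonzerodivisors. For the same reason the charts are used without localisation:
  identities are multiplied by powers of the determinant \<open>\<Delta>\<close>, and each function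
  carries the exponent that was used. These exponents are the source of the constants 2n and 2n+1 in
  the growth bounds. Positivity comes from the real form: the generators have real coefficients and
  the Hermitian form is positive definite, so arguments with sums of squares work over the complex
  numbers and replace averaging over the compact group. The characteristic variety is not computed.
  The upper bounds are counts, and every count rests on one fact of linear algebra: a homogeneous
  system with more unknowns than equations has a nonzero solution.\<close>

lemma homogeneous_system_solution:
  fixes a :: "'t \<Rightarrow> 'k \<Rightarrow> 'c::field"
  assumes "finite K" "finite T" "card K < card T"
  shows "\<exists>c. (\<exists>t\<in>T. c t \<noteq> 0) \<and> (\<forall>k\<in>K. (\<Sum>t\<in>T. c t * a t k) = 0)"
  using assms
proof (induction K arbitrary: T a rule: finite_induct)
  case empty
  then obtain t where "t \<in> T" by (metis card.empty less_irrefl ex_in_conv)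
  then show ?case by (intro exI[of _ "\<lambda>_. 1"]) auto
next
  case (insert k0 K)
  show ?case
  proof (cases "\<forall>t\<in>T. a t k0 = 0")
    case True
    have "card K < card T" using insert by simp
    with insert.IH[OF insert.prems(1), of a] True show ?thesis by auto
  next
    case False
    then obtain t0 where t0: "t0 \<in> T" "a t0 k0 \<noteq> 0" by auto
    \<comment> \<open>Gaussian elimination: the equation \<open>k0\<close> is solved for the unknown
      \<open>t0\<close> and substituted into the others.\<close>
    define a' where "a' t k = a t k - a t k0 / a t0 k0 * a t0 k" for t k
    have "card K < card (T - {t0})" using insert t0 by simp
    from insert.IH[OF _ this, of a'] insert.prems obtain c where
      c: "\<exists>t\<in>T - {t0}. c t \<noteq> 0" "\<forall>k\<in>K. (\<Sum>t\<in>T - {t0}. c t * a' t k) = 0" by auto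
    define s where "s = (\<Sum>t\<in>T - {t0}. c t * a t k0)"
    define d where "d t = (if t = t0 then - s / a t0 k0 else c t)" for t
    have split: "(\<Sum>t\<in>T. d t * a t k) = - s / a t0 k0 * a t0 k + (\<Sum>t\<in>T - {t0}. c t * a t k)" for k
      using insert.prems t0 by (simp add: sum.remove[of T t0] d_def)
    have "(\<Sum>t\<in>T. d t * a t k) = 0" if "k \<in> K" for k
    proof -
      have "0 = (\<Sum>t\<in>T - {t0}. c t * a' t k)" using c that by auto
      also have "\<dots> = (\<Sum>t\<in>T - {t0}. c t * a t k) - s / a t0 k0 * a t0 k"
        by (simp add: a'_def s_def right_diff_distrib sum_subtractf sum_distrib_right sum_divide_distrib mult.assoc)
      finally show ?thesis by (simp add: split)
    qed
    moreover have "(\<Sum>t\<in>T. d t * a t k0) = 0" using t0 by (simp add: split s_def)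
    moreover have "\<exists>t\<in>T. d t \<noteq> 0" using c by (auto simp: d_def)
    ultimately show ?thesis by (intro exI[of _ d]) auto
  qed
qed

section \<open>Evaluation and degree of polynomials\<close>

lemma mconst_add: "mconst (a + b) = mconst a + mconst b"
  by (simp add: mconst_def single_add)

lemma mconst_mult: "mconst (a * b) = mconst a * mconst b"
  by (simp add: mconst_def mult_single)

lemma mconst_0 [simp]: "mconst 0 = 0"
  by (simp add: mconst_def)

lemma mconst_1 [simp]: "mconst 1 = 1"
  by (simp add: mconst_def)

lemma mconst_uminus: "mconst (- a) = - mconst a"
  by (simp add: mconst_def single_uminus)

lemma mconst_of_int: "mconst (of_int n) = of_int n"
  by (simp add: mconst_def)

lemma mvar_power: "mvar i ^ n = Poly_Mapping.single (Poly_Mapping.single i n) 1"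
proof (induction n)
  case (Suc n)
  then show ?case
    by (simp add: mvar_def mult_single single_add[symmetric])
qed simp

lemma prod_mvar_power:
  assumes "finite A"
  shows "(\<Prod>i\<in>A. mvar i ^ e i) = Poly_Mapping.single (\<Sum>i\<in>A. Poly_Mapping.single i (e i)) 1"
  using assms by induction (simp_all add: mvar_power mult_single)

lemma single_eq_prod_mvar:
  "Poly_Mapping.single m c = mconst c * (\<Prod>i\<in>UNIV. mvar i ^ Poly_Mapping.lookup m i)"
  for m :: "'v::finite \<Rightarrow>\<^sub>0 nat"
  by (simp add: prod_mvar_power pm_sum_expand mconst_def mult_single)

lemma mpoly_induct [case_names const var add mult]:
  fixes p :: "'v::finite mpoly"
  assumes c: "\<And>c. P (mconst c)" and v: "\<And>i. P (mvar i)"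
    and a: "\<And>p q. P p \<Longrightarrow> P q \<Longrightarrow> P (p + q)" and m: "\<And>p q. P p \<Longrightarrow> P q \<Longrightarrow> P (p * q)"
  shows "P p"
proof (induction p rule: pm_induct)
  case (single k x)
  have 1: "P 1" using c[of 1] by simp
  have "P (mvar i ^ n)" for i n by (induction n) (auto intro: m v 1)
  then have "P (\<Prod>i\<in>A. mvar i ^ Poly_Mapping.lookup k i)" for A
    by (induction A rule: infinite_finite_induct) (auto intro: m 1)
  then show ?case unfolding single_eq_prod_mvar by (intro m c)
qed (rule a)

lemma meval_add: "meval a (p + q) = meval a p + meval a q"
  unfolding meval_def by (rule pm_sum_add) (auto simp: algebra_simps)

lemma meval_single: "meval a (Poly_Mapping.single m c) = c * (\<Prod>i\<in>UNIV. a i ^ Poly_Mapping.lookup m i)"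
  unfolding meval_def by (cases "c = 0") auto

lemma meval_mult: "meval a (p * q) = meval a p * meval a q"
proof (induction p rule: pm_induct)
  case (single k v)
  show ?case
    by (induction q rule: pm_induct)
      (simp_all add: meval_add mult_single meval_single lookup_add power_add prod.distrib distrib_left)
qed (simp add: meval_add distrib_right)

lemma meval_const [simp]: "meval a (mconst c) = c"
  by (simp add: mconst_def meval_single)

lemma meval_0 [simp]: "meval a 0 = 0"
  by (simp add: meval_def)

lemma meval_1 [simp]: "meval a 1 = 1"
  using meval_const[of a 1] by simp

lemma meval_var [simp]: "meval a (mvar i) = a i"
proof -
  have "(\<Prod>j\<in>UNIV. a j ^ Poly_Mapping.lookup (Poly_Mapping.single i (1::nat)) j) = (\<Prod>j\<in>UNIV. if j = i then a j else 1)"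
    by (intro prod.cong) (auto simp: lookup_single when_def)
  then show ?thesis by (simp add: mvar_def meval_single)
qed

lemma meval_uminus: "meval a (- p) = - meval a p"
  using meval_add[of a p "- p"] by (simp add: eq_neg_iff_add_eq_0 add.commute)

lemma meval_diff: "meval a (p - q) = meval a p - meval a q"
  using meval_add[of a p "- q"] by (simp add: meval_uminus)

lemma meval_sum: "meval a (\<Sum>k\<in>S. f k) = (\<Sum>k\<in>S. meval a (f k))"
  by (induction S rule: infinite_finite_induct) (simp_all add: meval_add)

lemma meval_prod: "meval a (\<Prod>k\<in>S. f k) = (\<Prod>k\<in>S. meval a (f k))"
  by (induction S rule: infinite_finite_induct) (simp_all add: meval_mult)

lemma meval_power: "meval a (p ^ n) = meval a p ^ n"
  by (induction n) (simp_all add: meval_mult)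

lemma meval_of_int: "meval a (of_int n) = of_int n"
  by (metis mconst_of_int meval_const)

text \<open>Read off coefficientwise, the derivative involves no truncated subtraction of exponents;
  this form shows when a coefficient of a derivative is nonzero.\<close>

lemma lookup_mpderiv:
  "Poly_Mapping.lookup (mpderiv i p) m
     = of_nat (Poly_Mapping.lookup m i + 1) * Poly_Mapping.lookup p (m + Poly_Mapping.single i 1)"
proof (induction p rule: pm_induct)
  case (single k v)
  show ?case
  proof (cases "Poly_Mapping.lookup k i = 0")
    case True
    then have "k \<noteq> m + Poly_Mapping.single i 1"
      by (metis One_nat_def add_eq_0_iff_both_eq_0 lookup_add lookup_single_eq one_neq_zero)
    with True show ?thesis by (simp add: mpderiv_single lookup_single when_def)
  next
    case False
    have "k - Poly_Mapping.single i 1 = m \<longleftrightarrow> k = m + Poly_Mapping.single i 1"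
    proof
      assume *: "k - Poly_Mapping.single i 1 = m"
      show "k = m + Poly_Mapping.single i 1"
        unfolding *[symmetric] using False
        by (intro poly_mapping_eqI) (auto simp: lookup_add lookup_minus lookup_single when_def)
    next
      assume *: "k = m + Poly_Mapping.single i 1"
      show "k - Poly_Mapping.single i 1 = m" unfolding * by simp
    qed
    then show ?thesis by (auto simp: mpderiv_single lookup_single when_def lookup_add)
  qed
qed (simp add: mpderiv_add lookup_add algebra_simps)

lemma mpderiv_const [simp]: "mpderiv i (mconst c) = 0"
  by (simp add: mconst_def mpderiv_single)

lemma mpderiv_var: "mpderiv i (mvar j) = (if i = j then 1 else 0)"
  by (simp add: mvar_def mpderiv_single lookup_single)

lemma mpderiv_1 [simp]: "mpderiv i 1 = 0"
  using mpderiv_const[of i 1] by simp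

lemma mpderiv_sum: "mpderiv i (\<Sum>k\<in>S. f k) = (\<Sum>k\<in>S. mpderiv i (f k))"
  by (induction S rule: infinite_finite_induct) (simp_all add: mpderiv_add mpderiv_zero)

section \<open>Total degree and the spaces of polynomials of bounded degree\<close>

definition tdeg :: "('v::finite \<Rightarrow>\<^sub>0 nat) \<Rightarrow> nat"
  where "tdeg m = (\<Sum>i\<in>UNIV. Poly_Mapping.lookup m i)"

lemma tdeg_add: "tdeg (m + m') = tdeg m + tdeg m'"
  by (simp add: tdeg_def lookup_add sum.distrib)

lemma tdeg_single [simp]: "tdeg (Poly_Mapping.single i n) = n"
  by (simp add: tdeg_def lookup_single when_def)

lemma tdeg_0 [simp]: "tdeg 0 = 0"
  by (simp add: tdeg_def)

lemma tdeg_eq_0: "tdeg m = 0 \<longleftrightarrow> m = 0"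
  by (auto simp: tdeg_def intro!: poly_mapping_eqI)

lemma lookup_le_tdeg: "Poly_Mapping.lookup m i \<le> tdeg m"
  unfolding tdeg_def by (rule member_le_sum) auto

lemma finite_tdeg_le: "finite {m :: 'v::finite \<Rightarrow>\<^sub>0 nat. tdeg m \<le> e}"
proof -
  have "Poly_Mapping.lookup ` {m :: 'v \<Rightarrow>\<^sub>0 nat. tdeg m \<le> e} \<subseteq> PiE UNIV (\<lambda>_. {..e})"
    using lookup_le_tdeg le_trans by fastforce
  moreover have "finite (PiE (UNIV :: 'v set) (\<lambda>_. {..e}))" by (intro finite_PiE) auto
  ultimately have "finite (Poly_Mapping.lookup ` {m :: 'v \<Rightarrow>\<^sub>0 nat. tdeg m \<le> e})" by (rule finite_subset)
  moreover have "inj_on Poly_Mapping.lookup {m :: 'v \<Rightarrow>\<^sub>0 nat. tdeg m \<le> e}"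
    by (auto intro!: inj_onI poly_mapping_eqI)
  ultimately show ?thesis by (rule finite_imageD)
qed

definition polys_le :: "nat \<Rightarrow> 'v::finite mpoly set"
  where "polys_le e = {p. \<forall>m\<in>Poly_Mapping.keys p. tdeg m \<le> e}"

lemma polys_le_mono: "p \<in> polys_le d \<Longrightarrow> d \<le> e \<Longrightarrow> p \<in> polys_le e"
  by (force simp: polys_le_def)

lemma polys_le_0 [simp]: "0 \<in> polys_le e"
  by (simp add: polys_le_def)

lemma polys_le_add: "p \<in> polys_le e \<Longrightarrow> q \<in> polys_le e \<Longrightarrow> p + q \<in> polys_le e"
  using keys_add[of p q] by (auto simp: polys_le_def)

lemma polys_le_uminus: "p \<in> polys_le e \<Longrightarrow> - p \<in> polys_le e"
  by (auto simp: polys_le_def in_keys_iff)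

lemma polys_le_diff: "p \<in> polys_le e \<Longrightarrow> q \<in> polys_le e \<Longrightarrow> p - q \<in> polys_le e"
  using polys_le_add[of p e "- q"] by (simp add: polys_le_uminus)

lemma polys_le_mult: "p \<in> polys_le d \<Longrightarrow> q \<in> polys_le e \<Longrightarrow> p * q \<in> polys_le (d + e)"
  using keys_mult[of p q] by (fastforce simp: polys_le_def tdeg_add intro: add_mono)

lemma polys_le_const [simp]: "mconst c \<in> polys_le e"
  by (auto simp: polys_le_def mconst_def split: if_splits)

lemma polys_le_var [simp]: "1 \<le> e \<Longrightarrow> mvar i \<in> polys_le e"
  by (auto simp: polys_le_def mvar_def)

lemma polys_le_1 [simp]: "1 \<in> polys_le e"
  using polys_le_const[of 1] by simp

lemma polys_le_sum: "(\<And>k. k \<in> S \<Longrightarrow> f k \<in> polys_le e) \<Longrightarrow> (\<Sum>k\<in>S. f k) \<in> polys_le e"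
  by (induction S rule: infinite_finite_induct) (auto intro: polys_le_add)

lemma polys_le_power: "p \<in> polys_le e \<Longrightarrow> p ^ n \<in> polys_le (n * e)"
  by (induction n) (auto intro: polys_le_mult)

lemma polys_le_single: "tdeg m \<le> e \<Longrightarrow> Poly_Mapping.single m c \<in> polys_le e"
  by (auto simp: polys_le_def split: if_splits)

lemma polys_le_deriv: "p \<in> polys_le e \<Longrightarrow> mpderiv i p \<in> polys_le (e - 1)"
proof (unfold polys_le_def, clarify)
  fix m assume p: "\<forall>m\<in>Poly_Mapping.keys p. tdeg m \<le> e" and "m \<in> Poly_Mapping.keys (mpderiv i p)"
  then have "m + Poly_Mapping.single i 1 \<in> Poly_Mapping.keys p"
    by (auto simp: in_keys_iff lookup_mpderiv)
  with p have "tdeg (m + Poly_Mapping.single i 1) \<le> e" by blast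
  then show "tdeg m \<le> e - 1" by (simp add: tdeg_add)
qed

lemma polys_le_ex: "\<exists>e. p \<in> polys_le e"
proof -
  have "p \<in> polys_le (Max (tdeg ` Poly_Mapping.keys p))" by (auto simp: polys_le_def)
  then show ?thesis ..
qed

lemma mpoly_eq_sum: "p = (\<Sum>m\<in>Poly_Mapping.keys p. mconst (Poly_Mapping.lookup p m) * Poly_Mapping.single m 1)"
  by (rule poly_mapping_eqI)
     (auto simp: lookup_sum mconst_def mult_single lookup_single when_def in_keys_iff sum.delta')

section \<open>Krull dimension and growth of functions\<close>

text \<open>Adding \<open>p\<close>, respectively \<open>q\<close>, to the equations of
  \<open>Z\<close> writes \<open>Z\<close> as a union of two closed sets; so the functions vanishing
  on an irreducible set form a prime ideal.\<close>

lemma zariski_irreducible_prime: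
  assumes Z: "zariski_irreducible Z" and pq: "\<And>a. a \<in> Z \<Longrightarrow> meval a p * meval a q = 0"
  shows "(\<forall>a\<in>Z. meval a p = 0) \<or> (\<forall>a\<in>Z. meval a q = 0)"
proof -
  obtain S where S: "Z = zero_set S" using Z by (auto simp: zariski_irreducible_def zariski_closed_def)
  have "Z = zero_set (insert p S) \<union> zero_set (insert q S)"
    using pq unfolding S zero_set_def by auto
  moreover have "zariski_closed (zero_set T)" for T :: "'a mpoly set" by (auto simp: zariski_closed_def)
  ultimately have "Z = zero_set (insert p S) \<or> Z = zero_set (insert q S)"
    using Z by (auto simp: zariski_irreducible_def)
  then show ?thesis by (auto simp: zero_set_def)
qed

text \<open>Exponents are lists because a chain of closed sets contributes one function at a time,
  prepended to those found below it.\<close>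

fun list_monom :: "'a::comm_ring_1 list \<Rightarrow> nat list \<Rightarrow> 'a" where
  "list_monom [] js = 1"
| "list_monom (f # fs) js = f ^ hd js * list_monom fs (tl js)"

text \<open>A box of exponents instead of a bound on the total degree: its cardinality is exactly
  \<open>L ^ d\<close>, and it splits as a product when a function is prepended.\<close>

definition exponents :: "nat \<Rightarrow> nat \<Rightarrow> nat list set"
  where "exponents d L = {js. set js \<subseteq> {..<L} \<and> length js = d}"

lemma exponents_0 [simp]: "exponents 0 L = {[]}"
  by (auto simp: exponents_def)

lemma finite_exponents [simp]: "finite (exponents d L)"
  unfolding exponents_def by (rule finite_lists_length_eq) simp

lemma card_exponents: "card (exponents d L) = L ^ d"
  unfolding exponents_def by (simp add: card_lists_length_eq)

lemma exponents_Suc: "exponents (Suc d) L = (\<lambda>(j, js). j # js) ` ({..<L} \<times> exponents d L)"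
  by (auto simp: exponents_def length_Suc_conv image_iff)

lemma sum_exponents_Suc:
  "(\<Sum>js\<in>exponents (Suc d) L. h js) = (\<Sum>j<L. \<Sum>js\<in>exponents d L. h (j # js))"
proof -
  have "inj_on (\<lambda>(j, js). j # js) ({..<L} \<times> exponents d L)" by (auto simp: inj_on_def)
  then show ?thesis
    unfolding exponents_Suc
    by (subst sum.reindex) (auto simp: sum.cartesian_product case_prod_unfold)
qed

definition alg_independent_on :: "('w::finite \<Rightarrow> complex) set \<Rightarrow> 'w mpoly list \<Rightarrow> bool"
  where "alg_independent_on Z fs \<longleftrightarrow> (\<forall>L c.
    (\<forall>a\<in>Z. (\<Sum>js\<in>exponents (length fs) L. c js * meval a (list_monom fs js)) = 0)
      \<longrightarrow> (\<forall>js\<in>exponents (length fs) L. c js = 0))"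

text \<open>Sort a relation on \<open>Z'\<close> by powers of \<open>p\<close> and divide by the
  lowest power that occurs. Since \<open>Z'\<close> is irreducible and \<open>p\<close> is not zero
  on it, the cofactor still vanishes on \<open>Z'\<close>; on \<open>Z\<close>, where
  \<open>p\<close> vanishes, only its constant term in \<open>p\<close> survives, and this is a
  relation among \<open>fs\<close>.\<close>

lemma alg_independent_on_Cons:
  assumes ind: "alg_independent_on Z fs" and ZZ: "Z \<subseteq> Z'" and irr: "zariski_irreducible Z'"
    and p0: "\<And>a. a \<in> Z \<Longrightarrow> meval a p = 0" and p1: "\<exists>a\<in>Z'. meval a p \<noteq> 0"
  shows "alg_independent_on Z' (p # fs)"
  unfolding alg_independent_on_def
proof (intro allI impI)
  fix L and c :: "nat list \<Rightarrow> complex"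
  define g where "g j = (\<Sum>js\<in>exponents (length fs) L. mconst (c (j # js)) * list_monom fs js)" for j
  assume "\<forall>a\<in>Z'. (\<Sum>js\<in>exponents (length (p # fs)) L. c js * meval a (list_monom (p # fs) js)) = 0"
  then have z: "(\<Sum>j<L. meval a p ^ j * meval a (g j)) = 0" if "a \<in> Z'" for a
    using that by (simp add: sum_exponents_Suc g_def meval_sum meval_mult meval_power
      sum_distrib_left mult.assoc mult.left_commute)
  have c0: "\<forall>js\<in>exponents (length fs) L. c (j # js) = 0" if "j < L" for j
    using that
  proof (induction j rule: less_induct)
    case (less j)
    have gz: "g i = 0" if "i < j" for i
      unfolding g_def using less.IH[OF that] that less.prems by (intro sum.neutral) auto
    define h where "h = (\<Sum>i=j..<L. p ^ (i - j) * g i)"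
    have "meval a (p ^ j) * meval a h = 0" if a: "a \<in> Z'" for a
    proof -
      have "meval a (p ^ j) * meval a h = (\<Sum>i=j..<L. meval a p ^ i * meval a (g i))"
        unfolding h_def
        by (auto simp: meval_sum meval_mult meval_power sum_distrib_left mult.assoc[symmetric]
            power_add[symmetric] intro!: sum.cong)
      also have "\<dots> = (\<Sum>i<L. meval a p ^ i * meval a (g i))"
        by (rule sum.mono_neutral_left) (auto simp: gz)
      finally show ?thesis using z[OF a] by simp
    qed
    from zariski_irreducible_prime[OF irr this] p1
    have h0: "\<forall>a\<in>Z'. meval a h = 0" by (auto simp: meval_power)
    have "meval a (g j) = 0" if a: "a \<in> Z" for a
    proof -
      have "meval a h = (\<Sum>i=j..<L. if i = j then meval a (g i) else 0)"
        unfolding h_def meval_sum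
        by (rule sum.cong) (auto simp: meval_mult meval_power p0[OF a])
      then have "meval a h = meval a (g j)" using less.prems by simp
      then show ?thesis using h0 a ZZ by auto
    qed
    then have "\<forall>a\<in>Z. (\<Sum>js\<in>exponents (length fs) L. c (j # js) * meval a (list_monom fs js)) = 0"
      by (simp add: g_def meval_sum meval_mult)
    with ind[unfolded alg_independent_on_def, THEN spec[of _ L], THEN spec[of _ "\<lambda>js. c (j # js)"]]
    show ?case by blast
  qed
  show "\<forall>js\<in>exponents (length (p # fs)) L. c js = 0"
    using c0 by (auto simp: exponents_Suc)
qed

lemma alg_independent_on_chain:
  assumes "\<And>i. i \<le> d \<Longrightarrow> zariski_irreducible (Z i)" "\<And>i. i < d \<Longrightarrow> Z i \<subset> Z (Suc i)"
  shows "\<exists>fs. length fs = d \<and> alg_independent_on (Z d) fs"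
  using assms
proof (induction d)
  case 0
  then have "Z 0 \<noteq> {}" by (auto simp: zariski_irreducible_def)
  then show ?case by (auto simp: alg_independent_on_def)
next
  case (Suc d)
  then obtain fs where fs: "length fs = d" "alg_independent_on (Z d) fs" by force
  have "zariski_irreducible (Z d)" using Suc.prems by simp
  then obtain S where S: "Z d = zero_set S" by (auto simp: zariski_irreducible_def zariski_closed_def)
  have sub: "Z d \<subset> Z (Suc d)" using Suc.prems by simp
  then obtain b where b: "b \<in> Z (Suc d)" "b \<notin> Z d" by auto
  then obtain p where p: "p \<in> S" "meval b p \<noteq> 0" by (auto simp: S zero_set_def)
  have "alg_independent_on (Z (Suc d)) (p # fs)"
    using fs(2) sub Suc.prems b p by (intro alg_independent_on_Cons[of "Z d"]) (auto simp: S zero_set_def)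
  with fs(1) show ?case by (intro exI[of _ "p # fs"]) simp
qed

lemma list_monom_polys_le:
  assumes "\<And>f. f \<in> set fs \<Longrightarrow> f \<in> polys_le E" "js \<in> exponents (length fs) L"
  shows "list_monom fs js \<in> polys_le (length fs * (L * E))"
  using assms
proof (induction fs arbitrary: js)
  case (Cons f fs)
  then obtain j js' where js: "js = j # js'" "j < L" "js' \<in> exponents (length fs) L"
    by (auto simp: exponents_Suc)
  have "f ^ j \<in> polys_le (j * E)" using Cons.prems by (intro polys_le_power) auto
  then have "f ^ j \<in> polys_le (L * E)" by (rule polys_le_mono) (use js in auto)
  moreover have "list_monom fs js' \<in> polys_le (length fs * (L * E))" using Cons js by auto
  ultimately show ?case by (simp add: js polys_le_mult)
qed simp

text \<open>The \<open>L ^ d\<close> monomials in \<open>fs\<close> have degree at most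
  \<open>k\<close>, which grows linearly in \<open>L\<close>, while at most
  \<open>C * (k + 1) ^ N\<close> functions span them on \<open>V\<close>. For \<open>d > N\<close>
  and large \<open>L\<close> a linear dependence is forced.\<close>

lemma alg_independent_on_length_le:
  fixes V :: "('w::finite \<Rightarrow> complex) set"
  assumes growth: "\<And>k. \<exists>G :: 'w mpoly set. finite G \<and> card G \<le> C * (k + 1) ^ N \<and>
      (\<forall>p\<in>polys_le k. \<exists>c. \<forall>a\<in>V. meval a p = (\<Sum>g\<in>G. c g * meval a g))"
    and ind: "alg_independent_on Z fs" and ZV: "Z \<subseteq> V"
  shows "length fs \<le> N"
proof (rule ccontr)
  define d where "d = length fs"
  assume "\<not> length fs \<le> N"
  then have d: "d \<ge> Suc N" by (simp add: d_def)
  obtain e where e: "\<And>f. f \<in> set fs \<Longrightarrow> f \<in> polys_le (e f)" using polys_le_ex by metis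
  define E where "E = Max (e ` set fs)"
  have E: "f \<in> polys_le E" if "f \<in> set fs" for f
    using e[OF that] by (rule polys_le_mono) (use that in \<open>auto simp: E_def\<close>)
  \<comment> \<open>The added 1 makes \<open>L\<close> exceed \<open>C * (d * E + 1) ^ N\<close>;
    with \<open>k + 1 \<le> (d * E + 1) * L\<close> there are then fewer than
    \<open>L ^ Suc N\<close> spanning functions.\<close>
  define L where "L = C * (d * E + 1) ^ N + 1"
  define k where "k = d * (L * E)"
  have L1: "L \<ge> 1" by (simp add: L_def)
  have "C * (k + 1) ^ N \<le> C * ((d * E + 1) * L) ^ N"
    using L1 by (intro mult_left_mono power_mono) (auto simp: k_def algebra_simps)
  also have "\<dots> = C * (d * E + 1) ^ N * L ^ N" by (simp only: power_mult_distrib mult.assoc)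
  also have "\<dots> < L * L ^ N" using L1 by (intro mult_strict_right_mono) (simp_all add: L_def)
  also have "\<dots> = L ^ Suc N" by simp
  also have "\<dots> \<le> L ^ d" using d L1 by (intro power_increasing) auto
  finally have less: "C * (k + 1) ^ N < L ^ d" .
  from growth[of k] obtain G where G: "finite G" "card G \<le> C * (k + 1) ^ N"
    "\<forall>p\<in>polys_le k. \<exists>c. \<forall>a\<in>V. meval a p = (\<Sum>g\<in>G. c g * meval a g)" by blast
  have "list_monom fs js \<in> polys_le k" if "js \<in> exponents d L" for js
    using list_monom_polys_le[OF E that[unfolded d_def]] by (simp add: k_def d_def)
  with G(3) have "\<forall>js\<in>exponents d L. \<exists>c. \<forall>a\<in>V. meval a (list_monom fs js) = (\<Sum>g\<in>G. c g * meval a g)"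
    by blast
  then obtain b where b: "\<And>js a. js \<in> exponents d L \<Longrightarrow> a \<in> V \<Longrightarrow>
      meval a (list_monom fs js) = (\<Sum>g\<in>G. b js g * meval a g)" by metis
  have "card G < card (exponents d L)" using G(2) less by (simp add: card_exponents)
  from homogeneous_system_solution[OF G(1) finite_exponents this, of b]
  obtain c where c: "\<exists>js\<in>exponents d L. c js \<noteq> 0"
    "\<And>g. g \<in> G \<Longrightarrow> (\<Sum>js\<in>exponents d L. c js * b js g) = 0" by blast
  have "(\<Sum>js\<in>exponents d L. c js * meval a (list_monom fs js)) = 0" if "a \<in> Z" for a
  proof -
    have aV: "a \<in> V" using that ZV by auto
    have "(\<Sum>js\<in>exponents d L. c js * meval a (list_monom fs js))
        = (\<Sum>js\<in>exponents d L. \<Sum>g\<in>G. c js * b js g * meval a g)"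
      by (simp add: b[OF _ aV] sum_distrib_left mult.assoc)
    also have "\<dots> = (\<Sum>g\<in>G. (\<Sum>js\<in>exponents d L. c js * b js g) * meval a g)"
      by (subst sum.swap) (simp add: sum_distrib_right)
    finally show ?thesis by (simp add: c(2))
  qed
  with ind c(1) show False unfolding alg_independent_on_def d_def by blast
qed

lemma meval_on_line: "\<exists>P :: complex poly. \<forall>t. poly P t = meval (\<lambda>w. a w + t * (b w - a w)) p"
proof (induction p rule: mpoly_induct)
  case (const c)
  show ?case by (intro exI[of _ "[:c:]"]) simp
next
  case (var i)
  show ?case by (intro exI[of _ "[:a i, b i - a i:]"]) simp
next
  case (add p q)
  then obtain P Q where "\<forall>t. poly P t = meval (\<lambda>w. a w + t * (b w - a w)) p"
    "\<forall>t. poly Q t = meval (\<lambda>w. a w + t * (b w - a w)) q" by auto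
  then show ?case by (intro exI[of _ "P + Q"]) (simp add: meval_add)
next
  case (mult p q)
  then obtain P Q where "\<forall>t. poly P t = meval (\<lambda>w. a w + t * (b w - a w)) p"
    "\<forall>t. poly Q t = meval (\<lambda>w. a w + t * (b w - a w)) q" by auto
  then show ?case by (intro exI[of _ "P * Q"]) (simp add: meval_mult)
qed

text \<open>If neither closed part is everything, choose a point of \<open>L\<close> outside each
  and join them by a line inside \<open>L\<close>. Two equations violated at these points restrict
  to nonzero univariate polynomials whose product vanishes along the line.\<close>

lemma zariski_irreducible_coordinate_subspace:
  fixes S :: "'w::finite set"
  defines "L \<equiv> {a :: 'w \<Rightarrow> complex. \<forall>w. w \<notin> S \<longrightarrow> a w = 0}"
  shows "zariski_irreducible L"
  unfolding zariski_irreducible_def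
proof (intro conjI allI impI)
  show "zariski_closed L"
    unfolding zariski_closed_def by (rule exI[of _ "mvar ` (- S)"]) (auto simp: L_def zero_set_def)
  have "(\<lambda>_. 0) \<in> L" by (simp add: L_def)
  then show "L \<noteq> {}" by blast
  fix A B assume "zariski_closed A \<and> zariski_closed B \<and> L = A \<union> B"
  then obtain SA SB where A: "A = zero_set SA" and B: "B = zero_set SB" and LAB: "L = A \<union> B"
    by (auto simp: zariski_closed_def)
  show "L = A \<or> L = B"
  proof (rule ccontr)
    assume "\<not> ?thesis"
    then obtain a b where ab: "a \<in> L" "a \<notin> A" "b \<in> L" "b \<notin> B" using LAB by auto
    then obtain p q where p: "p \<in> SA" "meval a p \<noteq> 0" and q: "q \<in> SB" "meval b q \<noteq> 0"
      by (auto simp: A B zero_set_def)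
    obtain P Q where P: "\<And>t. poly P t = meval (\<lambda>w. a w + t * (b w - a w)) p"
      and Q: "\<And>t. poly Q t = meval (\<lambda>w. a w + t * (b w - a w)) q"
      using meval_on_line[of a b p] meval_on_line[of a b q] by auto
    have "poly (P * Q) t = 0" for t
    proof -
      have "(\<lambda>w. a w + t * (b w - a w)) \<in> L" using ab by (auto simp: L_def)
      then have "(\<lambda>w. a w + t * (b w - a w)) \<in> A \<union> B" using LAB by simp
      then show ?thesis using p q by (auto simp: P Q A B zero_set_def)
    qed
    then have "P * Q = 0" by (metis poly_all_0_iff_0)
    then have "P = 0 \<or> Q = 0" by simp
    moreover have "poly P 0 \<noteq> 0" "poly Q 1 \<noteq> 0" using p q by (simp_all add: P Q)
    ultimately show False by auto
  qed
qed

text \<open>A chain of length \<open>d\<close> in \<open>V\<close> yields \<open>d\<close> functions algebraically independent on \<open>V\<close>, and the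
  monomials in these grow too fast if \<open>d > N\<close>.\<close>

lemma krull_dim_eqI:
  fixes V :: "('w::finite \<Rightarrow> complex) set"
  assumes growth: "\<And>k. \<exists>G :: 'w mpoly set. finite G \<and> card G \<le> C * (k + 1) ^ N \<and>
      (\<forall>p\<in>polys_le k. \<exists>c. \<forall>a\<in>V. meval a p = (\<Sum>g\<in>G. c g * meval a g))"
    and S: "card S = N" "{a. \<forall>w. w \<notin> S \<longrightarrow> a w = 0} \<subseteq> V"
  shows "krull_dim V = enat N"
  unfolding krull_dim_def
proof (rule antisym)
  show "Sup {enat d |d. \<exists>Z :: nat \<Rightarrow> ('w \<Rightarrow> complex) set.
     (\<forall>i\<le>d. zariski_irreducible (Z i) \<and> Z i \<subseteq> V) \<and> (\<forall>i<d. Z i \<subset> Z (Suc i))} \<le> enat N"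
  proof (rule Sup_least, clarify)
    fix d and Z :: "nat \<Rightarrow> ('w \<Rightarrow> complex) set"
    assume Z: "\<forall>i\<le>d. zariski_irreducible (Z i) \<and> Z i \<subseteq> V" "\<forall>i<d. Z i \<subset> Z (Suc i)"
    then obtain fs where fs: "length fs = d" "alg_independent_on (Z d) fs"
      using alg_independent_on_chain[of d Z] by blast
    have "length fs \<le> N" using alg_independent_on_length_le[OF growth fs(2)] Z by blast
    with fs show "enat d \<le> enat N" by simp
  qed
  \<comment> \<open>The lower bound comes from a flag of coordinate subspaces, the coordinates in
    \<open>S\<close> being released one after another.\<close>
  obtain f where f: "bij_betw f {..<N} S"
    using ex_bij_betw_nat_finite[of S] S(1) by (auto simp: atLeast0LessThan)
  define Z where "Z i = {a :: 'w \<Rightarrow> complex. \<forall>w. w \<notin> f ` {..<i} \<longrightarrow> a w = 0}" for i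
  have "Z i \<subseteq> V" if "i \<le> N" for i
  proof -
    have "f ` {..<i} \<subseteq> S" using f that by (auto simp: bij_betw_def)
    then have "Z i \<subseteq> {a. \<forall>w. w \<notin> S \<longrightarrow> a w = 0}" unfolding Z_def by blast
    with S(2) show ?thesis by auto
  qed
  moreover have "Z i \<subset> Z (Suc i)" if "i < N" for i
  proof
    show "Z i \<subseteq> Z (Suc i)" unfolding Z_def by (auto simp: lessThan_Suc)
    have "f i \<notin> f ` {..<i}"
      using f that inj_on_image_mem_iff[of f "{..<N}" i "{..<i}"] by (auto simp: bij_betw_def)
    then have "(\<lambda>w. if w = f i then 1 else 0) \<in> Z (Suc i) - Z i" by (auto simp: Z_def)
    then show "Z i \<noteq> Z (Suc i)" by blast
  qed
  ultimately have "\<exists>Z :: nat \<Rightarrow> ('w \<Rightarrow> complex) set.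
     (\<forall>i\<le>N. zariski_irreducible (Z i) \<and> Z i \<subseteq> V) \<and> (\<forall>i<N. Z i \<subset> Z (Suc i))"
    using zariski_irreducible_coordinate_subspace by (intro exI[of _ Z]) (auto simp: Z_def)
  then show "enat N \<le> Sup {enat d |d. \<exists>Z :: nat \<Rightarrow> ('w \<Rightarrow> complex) set.
     (\<forall>i\<le>d. zariski_irreducible (Z i) \<and> Z i \<subseteq> V) \<and> (\<forall>i<d. Z i \<subset> Z (Suc i))}"
    by (intro Sup_upper) blast
qed

section \<open>Left ideals and polynomials in the derivations\<close>

lemma hull_left_ideal_minimal: "left_ideal L \<Longrightarrow> S \<subseteq> L \<Longrightarrow> left_ideal hull S \<subseteq> L"
  by (rule hull_minimal)

lemma left_ideal_0: "left_ideal L \<Longrightarrow> 0 \<in> L"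
  and left_ideal_add: "left_ideal L \<Longrightarrow> a \<in> L \<Longrightarrow> b \<in> L \<Longrightarrow> a + b \<in> L"
  and left_ideal_mult: "left_ideal L \<Longrightarrow> a \<in> L \<Longrightarrow> r * a \<in> L"
  by (auto simp: left_ideal_def)

lemma left_ideal_uminus: "left_ideal L \<Longrightarrow> a \<in> L \<Longrightarrow> - a \<in> L"
  using left_ideal_mult[of L a "-1"] by simp

lemma left_ideal_diff: "left_ideal L \<Longrightarrow> a \<in> L \<Longrightarrow> b \<in> L \<Longrightarrow> a - b \<in> L"
  using left_ideal_add[of L a "- b"] left_ideal_uminus[of L b] by simp

lemma left_ideal_sum: "left_ideal L \<Longrightarrow> (\<And>k. k \<in> S \<Longrightarrow> f k \<in> L) \<Longrightarrow> (\<Sum>k\<in>S. f k) \<in> L"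
  by (induction S rule: infinite_finite_induct) (auto intro: left_ideal_0 left_ideal_add)

lemma left_ideal_mult_right: "left_ideal L \<Longrightarrow> a \<in> L \<Longrightarrow> a * r \<in> L" for r :: "'a::comm_ring_1"
  by (metis left_ideal_mult mult.commute)

lemma left_ideal_eq_UNIV: "left_ideal L \<Longrightarrow> 1 \<in> L \<Longrightarrow> L = UNIV"
  using left_ideal_mult[of L 1] by auto

lemma weyl_induct [case_names const x d add mult]:
  assumes c: "\<And>c. P (weyl_const c)" and x: "\<And>i. P (weyl_x i)" and d: "\<And>i. P (weyl_d i)"
    and a: "\<And>S T. P S \<Longrightarrow> P T \<Longrightarrow> P (S + T)" and m: "\<And>S T. P S \<Longrightarrow> P T \<Longrightarrow> P (S * T)"
  shows "P T"
proof -
  have "P (Abs_weyl S)" if "S \<in> weyl_ops" for S using that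
  proof (induction rule: weyl_ops.induct)
    case (const c') then show ?case using c[of c'] by (simp add: weyl_const_def)
  next
    case (var i) then show ?case using x[of i] by (simp add: weyl_x_def)
  next
    case (deriv i) then show ?case using d[of i] by (simp add: weyl_d_def)
  next
    case (add S T)
    then have "Abs_weyl (\<lambda>f. S f + T f) = Abs_weyl S + Abs_weyl T"
      by (simp add: plus_weyl.abs_eq eq_onp_def)
    with add a show ?case by simp
  next
    case (comp S T)
    then have "Abs_weyl (\<lambda>f. S (T f)) = Abs_weyl S * Abs_weyl T"
      by (simp add: times_weyl.abs_eq eq_onp_def)
    with comp m show ?case by simp
  qed
  from this[OF weyl_apply[of T]] show ?thesis by (simp add: weyl_apply_inverse)
qed

lemma weyl_d_x: "weyl_d j * weyl_x i = weyl_x i * weyl_d j + (if i = j then 1 else 0)"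
  by (rule weyl_eqI)
     (simp add: weyl_apply_add weyl_apply_mult weyl_apply_d weyl_apply_x mpderiv_mult mpderiv_var)

lemma cprod_commute:
  fixes f :: "'i \<Rightarrow> 'a::monoid_mult"
  assumes "finite A" and c: "\<And>i j. f i * f j = f j * f i" and z: "\<And>i. f i * z = z * f i"
  shows "cprod f A * z = z * cprod f A"
  using assms(1)
proof induction
  case (insert a A)
  have "f a * cprod f A * z = f a * z * cprod f A" using insert by (simp add: mult.assoc)
  also have "\<dots> = z * (f a * cprod f A)" by (simp add: z mult.assoc)
  finally show ?case using insert by (simp add: cprod_insert c)
qed simp

lemma cprod_distrib:
  fixes f g :: "'i \<Rightarrow> 'a::monoid_mult"
  assumes "finite A" and f: "\<And>i j. f i * f j = f j * f i" and g: "\<And>i j. g i * g j = g j * g i"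
    and fg: "\<And>i j. f i * g j = g j * f i"
  shows "cprod (\<lambda>i. f i * g i) A = cprod f A * cprod g A"
  using assms(1)
proof induction
  case (insert a A)
  have c: "(f i * g i) * (f j * g j) = (f j * g j) * (f i * g i)" for i j
  proof -
    have fg': "f i * (g j * X) = g j * (f i * X)" for i j X by (simp add: mult.assoc[symmetric] fg)
    have "(f i * g i) * (f j * g j) = (f i * f j) * (g i * g j)" by (simp add: mult.assoc fg')
    also have "\<dots> = (f j * f i) * (g j * g i)" by (subst f, subst g) (rule refl)
    also have "\<dots> = (f j * g j) * (f i * g i)" by (simp add: mult.assoc fg')
    finally show ?thesis .
  qed
  have "cprod (\<lambda>i. f i * g i) (insert a A) = (f a * g a) * (cprod f A * cprod g A)"
    using insert by (simp add: cprod_insert[of "\<lambda>i. f i * g i", OF c])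
  also have "\<dots> = (f a * cprod f A) * (g a * cprod g A)"
  proof -
    have "cprod f A * g a = g a * cprod f A" by (rule cprod_commute[OF insert(1) f fg])
    then have "g a * (cprod f A * X) = cprod f A * (g a * X)" for X by (simp add: mult.assoc[symmetric])
    then show ?thesis by (simp add: mult.assoc)
  qed
  also have "\<dots> = cprod f (insert a A) * cprod g (insert a A)"
    using insert by (simp add: cprod_insert f g)
  finally show ?case .
qed simp

text \<open>Substitution of the derivations for the variables. As a ring homomorphism it lets the
  equations in \<open>weyl_d\<close> be handled inside the commutative polynomial ring.\<close>

definition dop :: "'v::finite mpoly \<Rightarrow> 'v weyl"
  where "dop f = (\<Sum>m\<in>Poly_Mapping.keys f. weyl_const (Poly_Mapping.lookup f m)
     * cprod (\<lambda>i. weyl_d i ^ Poly_Mapping.lookup m i) UNIV)"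

lemma dop_add: "dop (f + g) = dop f + dop g"
  unfolding dop_def by (rule pm_sum_add) (auto simp: weyl_const_add algebra_simps)

lemma dop_single: "dop (Poly_Mapping.single m c)
   = weyl_const c * cprod (\<lambda>i. weyl_d i ^ Poly_Mapping.lookup m i) UNIV"
  unfolding dop_def
  by (rule pm_sum_single[where h = "\<lambda>m c. weyl_const c * cprod (\<lambda>i. weyl_d i ^ Poly_Mapping.lookup m i) UNIV"])
     simp

lemma dop_const: "dop (mconst c) = weyl_const c"
  by (simp add: mconst_def dop_single cprod_1)

lemma dop_0 [simp]: "dop 0 = 0"
  by (simp add: dop_def)

lemma dop_1 [simp]: "dop 1 = 1"
  using dop_const[of 1] by simp

lemma dop_var: "dop (mvar i) = weyl_d i"
proof -
  have "weyl_d i * cprod (\<lambda>j. weyl_d j ^ 0) UNIV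
      = cprod (\<lambda>j. weyl_d j ^ (0 + (if j = i then Suc 0 else 0))) UNIV"
    by (rule cprod_power_Suc[OF weyl_d_commute])
  moreover have "(\<lambda>j. weyl_d j ^ (0 + (if j = i then Suc 0 else 0)))
      = (\<lambda>j. weyl_d j ^ Poly_Mapping.lookup (Poly_Mapping.single i 1) j)"
    by (auto simp: fun_eq_iff lookup_single when_def)
  ultimately show ?thesis by (simp add: mvar_def dop_single cprod_1)
qed

lemma dop_mult: "dop (f * g) = dop f * dop g"
proof (induction f rule: pm_induct)
  case (single k v)
  show ?case
  proof (induction g rule: pm_induct)
    case (single l w)
    have *: "cprod (\<lambda>i. weyl_d i ^ Poly_Mapping.lookup (k + l) i) UNIV
        = cprod (\<lambda>i. weyl_d i ^ Poly_Mapping.lookup k i) UNIV * cprod (\<lambda>i. weyl_d i ^ Poly_Mapping.lookup l i) UNIV"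
      unfolding lookup_add power_add
      by (intro cprod_distrib power_commutes2 weyl_d_commute) auto
    show ?case
    proof -
      have "weyl_const w * (cprod (\<lambda>i. weyl_d i ^ Poly_Mapping.lookup k i) UNIV * X)
        = cprod (\<lambda>i. weyl_d i ^ Poly_Mapping.lookup k i) UNIV * (weyl_const w * X)" for X :: "'a weyl"
        by (simp only: mult.assoc[symmetric]
            weyl_const_commute[of w "cprod (\<lambda>i. weyl_d i ^ Poly_Mapping.lookup k i) UNIV"])
      with * show ?thesis by (simp add: mult_single dop_single weyl_const_mult mult.assoc)
    qed
  qed (simp add: dop_add distrib_left)
qed (simp add: dop_add distrib_right)

lemma dop_commute: "dop f * dop g = dop g * dop f"
  by (metis dop_mult mult.commute)

lemma dop_uminus: "dop (- f) = - dop f"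
  using dop_add[of f "- f"] by (simp add: eq_neg_iff_add_eq_0 add.commute)

lemma dop_diff: "dop (f - g) = dop f - dop g"
  using dop_add[of f "- g"] by (simp add: dop_uminus)

lemma dop_sum: "dop (\<Sum>k\<in>S. f k) = (\<Sum>k\<in>S. dop (f k))"
  by (induction S rule: infinite_finite_induct) (simp_all add: dop_add)

lemma dop_prod: "finite S \<Longrightarrow> dop (\<Prod>k\<in>S. f k) = cprod (\<lambda>k. dop (f k)) S"
  by (induction S rule: finite_induct) (simp_all add: dop_mult cprod_insert dop_commute)

lemma dop_of_int: "dop (of_int n) = of_int n"
proof -
  have n: "dop (of_nat k) = of_nat k" for k
    by (induction k) (simp_all add: dop_add)
  show ?thesis by (cases n rule: int_cases2) (simp_all add: n dop_uminus)
qed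

text \<open>Taking the commutator with \<open>weyl_x i\<close> is a derivation, so induction over
  products suffices. By this relation \<open>weyl_x i\<close> acts as minus a partial derivative in
  the dual variables.\<close>

lemma dop_x: "dop f * weyl_x i = weyl_x i * dop f + dop (mpderiv i f)"
proof (induction f rule: mpoly_induct)
  case (const c)
  show ?case by (simp add: dop_const weyl_const_commute)
next
  case (var j)
  show ?case by (simp add: dop_var weyl_d_x mpderiv_var)
next
  case (add p q)
  then show ?case by (simp add: dop_add mpderiv_add algebra_simps)
next
  case (mult p q)
  have "dop (p * q) * weyl_x i = dop p * (dop q * weyl_x i)" by (simp add: dop_mult mult.assoc)
  also have "\<dots> = (dop p * weyl_x i) * dop q + dop p * dop (mpderiv i q)"
    unfolding mult.IH(2) by (simp only: distrib_left mult.assoc)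
  also have "\<dots> = weyl_x i * dop (p * q) + dop (mpderiv i (p * q))"
    unfolding mult.IH(1) by (simp add: distrib_right mult.assoc dop_mult mpderiv_mult dop_add)
  finally show ?case .
qed

section \<open>Derivations and determinants\<close>

text \<open>Only additivity and the Leibniz rule: integers are then killed automatically, and
  complex constants are treated separately where they occur.\<close>

definition derivation :: "('a::comm_ring_1 \<Rightarrow> 'a) \<Rightarrow> bool"
  where "derivation D \<longleftrightarrow> (\<forall>a b. D (a + b) = D a + D b) \<and> (\<forall>a b. D (a * b) = D a * b + a * D b)"

lemma derivation_add: "derivation D \<Longrightarrow> D (a + b) = D a + D b"
  and derivation_mult: "derivation D \<Longrightarrow> D (a * b) = D a * b + a * D b"
  by (auto simp: derivation_def)

lemma derivation_0: "derivation D \<Longrightarrow> D 0 = 0"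
  using derivation_add[of D 0 0] by simp

lemma derivation_1: "derivation D \<Longrightarrow> D 1 = 0"
  using derivation_mult[of D 1 1] by simp

lemma derivation_uminus: "derivation D \<Longrightarrow> D (- a) = - D a"
  using derivation_add[of D a "- a"] derivation_0[of D] by (simp add: eq_neg_iff_add_eq_0 add.commute)

lemma derivation_diff: "derivation D \<Longrightarrow> D (a - b) = D a - D b"
  using derivation_add[of D a "- b"] derivation_uminus[of D b] by simp

lemma derivation_sum: "derivation D \<Longrightarrow> D (\<Sum>k\<in>S. f k) = (\<Sum>k\<in>S. D (f k))"
  by (induction S rule: infinite_finite_induct) (auto simp: derivation_add derivation_0)

lemma derivation_of_int: "derivation D \<Longrightarrow> D (of_int n) = 0"
proof -
  assume D: "derivation D"
  have n: "D (of_nat k) = 0" for k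
    by (induction k) (simp_all add: derivation_add[OF D] derivation_0[OF D] derivation_1[OF D])
  show ?thesis by (cases n rule: int_cases2) (simp_all add: n derivation_uminus[OF D])
qed

lemma derivation_power: "derivation D \<Longrightarrow> D (a ^ n) = of_nat n * a ^ (n - 1) * D a"
proof (induction n)
  case (Suc n)
  then show ?case by (cases n) (simp_all add: derivation_mult algebra_simps)
qed (simp add: derivation_1)

lemma derivation_prod:
  assumes D: "derivation D" and "finite S"
  shows "D (\<Prod>k\<in>S. f k) = (\<Sum>j\<in>S. \<Prod>k\<in>S. if k = j then D (f k) else f k)"
  using assms(2)
proof induction
  case (insert a S)
  have "(\<Prod>k\<in>S. if k = a then D (f k) else f k) = (\<Prod>k\<in>S. f k)"
    using insert by (intro prod.cong) auto
  moreover have "(\<Sum>j\<in>S. \<Prod>k\<in>insert a S. if k = j then D (f k) else f k)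
      = (\<Sum>j\<in>S. f a * (\<Prod>k\<in>S. if k = j then D (f k) else f k))"
  proof (rule sum.cong[OF refl])
    fix j assume "j \<in> S"
    with insert have "a \<noteq> j" by auto
    with insert show "(\<Prod>k\<in>insert a S. if k = j then D (f k) else f k) = f a * (\<Prod>k\<in>S. if k = j then D (f k) else f k)"
      by simp
  qed
  ultimately show ?case
    using insert by (simp add: derivation_mult[OF D] sum_distrib_left)
qed (simp add: derivation_1[OF D])

lemma det_row_replace:
  fixes M :: "'a::comm_ring_1^'n^'n"
  shows "det (\<chi> i. if i = k then M $ l else M $ i) = (if l = k then det M else 0)"
proof (cases "l = k")
  case True
  then have "(\<chi> i. if i = k then M $ l else M $ i) = M" by (simp add: vec_eq_iff)
  then show ?thesis using True by simp
next
  case False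
  then show ?thesis
    by (simp, intro det_identical_rows[of l k]) (auto simp: row_def vec_eq_iff)
qed

lemma det_row_combination:
  fixes M :: "'a::comm_ring_1^'n^'n"
  shows "det (\<chi> i. if i = k then (\<Sum>l\<in>UNIV. c l *s M $ l) else M $ i) = c k * det M"
proof -
  have "det (\<chi> i. if i = k then (\<Sum>l\<in>UNIV. c l *s M $ l) else M $ i)
      = (\<Sum>l\<in>UNIV. det (\<chi> i. if i = k then c l *s M $ l else M $ i))"
    by (rule det_linear_row_sum) simp
  also have "\<dots> = (\<Sum>l\<in>UNIV. c l * (if l = k then det M else 0))"
    by (simp add: det_row_mul det_row_replace)
  finally show ?thesis by (simp add: if_distrib[of "(*) _"] cong: if_cong)
qed

lemma derivation_det:
  fixes M :: "'a::comm_ring_1^'n^'n"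
  assumes D: "derivation D"
  shows "D (det M) = (\<Sum>k\<in>UNIV. det (\<chi> i. if i = k then (\<chi> j. D (M $ i $ j)) else M $ i))"
proof -
  have "D (det M) = (\<Sum>p | p permutes UNIV. of_int (sign p) * D (\<Prod>i\<in>UNIV. M $ i $ p i))"
    by (simp add: det_def derivation_sum[OF D] derivation_mult[OF D] derivation_of_int[OF D])
  also have "\<dots> = (\<Sum>p | p permutes UNIV. \<Sum>k\<in>UNIV. of_int (sign p)
      * (\<Prod>i\<in>UNIV. if i = k then D (M $ i $ p i) else M $ i $ p i))"
    by (simp add: derivation_prod[OF D] sum_distrib_left)
  also have "\<dots> = (\<Sum>k\<in>UNIV. \<Sum>p | p permutes UNIV. of_int (sign p)
      * (\<Prod>i\<in>UNIV. (if i = k then (\<chi> j. D (M $ i $ j)) else M $ i) $ p i))"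
    by (subst sum.swap) (intro sum.cong refl arg_cong2[where f = "(*)"] prod.cong; auto)
  finally show ?thesis by (simp add: det_def)
qed

text \<open>Jacobi's formula without inverting \<open>M\<close>: after transposition the derivative
  of row \<open>k\<close> is a combination of the rows, and only the multiple of row
  \<open>k\<close> itself contributes to the determinant.\<close>

lemma derivation_det_right:
  fixes M B :: "'a::comm_ring_1^'n^'n"
  assumes D: "derivation D" and MB: "\<And>i j. D (M $ i $ j) = (M ** B) $ i $ j"
  shows "D (det M) = trace B * det M"
proof -
  let ?M = "transpose M"
  have "D (det M) = D (det ?M)" by simp
  also have "\<dots> = (\<Sum>k\<in>UNIV. det (\<chi> i. if i = k then (\<Sum>l\<in>UNIV. B $ l $ k *s ?M $ l) else ?M $ i))"
    unfolding derivation_det[OF D]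
    by (intro sum.cong refl arg_cong[where f = det])
       (auto simp: vec_eq_iff transpose_def MB matrix_matrix_mult_def mult.commute)
  also have "\<dots> = (\<Sum>k\<in>UNIV. B $ k $ k * det M)" by (simp only: det_row_combination det_transpose)
  finally show ?thesis by (simp add: trace_def sum_distrib_right)
qed

section \<open>The ideal of the special orthogonal group\<close>

definition ymat :: "('n::finite \<times> 'n) mpoly^'n^'n"
  where "ymat = (\<chi> i j. mvar (i, j))"

definition gram_cols :: "'n::finite \<Rightarrow> 'n \<Rightarrow> ('n \<times> 'n) mpoly"
  where "gram_cols i j = (if i = j then 1 else 0) - (\<Sum>k\<in>UNIV. mvar (k, i) * mvar (k, j))"

definition gram_rows :: "'n::finite \<Rightarrow> 'n \<Rightarrow> ('n \<times> 'n) mpoly"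
  where "gram_rows i j = (if i = j then 1 else 0) - (\<Sum>k\<in>UNIV. mvar (i, k) * mvar (j, k))"

definition so_ideal :: "('n::finite \<times> 'n) mpoly set"
  where "so_ideal = left_ideal hull ({gram_cols i j |i j. True} \<union> {gram_rows i j |i j. True} \<union> {1 - det ymat})"

definition rot :: "'n::finite \<Rightarrow> 'n \<Rightarrow> ('n \<times> 'n) mpoly \<Rightarrow> ('n \<times> 'n) mpoly"
  where "rot i j f = (\<Sum>k\<in>UNIV. mvar (k, i) * mpderiv (k, j) f - mvar (k, j) * mpderiv (k, i) f)"

lemma gram_cols_sym: "gram_cols i j = gram_cols j i"
  by (simp add: gram_cols_def mult.commute)

lemma gram_rows_sym: "gram_rows i j = gram_rows j i"
  by (simp add: gram_rows_def mult.commute)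

lemma left_ideal_so_ideal: "left_ideal so_ideal"
  unfolding so_ideal_def by (rule left_ideal_hull)

lemma gram_cols_in: "gram_cols i j \<in> so_ideal"
  and gram_rows_in: "gram_rows i j \<in> so_ideal"
  and det_in: "1 - det ymat \<in> so_ideal"
  unfolding so_ideal_def by (rule hull_inc, auto)+

lemma derivation_rot: "derivation (rot i j)"
  unfolding derivation_def rot_def
  by (auto simp: mpderiv_add mpderiv_mult algebra_simps sum.distrib sum_subtractf sum_distrib_left sum_distrib_right)

lemma rot_const [simp]: "rot i j (mconst c) = 0"
  by (simp add: rot_def)

lemma rot_const_mult: "rot i j (mconst c * f) = mconst c * rot i j f"
  by (simp add: derivation_mult[OF derivation_rot])

lemma rot_var: "rot i j (mvar (k, l)) = (if l = j then mvar (k, i) else 0) - (if l = i then mvar (k, j) else 0)"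
proof -
  have "(\<Sum>m\<in>UNIV. mvar (m, a) * mpderiv (m, b) (mvar (k, l))) = (if l = b then mvar (k, a) else 0)" for a b
  proof -
    have "(\<Sum>m\<in>UNIV. mvar (m, a) * mpderiv (m, b) (mvar (k, l)))
        = (\<Sum>m\<in>UNIV. if m = k then (if l = b then mvar (k, a) else 0) else 0)"
      by (rule sum.cong) (auto simp: mpderiv_var)
    then show ?thesis by simp
  qed
  then show ?thesis by (simp add: rot_def sum_subtractf)
qed

lemma rot_swap: "rot j i f = - rot i j f"
  by (simp add: rot_def sum_negf[symmetric])

lemma rot_same [simp]: "rot i i f = 0"
  by (simp add: rot_def)

text \<open>Since the rotation fields preserve the degree, they act on a finite-dimensional space of
  polynomials; the linear relation among powers of the Casimir operator depends on this.\<close>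

lemma polys_le_rot: "f \<in> polys_le e \<Longrightarrow> rot i j f \<in> polys_le e"
proof (cases "e = 0")
  \<comment> \<open>Degree bound 0 is separate: there the bound \<open>e - 1\<close> for the
    derivative stays 0, and multiplication by a variable would lift it to 1.\<close>
  case True
  assume f: "f \<in> polys_le e"
  have "f = mconst (Poly_Mapping.lookup f 0)"
    by (rule poly_mapping_eqI)
       (use f True in \<open>auto simp: polys_le_def mconst_def lookup_single when_def tdeg_eq_0 in_keys_iff\<close>)
  then have "rot i j f = 0" by (metis rot_const)
  then show ?thesis by simp
next
  case False
  assume f: "f \<in> polys_le e"
  have "mvar (k, a) * mpderiv (k, b) f \<in> polys_le e" for k a b
    using polys_le_mult[OF polys_le_var[OF order_refl] polys_le_deriv[OF f], of "(k, a)" "(k, b)"] False by simp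
  then show ?thesis unfolding rot_def by (intro polys_le_sum polys_le_diff)
qed

lemma derivation_ideal:
  assumes D: "derivation D" and L: "left_ideal L" and S: "S \<subseteq> L" "\<And>s. s \<in> S \<Longrightarrow> D s \<in> L"
    and f: "f \<in> left_ideal hull S"
  shows "D f \<in> L"
proof -
  have "left_ideal {f \<in> L. D f \<in> L}"
    unfolding left_ideal_def using L
    by (auto simp: derivation_0[OF D] derivation_add[OF D] derivation_mult[OF D]
        intro: left_ideal_0 left_ideal_add left_ideal_mult left_ideal_mult_right)
  then have "left_ideal hull S \<subseteq> {f \<in> L. D f \<in> L}"
    using S by (intro hull_left_ideal_minimal) auto
  with f show ?thesis by auto
qed

text \<open>Right rotations fix the matrix of row products, so the row equations are killed
  outright; the column equations are only carried into one another.\<close>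

lemma rot_gram_rows: "rot i j (gram_rows a b) = 0"
proof -
  note D = derivation_rot[of i j]
  have "rot i j (gram_rows a b) = - (\<Sum>k\<in>UNIV. rot i j (mvar (a, k)) * mvar (b, k) + mvar (a, k) * rot i j (mvar (b, k)))"
    unfolding gram_rows_def
    by (auto simp: derivation_diff[OF D] derivation_sum[OF D] derivation_mult[OF D] derivation_0[OF D] derivation_1[OF D])
  also have "(\<Sum>k\<in>UNIV. rot i j (mvar (a, k)) * mvar (b, k) + mvar (a, k) * rot i j (mvar (b, k)))
      = (\<Sum>k\<in>UNIV. (if k = j then mvar (a, i) * mvar (b, k) + mvar (a, k) * mvar (b, i) else 0)
                   - (if k = i then mvar (a, j) * mvar (b, k) + mvar (a, k) * mvar (b, j) else 0))"
    by (rule sum.cong) (auto simp: rot_var algebra_simps)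
  also have "\<dots> = 0" by (simp add: sum_subtractf mult.commute)
  finally show ?thesis by simp
qed

lemma rot_gram_cols: "rot i j (gram_cols a b) =
    (if a = j then gram_cols i b else 0) - (if a = i then gram_cols j b else 0)
  + (if b = j then gram_cols a i else 0) - (if b = i then gram_cols a j else 0)"
proof -
  note D = derivation_rot[of i j]
  define q :: "'a \<Rightarrow> 'a \<Rightarrow> ('a \<times> 'a) mpoly" where "q a b = (\<Sum>k\<in>UNIV. mvar (k, a) * mvar (k, b))" for a b
  have g: "gram_cols a b = (if a = b then 1 else 0) - q a b" for a b by (simp add: gram_cols_def q_def)
  have qs: "q a b = q b a" for a b by (simp add: q_def mult.commute)
  have "rot i j (q a b) = (\<Sum>k\<in>UNIV. rot i j (mvar (k, a)) * mvar (k, b) + mvar (k, a) * rot i j (mvar (k, b)))"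
    by (simp add: q_def derivation_sum[OF D] derivation_mult[OF D])
  also have "\<dots> = (if a = j then q i b else 0) - (if a = i then q j b else 0)
      + (if b = j then q a i else 0) - (if b = i then q a j else 0)"
    by (auto simp: rot_var q_def sum.distrib sum_subtractf algebra_simps)
  finally have "rot i j (gram_cols a b) = - ((if a = j then q i b else 0) - (if a = i then q j b else 0)
      + (if b = j then q a i else 0) - (if b = i then q a j else 0))"
    by (simp add: g derivation_diff[OF D] derivation_0[OF D] derivation_1[OF D])
  then show ?thesis by (auto simp: g qs)
qed

text \<open>The form "derivative equals matrix times \<open>B\<close>" required for differentiating
  the determinant; \<open>B\<close> is skew, so its trace is 0.\<close>

lemma rot_ymat: "rot i j (ymat $ k $ l)
   = (ymat ** (\<chi> a b. (if a = i \<and> b = j then 1 else 0) - (if a = j \<and> b = i then 1 else 0))) $ k $ l"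
proof -
  have "(\<Sum>m\<in>UNIV. mvar (k, m) * ((if m = i \<and> l = j then 1 else 0) - (if m = j \<and> l = i then 1 else 0)))
      = (\<Sum>m\<in>UNIV. (if m = i then if l = j then mvar (k, i) else 0 else 0)
                  - (if m = j then if l = i then mvar (k, j) else 0 else 0))"
    by (rule sum.cong) auto
  then show ?thesis
    by (simp add: ymat_def matrix_matrix_mult_def rot_var sum_subtractf)
qed

lemma rot_det: "rot i j (det ymat) = 0"
proof (cases "i = j")
  case False
  then have "trace (\<chi> a b. (if a = i \<and> b = j then 1 else 0) - (if a = j \<and> b = i then 1 else 0)) = (0 :: ('a \<times> 'a) mpoly)"
    unfolding trace_def by (intro sum.neutral) auto
  then show ?thesis
    using derivation_det_right[OF derivation_rot[of i j] rot_ymat] by simp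
qed simp

lemma rot_so_ideal: "f \<in> so_ideal \<Longrightarrow> rot i j f \<in> so_ideal"
proof (rule derivation_ideal[OF derivation_rot left_ideal_so_ideal])
  note L = left_ideal_so_ideal
  let ?S = "{gram_cols i j |i j. True} \<union> {gram_rows i j |i j. True} \<union> {1 - det ymat} :: ('a \<times> 'a) mpoly set"
  show "?S \<subseteq> so_ideal" using gram_cols_in gram_rows_in det_in by auto
  show "rot i j s \<in> so_ideal" if "s \<in> ?S" for s
    using that gram_cols_in left_ideal_0[OF L]
    by (auto simp: rot_gram_cols rot_gram_rows derivation_diff[OF derivation_rot] derivation_1[OF derivation_rot]
        rot_det intro!: left_ideal_add[OF L] left_ideal_diff[OF L] left_ideal_uminus[OF L])
  show "f \<in> so_ideal \<Longrightarrow> f \<in> left_ideal hull ?S" by (simp add: so_ideal_def)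
qed

lemma meval_det: "meval a (det M) = det (\<chi> i j. meval a (M $ i $ j))"
  by (simp add: det_def meval_sum meval_mult meval_of_int meval_prod)

lemma so_ideal_vanishes:
  fixes g :: "complex^'n^'n"
  assumes g: "transpose g ** g = mat 1" "det g = 1" and f: "f \<in> so_ideal"
  shows "meval (\<lambda>(i, j). g $ i $ j) f = 0"
proof -
  let ?a = "\<lambda>(i, j). g $ i $ j"
  have g': "g ** transpose g = mat 1" using g(1) by (simp add: matrix_left_right_inverse)
  have "left_ideal {f. meval ?a f = 0}" by (auto simp: left_ideal_def meval_add meval_mult)
  moreover have "meval ?a (gram_cols i j) = 0" for i j
    using arg_cong[OF g(1), of "\<lambda>M. M $ i $ j"]
    by (simp add: gram_cols_def meval_diff meval_sum meval_mult matrix_matrix_mult_def transpose_def mat_def split: if_splits)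
  moreover have "meval ?a (gram_rows i j) = 0" for i j
    using arg_cong[OF g', of "\<lambda>M. M $ i $ j"]
    by (simp add: gram_rows_def meval_diff meval_sum meval_mult matrix_matrix_mult_def transpose_def mat_def split: if_splits)
  moreover have "meval ?a (1 - det ymat) = 0"
    using g(2) by (simp add: meval_diff meval_det ymat_def)
  ultimately have "so_ideal \<subseteq> {f. meval ?a f = 0}"
    unfolding so_ideal_def by (intro hull_left_ideal_minimal) auto
  with f show ?thesis by auto
qed

lemma one_notin_so_ideal: "1 \<notin> so_ideal"
proof
  assume "1 \<in> so_ideal"
  from so_ideal_vanishes[of "mat 1", OF _ _ this] show False by (simp add: transpose_mat)
qed

section \<open>Adjoints for the Fischer inner product\<close>

definition mfact :: "('v::finite \<Rightarrow>\<^sub>0 nat) \<Rightarrow> nat"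
  where "mfact m = (\<Prod>i\<in>UNIV. fact (Poly_Mapping.lookup m i))"

text \<open>Monomials are orthogonal, with the product of the factorials of the exponents as square
  norm. This normalisation makes multiplication by a variable adjoint to the partial derivative. The
  form is conjugate-linear in the second argument.\<close>

definition fischer :: "'v::finite mpoly \<Rightarrow> 'v mpoly \<Rightarrow> complex"
  where "fischer f g = (\<Sum>m\<in>Poly_Mapping.keys f.
     of_nat (mfact m) * Poly_Mapping.lookup f m * cnj (Poly_Mapping.lookup g m))"

lemma mfact_pos: "mfact m > 0"
  by (simp add: mfact_def prod_pos)

lemma mfact_add_single: "mfact (m + Poly_Mapping.single i 1) = (Poly_Mapping.lookup m i + 1) * mfact m"
proof -
  have e: "mfact m' = fact (Poly_Mapping.lookup m' i) * (\<Prod>j\<in>UNIV - {i}. fact (Poly_Mapping.lookup m' j))" for m'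
    unfolding mfact_def by (rule prod.remove) auto
  have "(\<Prod>j\<in>UNIV - {i}. fact (Poly_Mapping.lookup (m + Poly_Mapping.single i 1) j))
      = (\<Prod>j\<in>UNIV - {i}. fact (Poly_Mapping.lookup m j) :: nat)"
    by (rule prod.cong) (auto simp: lookup_add lookup_single when_def)
  then show ?thesis unfolding e[of "m + _"] e[of m] by (simp add: lookup_add algebra_simps)
qed

lemma fischer_add_left: "fischer (f + f') g = fischer f g + fischer f' g"
  unfolding fischer_def by (rule pm_sum_add) (auto simp: algebra_simps)

lemma fischer_add_right: "fischer f (g + g') = fischer f g + fischer f g'"
  by (simp add: fischer_def lookup_add algebra_simps sum.distrib)

lemma fischer_0_left [simp]: "fischer 0 g = 0"
  by (simp add: fischer_def)

lemma fischer_0_right [simp]: "fischer f 0 = 0"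
  by (simp add: fischer_def)

lemma fischer_uminus_right: "fischer f (- g) = - fischer f g"
  using fischer_add_right[of f g "- g"] by (simp add: eq_neg_iff_add_eq_0 add.commute)

lemma fischer_uminus_left: "fischer (- f) g = - fischer f g"
  using fischer_add_left[of f "- f" g] by (simp add: eq_neg_iff_add_eq_0 add.commute)

lemma fischer_diff_right: "fischer f (g - g') = fischer f g - fischer f g'"
  using fischer_add_right[of f g "- g'"] by (simp add: fischer_uminus_right)

lemma fischer_diff_left: "fischer (f - f') g = fischer f g - fischer f' g"
  using fischer_add_left[of f "- f'" g] by (simp add: fischer_uminus_left)

lemma fischer_sum_left: "fischer (\<Sum>k\<in>S. f k) g = (\<Sum>k\<in>S. fischer (f k) g)"
  by (induction S rule: infinite_finite_induct) (auto simp: fischer_add_left)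

lemma fischer_sum_right: "fischer f (\<Sum>k\<in>S. g k) = (\<Sum>k\<in>S. fischer f (g k))"
  by (induction S rule: infinite_finite_induct) (auto simp: fischer_add_right)

lemma fischer_single_left: "fischer (Poly_Mapping.single m c) g = of_nat (mfact m) * c * cnj (Poly_Mapping.lookup g m)"
  unfolding fischer_def
  by (rule pm_sum_single[where h = "\<lambda>m c. of_nat (mfact m) * c * cnj (Poly_Mapping.lookup g m)"]) simp

lemma fischer_single_right: "fischer f (Poly_Mapping.single m c) = of_nat (mfact m) * Poly_Mapping.lookup f m * cnj c"
proof (induction f rule: pm_induct)
  case (single k v)
  show ?case by (simp add: fischer_single_left lookup_single when_def)
qed (simp add: fischer_add_left lookup_add algebra_simps)

lemma fischer_var_left: "fischer (mvar i * f) g = fischer f (mpderiv i g)"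
proof (induction f rule: pm_induct)
  case (single k v)
  show ?case
    using mfact_add_single[of k i]
    by (simp add: mvar_def mult_single fischer_single_left lookup_mpderiv add.commute algebra_simps)
qed (simp add: fischer_add_left distrib_left)

lemma fischer_commute: "fischer g f = cnj (fischer f g)"
proof (induction f rule: pm_induct)
  case (single k v)
  show ?case by (simp add: fischer_single_left fischer_single_right)
qed (simp add: fischer_add_left fischer_add_right)

lemma fischer_var_right: "fischer f (mvar i * g) = fischer (mpderiv i f) g"
  by (metis fischer_commute fischer_var_left)

lemma fischer_const_left: "fischer (mconst c * f) g = c * fischer f g"
proof (induction f rule: pm_induct)
  case (single k v)
  show ?case by (simp add: mconst_def mult_single fischer_single_left)
qed (simp add: fischer_add_left distrib_left)

lemma fischer_const_right: "fischer f (mconst c * g) = cnj c * fischer f g"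
  by (metis fischer_commute fischer_const_left complex_cnj_mult)

lemma fischer_pos: "f \<noteq> 0 \<Longrightarrow> Re (fischer f f) > 0"
proof -
  assume "f \<noteq> 0"
  then have "Poly_Mapping.keys f \<noteq> {}" by simp
  have "fischer f f = of_real (\<Sum>m\<in>Poly_Mapping.keys f. real (mfact m) * (cmod (Poly_Mapping.lookup f m))\<^sup>2)"
    unfolding fischer_def of_real_sum
    by (rule sum.cong) (simp_all add: mult.assoc complex_norm_square[symmetric])
  moreover have "(\<Sum>m\<in>Poly_Mapping.keys f. real (mfact m) * (cmod (Poly_Mapping.lookup f m))\<^sup>2) > 0"
    by (rule sum_pos) (use \<open>Poly_Mapping.keys f \<noteq> {}\<close> in \<open>auto simp: mfact_pos in_keys_iff\<close>)
  ultimately show ?thesis by (simp only: Re_complex_of_real)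
qed

lemma fischer_eq_0: "fischer f f = 0 \<Longrightarrow> f = 0"
  using fischer_pos[of f] by fastforce

lemma fischer_eqI: "(\<And>f. fischer f g = fischer f h) \<Longrightarrow> g = h"
  using fischer_eq_0[of "g - h"] by (simp add: fischer_diff_right)

text \<open>The adjoint is a relation, unique by definiteness of the form and existing by induction
  on operators, so no antiautomorphism of the Weyl algebra has to be constructed.\<close>

definition adjoint_ops :: "'v::finite weyl \<Rightarrow> ('v mpoly \<Rightarrow> 'v mpoly) \<Rightarrow> bool"
  where "adjoint_ops P T \<longleftrightarrow> (\<forall>f g. fischer (weyl_apply P f) g = fischer f (T g))"

lemma adjoint_ops_unique: "adjoint_ops P T \<Longrightarrow> adjoint_ops P T' \<Longrightarrow> T g = T' g"
  by (rule fischer_eqI) (simp add: adjoint_ops_def)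

lemma adjoint_ops_x: "adjoint_ops (weyl_x i) (mpderiv i)"
  by (simp add: adjoint_ops_def weyl_apply_x fischer_var_left)

lemma adjoint_ops_d: "adjoint_ops (weyl_d i) (\<lambda>q. mvar i * q)"
  by (simp add: adjoint_ops_def weyl_apply_d fischer_var_right)

lemma adjoint_ops_const: "adjoint_ops (weyl_const c) (\<lambda>q. mconst (cnj c) * q)"
  by (simp add: adjoint_ops_def weyl_apply_const fischer_const_left fischer_const_right)

lemma adjoint_ops_add: "adjoint_ops P S \<Longrightarrow> adjoint_ops Q T \<Longrightarrow> adjoint_ops (P + Q) (\<lambda>q. S q + T q)"
  by (simp add: adjoint_ops_def weyl_apply_add fischer_add_left fischer_add_right)

lemma weyl_apply_diff: "weyl_apply (P - Q) f = weyl_apply P f - weyl_apply Q f"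
  by transfer simp

lemma adjoint_ops_diff: "adjoint_ops P S \<Longrightarrow> adjoint_ops Q T \<Longrightarrow> adjoint_ops (P - Q) (\<lambda>q. S q - T q)"
  by (simp add: adjoint_ops_def weyl_apply_diff fischer_diff_left fischer_diff_right)

text \<open>Products are reversed: in the adjoint, the part belonging to the left factor acts first.
  So passing to a left multiple can only shrink the set of values of an adjoint.\<close>

lemma adjoint_ops_mult: "adjoint_ops P S \<Longrightarrow> adjoint_ops Q T \<Longrightarrow> adjoint_ops (P * Q) (\<lambda>q. T (S q))"
  by (simp add: adjoint_ops_def weyl_apply_mult)

lemma adjoint_ops_0: "adjoint_ops 0 (\<lambda>q. 0)"
  by (simp add: adjoint_ops_def)

lemma adjoint_ops_sum: "(\<And>k. k \<in> A \<Longrightarrow> adjoint_ops (P k) (S k)) \<Longrightarrow> adjoint_ops (\<Sum>k\<in>A. P k) (\<lambda>q. \<Sum>k\<in>A. S k q)"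
  by (induction A rule: infinite_finite_induct) (auto simp: adjoint_ops_0 adjoint_ops_add)

lemma adjoint_ops_ex: "\<exists>T. adjoint_ops P T"
  by (induction P rule: weyl_induct)
     (use adjoint_ops_x adjoint_ops_d adjoint_ops_const adjoint_ops_add adjoint_ops_mult in blast)+

text \<open>The adjoint of \<open>dop p\<close> is multiplication by the polynomial with conjugated
  coefficients; the property expresses that \<open>p\<close> is real, as the defining equations of
  the group are.\<close>

definition selfadjoint :: "'v::finite mpoly \<Rightarrow> bool"
  where "selfadjoint p \<longleftrightarrow> adjoint_ops (dop p) (\<lambda>q. p * q)"

lemma selfadjoint_0: "selfadjoint 0"
  by (simp add: selfadjoint_def adjoint_ops_0)

lemma selfadjoint_1: "selfadjoint 1"
  by (simp add: selfadjoint_def adjoint_ops_def)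

lemma selfadjoint_var: "selfadjoint (mvar i)"
  by (simp add: selfadjoint_def dop_var adjoint_ops_d)

lemma selfadjoint_mult: "selfadjoint p \<Longrightarrow> selfadjoint q \<Longrightarrow> selfadjoint (p * q)"
  by (simp add: selfadjoint_def adjoint_ops_def dop_mult weyl_apply_mult mult.assoc mult.left_commute)

lemma selfadjoint_diff: "selfadjoint p \<Longrightarrow> selfadjoint q \<Longrightarrow> selfadjoint (p - q)"
  by (simp add: selfadjoint_def adjoint_ops_def dop_diff weyl_apply_diff left_diff_distrib
      fischer_diff_left fischer_diff_right)

lemma selfadjoint_add: "selfadjoint p \<Longrightarrow> selfadjoint q \<Longrightarrow> selfadjoint (p + q)"
  by (simp add: selfadjoint_def adjoint_ops_def dop_add weyl_apply_add distrib_right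
      fischer_add_left fischer_add_right)

lemma selfadjoint_uminus: "selfadjoint p \<Longrightarrow> selfadjoint (- p)"
  using selfadjoint_diff[OF selfadjoint_0] by simp

lemma selfadjoint_sum: "(\<And>k. k \<in> S \<Longrightarrow> selfadjoint (f k)) \<Longrightarrow> selfadjoint (\<Sum>k\<in>S. f k)"
  by (induction S rule: infinite_finite_induct) (auto intro: selfadjoint_0 selfadjoint_add)

lemma selfadjoint_prod: "(\<And>k. k \<in> S \<Longrightarrow> selfadjoint (f k)) \<Longrightarrow> selfadjoint (\<Prod>k\<in>S. f k)"
  by (induction S rule: infinite_finite_induct) (auto intro: selfadjoint_1 selfadjoint_mult)

lemma selfadjoint_of_int: "selfadjoint (of_int n)"
proof -
  have n: "selfadjoint (of_nat k)" for k
    by (induction k) (auto intro: selfadjoint_0 selfadjoint_1 selfadjoint_add)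
  show ?thesis
    using n selfadjoint_diff[OF selfadjoint_0, of "of_nat _"] by (cases n rule: int_cases2) auto
qed

lemma selfadjoint_gens:
  "selfadjoint (gram_cols i j)" "selfadjoint (gram_rows i j)" "selfadjoint (1 - det ymat)"
  unfolding gram_cols_def gram_rows_def det_def ymat_def
  by (auto intro!: selfadjoint_diff selfadjoint_sum selfadjoint_mult selfadjoint_var selfadjoint_prod
      selfadjoint_of_int selfadjoint_1 selfadjoint_0 selfadjoint_uminus)

section \<open>Invariants and the properness of the ideal\<close>

lemma fischer_rot: "fischer (rot i j f) g = - fischer f (rot i j g)"
proof -
  have "fischer (rot i j f) g = (\<Sum>k\<in>UNIV. fischer f (mvar (k, j) * mpderiv (k, i) g) - fischer f (mvar (k, i) * mpderiv (k, j) g))"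
    by (simp add: rot_def fischer_sum_left fischer_diff_left fischer_var_left fischer_var_right)
  also have "\<dots> = fischer f (rot j i g)"
    by (simp add: rot_def fischer_sum_right fischer_diff_right)
  finally show ?thesis by (simp add: rot_swap[of j i] fischer_uminus_right)
qed

text \<open>The sum runs over all ordered pairs, which doubles the usual sum over
  \<open>i < j\<close>. As a sum of squares of skew operators it is selfadjoint and negative
  semidefinite.\<close>

definition casimir :: "('n::finite \<times> 'n) mpoly \<Rightarrow> ('n \<times> 'n) mpoly"
  where "casimir f = (\<Sum>i\<in>UNIV. \<Sum>j\<in>UNIV. rot i j (rot i j f))"

lemma casimir_add: "casimir (f + g) = casimir f + casimir g"
  by (simp add: casimir_def derivation_add[OF derivation_rot] sum.distrib)

lemma casimir_const_mult: "casimir (mconst c * f) = mconst c * casimir f"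
  by (simp add: casimir_def rot_const_mult sum_distrib_left)

lemma casimir_0 [simp]: "casimir 0 = 0"
  using casimir_add[of 0 0] by simp

lemma casimir_pow_lin:
  "(casimir ^^ l) (\<Sum>k\<in>S. mconst (c k) * f k) = (\<Sum>k\<in>S. mconst (c k) * (casimir ^^ l) (f k))"
proof (induction l)
  case (Suc l)
  have s: "casimir (\<Sum>k\<in>S. g k) = (\<Sum>k\<in>S. casimir (g k))" for g
    by (induction S rule: infinite_finite_induct) (auto simp: casimir_add)
  show ?case by (simp add: Suc s casimir_const_mult)
qed simp

lemma fischer_casimir: "fischer (casimir f) g = fischer f (casimir g)"
  by (simp add: casimir_def fischer_sum_left fischer_sum_right fischer_rot)

text \<open>Paired with \<open>v\<close>, the Casimir operator gives minus the sum of the square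
  norms of all \<open>rot i j v\<close>; each of them must vanish.\<close>

lemma casimir_eq_0:
  assumes "casimir v = 0"
  shows "rot i j v = 0"
proof (rule ccontr)
  assume nz: "rot i j v \<noteq> 0"
  have nn: "Re (fischer f f) \<ge> 0" for f :: "('a \<times> 'a) mpoly"
    using fischer_pos[of f] by (cases "f = 0") auto
  have "0 = - fischer (casimir v) v" using assms by simp
  also have "\<dots> = (\<Sum>i\<in>UNIV. \<Sum>j\<in>UNIV. fischer (rot i j v) (rot i j v))"
    by (simp add: casimir_def fischer_sum_left fischer_rot[of _ _ "rot _ _ _"] sum_negf)
  also have "\<dots> = (\<Sum>p\<in>UNIV. fischer (rot (fst p) (snd p) v) (rot (fst p) (snd p) v))"
    by (simp add: sum.cartesian_product case_prod_unfold)
  finally have "Re (\<Sum>p\<in>UNIV. fischer (rot (fst p) (snd p) v) (rot (fst p) (snd p) v)) = 0"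
    by simp
  moreover have "Re (\<Sum>p\<in>UNIV. fischer (rot (fst p) (snd p) v) (rot (fst p) (snd p) v)) > 0"
    unfolding Re_sum
    by (rule sum_pos2[of _ "(i, j)"]) (use nz in \<open>auto simp: nn fischer_pos\<close>)
  ultimately show False by simp
qed

text \<open>Selfadjointness excludes nilpotent parts: if \<open>casimir (casimir u) = 0\<close>,
  then \<open>casimir u\<close> has norm 0.\<close>

lemma casimir_pow_eq_0: "(casimir ^^ l) v = 0 \<Longrightarrow> casimir v = 0"
proof (induction l)
  case (Suc l)
  show ?case
  proof (cases l)
    case (Suc l')
    define u where "u = (casimir ^^ l') v"
    have cc: "casimir (casimir u) = 0" using Suc.prems by (simp add: Suc u_def)
    have "fischer (casimir u) (casimir u) = 0" using cc by (simp add: fischer_casimir)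
    then have "casimir u = 0" by (rule fischer_eq_0)
    then show ?thesis using Suc.IH by (simp add: Suc u_def)
  qed (use Suc.prems in simp)
qed simp

definition rot_image :: "('n::finite \<times> 'n) mpoly set"
  where "rot_image = {w. \<exists>q. w = (\<Sum>i\<in>UNIV. \<Sum>j\<in>UNIV. rot i j (q i j))}"

lemma rot_image_add: "v \<in> rot_image \<Longrightarrow> w \<in> rot_image \<Longrightarrow> v + w \<in> rot_image"
proof -
  assume "v \<in> rot_image" "w \<in> rot_image"
  then obtain p q where "v = (\<Sum>i\<in>UNIV. \<Sum>j\<in>UNIV. rot i j (p i j))" "w = (\<Sum>i\<in>UNIV. \<Sum>j\<in>UNIV. rot i j (q i j))"
    by (auto simp: rot_image_def)
  then have "v + w = (\<Sum>i\<in>UNIV. \<Sum>j\<in>UNIV. rot i j (p i j + q i j))"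
    by (simp add: derivation_add[OF derivation_rot] sum.distrib)
  then show ?thesis by (auto simp: rot_image_def intro!: exI[of _ "\<lambda>i j. p i j + q i j"])
qed

lemma rot_image_const: "w \<in> rot_image \<Longrightarrow> mconst c * w \<in> rot_image"
proof -
  assume "w \<in> rot_image"
  then obtain q where "w = (\<Sum>i\<in>UNIV. \<Sum>j\<in>UNIV. rot i j (q i j))" by (auto simp: rot_image_def)
  then have "mconst c * w = (\<Sum>i\<in>UNIV. \<Sum>j\<in>UNIV. rot i j (mconst c * q i j))"
    by (simp add: rot_const_mult sum_distrib_left)
  then show ?thesis by (auto simp: rot_image_def intro!: exI[of _ "\<lambda>i j. mconst c * q i j"])
qed

lemma casimir_rot_image: "casimir f \<in> rot_image"
  by (auto simp: rot_image_def casimir_def intro!: exI[of _ "\<lambda>i j. rot i j f"])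

lemma rot_image_0: "0 \<in> rot_image"
  using casimir_rot_image[of 0] by simp

lemma rot_image_sum: "(\<And>k. k \<in> S \<Longrightarrow> f k \<in> rot_image) \<Longrightarrow> (\<Sum>k\<in>S. f k) \<in> rot_image"
  by (induction S rule: infinite_finite_induct) (auto intro: rot_image_0 rot_image_add)

lemma rot_in_rot_image: "rot i j f \<in> rot_image"
proof -
  have "(\<Sum>a\<in>UNIV. \<Sum>b\<in>UNIV. rot a b (if a = i \<and> b = j then f else 0))
      = (\<Sum>a\<in>UNIV. \<Sum>b\<in>UNIV. if b = j then if a = i then rot i j f else 0 else 0)"
    by (intro sum.cong) (auto simp: derivation_0[OF derivation_rot])
  then show ?thesis
    by (auto simp: rot_image_def intro!: exI[of _ "\<lambda>a b. if a = i \<and> b = j then f else 0"])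
qed

text \<open>The powers of the Casimir operator applied to \<open>a\<close> stay in a finite-dimensional space, so
  they satisfy a linear relation; dividing out the powers of the semisimple operator yields the
  invariant part of \<open>a\<close>.\<close>

lemma so_ideal_invariant_part:
  assumes a: "a \<in> so_ideal"
  shows "\<exists>v\<in>so_ideal. (\<forall>i j. rot i j v = 0) \<and> a - v \<in> rot_image"
proof -
  note L = left_ideal_so_ideal
  obtain e where e: "a \<in> polys_le e" using polys_le_ex by blast
  have P: "(casimir ^^ k) a \<in> polys_le e \<inter> so_ideal" for k
  proof (induction k)
    case (Suc k)
    then show ?case
      by (auto simp: casimir_def intro!: polys_le_sum polys_le_rot left_ideal_sum[OF L] rot_so_ideal)
  qed (use a e in simp)
  define K where "K = {m :: 'a \<times> 'a \<Rightarrow>\<^sub>0 nat. tdeg m \<le> e}"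
  \<comment> \<open>The \<open>card K + 1\<close> vectors \<open>(casimir ^^ k) a\<close> with
    \<open>k \<le> card K\<close> have at most \<open>card K\<close> coordinates, hence are
    dependent.\<close>
  have "card K < card {..card K}" by simp
  from homogeneous_system_solution[OF _ _ this, of "\<lambda>k m. Poly_Mapping.lookup ((casimir ^^ k) a) m"]
  obtain c where c: "\<exists>k\<in>{..card K}. c k \<noteq> 0"
    "\<forall>m\<in>K. (\<Sum>k\<in>{..card K}. c k * Poly_Mapping.lookup ((casimir ^^ k) a) m) = 0"
    using finite_tdeg_le[of e] unfolding K_def by auto
  \<comment> \<open>The lowest index with nonzero coefficient: \<open>casimir ^^ l\<close> is split
    off the relation, and the remaining factor has nonzero constant term.\<close>
  define l where "l = (LEAST k. k \<le> card K \<and> c k \<noteq> 0)"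
  have l: "l \<le> card K" "c l \<noteq> 0"
    using c(1) LeastI_ex[of "\<lambda>k. k \<le> card K \<and> c k \<noteq> 0"] unfolding l_def by auto
  have below: "c k = 0" if "k < l" for k
    using not_less_Least[of k "\<lambda>k. k \<le> card K \<and> c k \<noteq> 0"] that l by (auto simp: l_def[symmetric])
  define v where "v = (\<Sum>k=l..card K. mconst (c k) * (casimir ^^ (k - l)) a)"
  have "(casimir ^^ l) v = (\<Sum>k=l..card K. mconst (c k) * (casimir ^^ l) ((casimir ^^ (k - l)) a))"
    unfolding v_def by (rule casimir_pow_lin)
  also have "\<dots> = (\<Sum>k=l..card K. mconst (c k) * (casimir ^^ k) a)"
  proof (rule sum.cong[OF refl])
    fix k assume "k \<in> {l..card K}"
    then have "k = l + (k - l)" by simp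
    then have "(casimir ^^ l) ((casimir ^^ (k - l)) a) = (casimir ^^ k) a" by (metis funpow_add comp_apply)
    then show "mconst (c k) * (casimir ^^ l) ((casimir ^^ (k - l)) a) = mconst (c k) * (casimir ^^ k) a" by simp
  qed
  also have "\<dots> = (\<Sum>k\<le>card K. mconst (c k) * (casimir ^^ k) a)"
    by (rule sum.mono_neutral_left) (auto simp: below not_le)
  also have "\<dots> = 0"
  proof (rule poly_mapping_eqI)
    have cl: "Poly_Mapping.lookup (mconst r * f) m = r * Poly_Mapping.lookup f m" for r and f :: "('a \<times> 'a) mpoly" and m
    proof (induction f rule: pm_induct)
      case (single k v)
      show ?case by (simp add: mconst_def mult_single lookup_single when_def)
    qed (simp add: distrib_left lookup_add)
    fix m
    show "Poly_Mapping.lookup (\<Sum>k\<le>card K. mconst (c k) * (casimir ^^ k) a) m = Poly_Mapping.lookup 0 m"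
    proof (cases "m \<in> K")
      case True
      then show ?thesis using c(2) by (simp add: lookup_sum cl)
    next
      case False
      then have "Poly_Mapping.lookup ((casimir ^^ k) a) m = 0" for k
        using P[of k] by (auto simp: K_def polys_le_def in_keys_iff)
      then show ?thesis by (simp add: lookup_sum cl)
    qed
  qed
  finally have v0: "casimir v = 0" by (rule casimir_pow_eq_0)
  \<comment> \<open>Normalised so that \<open>a\<close> has coefficient 1 in \<open>u\<close>; every
    term left in \<open>a - u\<close> contains a Casimir factor and lies in
    \<open>rot_image\<close>.\<close>
  define u where "u = mconst (1 / c l) * v"
  have "v = mconst (c l) * a + (\<Sum>k=Suc l..card K. mconst (c k) * (casimir ^^ (k - l)) a)"
    unfolding v_def using l by (simp add: sum.atLeast_Suc_atMost)
  then have "u = mconst (1 / c l * c l) * a + mconst (1 / c l) * (\<Sum>k=Suc l..card K. mconst (c k) * (casimir ^^ (k - l)) a)"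
    by (simp only: u_def distrib_left mconst_mult mult.assoc)
  then have "a - u = mconst (- 1 / c l) * (\<Sum>k=Suc l..card K. mconst (c k) * (casimir ^^ (k - l)) a)"
    using l by (simp add: mconst_uminus)
  moreover have "(casimir ^^ (k - l)) a \<in> rot_image" if "k \<in> {Suc l..card K}" for k
  proof -
    have "k - l = Suc (k - Suc l)" using that by auto
    then show ?thesis by (simp add: casimir_rot_image)
  qed
  ultimately have "a - u \<in> rot_image" by (auto intro!: rot_image_const rot_image_sum)
  moreover have "u \<in> so_ideal"
    unfolding u_def v_def using P by (intro left_ideal_mult[OF L] left_ideal_sum[OF L]) auto
  moreover have "rot i j u = 0" for i j
    using casimir_eq_0[OF v0] by (simp add: u_def rot_const_mult)
  ultimately show ?thesis by blast
qed

text \<open>On the compact real group these functions integrate to zero. That \<open>1\<close> is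
  not among them is the algebraic substitute for an invariant integral.\<close>

definition so_rot :: "('n::finite \<times> 'n) mpoly set"
  where "so_rot = {a + w |a w. a \<in> so_ideal \<and> w \<in> rot_image}"

lemma so_rot_add: "p \<in> so_rot \<Longrightarrow> q \<in> so_rot \<Longrightarrow> p + q \<in> so_rot"
proof -
  assume "p \<in> so_rot" "q \<in> so_rot"
  then obtain a v b w where *: "p = a + v" "q = b + w" "a \<in> so_ideal" "b \<in> so_ideal" "v \<in> rot_image" "w \<in> rot_image"
    by (auto simp: so_rot_def)
  then have "p + q = (a + b) + (v + w)" by simp
  with * show ?thesis unfolding so_rot_def
    by (blast intro: left_ideal_add[OF left_ideal_so_ideal] rot_image_add)
qed

lemma so_rot_ideal: "a \<in> so_ideal \<Longrightarrow> a \<in> so_rot"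
  unfolding so_rot_def using rot_image_0 by force

lemma so_rot_image: "w \<in> rot_image \<Longrightarrow> w \<in> so_rot"
  unfolding so_rot_def using left_ideal_0[OF left_ideal_so_ideal] by force

lemma so_rot_const: "p \<in> so_rot \<Longrightarrow> mconst c * p \<in> so_rot"
proof -
  assume "p \<in> so_rot"
  then obtain a w where "p = a + w" "a \<in> so_ideal" "w \<in> rot_image" by (auto simp: so_rot_def)
  then show ?thesis unfolding so_rot_def
    by (auto simp: distrib_left intro: left_ideal_mult[OF left_ideal_so_ideal] rot_image_const)
qed

text \<open>Replacing \<open>a\<close> by its invariant part \<open>v\<close> leaves
  \<open>1 - v\<close> both invariant and in the image of the rotation fields. Skewness makes such a
  vector orthogonal to itself, so \<open>v = 1\<close> and \<open>1\<close> would lie in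
  \<open>so_ideal\<close>.\<close>

lemma one_notin_so_rot: "1 \<notin> (so_rot :: ('n::finite \<times> 'n) mpoly set)"
proof
  assume "1 \<in> (so_rot :: ('n \<times> 'n) mpoly set)"
  then obtain a w where aw: "1 = a + w" "a \<in> so_ideal" "w \<in> (rot_image :: ('n \<times> 'n) mpoly set)"
    by (auto simp: so_rot_def)
  from so_ideal_invariant_part[OF aw(2)] obtain v where
    v: "v \<in> so_ideal" "\<And>i j. rot i j v = 0" "a - v \<in> rot_image" by blast
  have "1 - v = (a - v) + w" using aw(1) by simp
  with v(3) aw(3) have "1 - v \<in> rot_image" by (metis rot_image_add)
  then obtain q where q: "1 - v = (\<Sum>i\<in>UNIV. \<Sum>j\<in>UNIV. rot i j (q i j))" by (auto simp: rot_image_def)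
  have r: "rot i j (1 - v) = 0" for i j
    by (simp add: derivation_diff[OF derivation_rot] derivation_1[OF derivation_rot] v)
  have "fischer (\<Sum>i\<in>UNIV. \<Sum>j\<in>UNIV. rot i j (q i j)) (1 - v) = 0"
    by (simp add: fischer_sum_left fischer_rot r)
  then have "1 - v = 0" using q by (metis fischer_eq_0)
  then show False using v(1) by (simp add: one_notin_so_ideal)
qed

section \<open>The left ideal in the Weyl algebra and the adjoints of its elements\<close>

definition lie_gen :: "'n::finite \<Rightarrow> 'n \<Rightarrow> ('n \<times> 'n) weyl"
  where "lie_gen i j = (\<Sum>k\<in>UNIV. weyl_x (k, i) * weyl_d (k, j) - weyl_x (k, j) * weyl_d (k, i))"

definition so_weyl_ideal :: "('n::finite \<times> 'n) weyl set"
  where "so_weyl_ideal = left_ideal hull ({lie_gen i j |i j. True} \<union> dop ` so_ideal)"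

lemma left_ideal_so_weyl_ideal: "left_ideal so_weyl_ideal"
  unfolding so_weyl_ideal_def by (rule left_ideal_hull)

lemma lie_gen_in: "lie_gen i j \<in> so_weyl_ideal"
  and dop_in: "f \<in> so_ideal \<Longrightarrow> dop f \<in> so_weyl_ideal"
  unfolding so_weyl_ideal_def by (auto intro!: hull_inc)

lemma adjoint_ops_lie_gen: "adjoint_ops (lie_gen i j) (\<lambda>q. - rot i j q)"
proof -
  have "adjoint_ops (lie_gen i j) (\<lambda>q. \<Sum>k\<in>UNIV. mvar (k, j) * mpderiv (k, i) q - mvar (k, i) * mpderiv (k, j) q)"
    unfolding lie_gen_def
    by (intro adjoint_ops_sum adjoint_ops_diff adjoint_ops_mult adjoint_ops_x adjoint_ops_d)
  then show ?thesis by (simp add: rot_def sum_negf[symmetric])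
qed

text \<open>The preimage of a left ideal under \<open>dop\<close> is an ideal, so generators of the
  polynomial ideal suffice.\<close>

lemma hull_dop_hull:
  "left_ideal hull (L \<union> dop ` (left_ideal hull G)) = left_ideal hull (L \<union> dop ` G)"
proof
  let ?H = "left_ideal hull (L \<union> dop ` G)"
  have H: "left_ideal ?H" by (rule left_ideal_hull)
  have sub: "L \<union> dop ` G \<subseteq> ?H" by (rule hull_subset)
  have "left_ideal {f. dop f \<in> ?H}"
    using H by (auto simp: left_ideal_def dop_add dop_mult)
  then have "left_ideal hull G \<subseteq> {f. dop f \<in> ?H}"
    by (rule hull_left_ideal_minimal) (use sub in auto)
  then show "left_ideal hull (L \<union> dop ` (left_ideal hull G)) \<subseteq> ?H"
    using sub by (intro hull_left_ideal_minimal[OF H]) auto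
  show "?H \<subseteq> left_ideal hull (L \<union> dop ` (left_ideal hull G))"
    by (intro hull_mono Un_mono image_mono hull_subset order_refl)
qed

lemma so_gen_ideal_eq:
  "so_weyl_ideal = left_ideal hull ({lie_gen i j |i j. True}
     \<union> dop ` ({gram_cols i j |i j. True} \<union> {gram_rows i j |i j. True} \<union> {1 - det ymat}))"
  unfolding so_weyl_ideal_def so_ideal_def by (rule hull_dop_hull)

text \<open>\<open>so_rot\<close> is used only as a linear subspace, yet the operators whose adjoint
  takes values in it form a left ideal: a left factor acts before the adjoint of \<open>P\<close>
  and merely changes its argument. On generators the adjoint is a rotation field or multiplication
  by an element of \<open>so_ideal\<close>.\<close>

lemma adjoint_so_weyl_ideal:
  fixes P :: "('n::finite \<times> 'n) weyl"
  assumes P: "P \<in> so_weyl_ideal" and T: "adjoint_ops P T"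
  shows "T q \<in> so_rot"
proof -
  note J = left_ideal_so_ideal
  let ?S = "{P :: ('n \<times> 'n) weyl. \<forall>T. adjoint_ops P T \<longrightarrow> (\<forall>q. T q \<in> so_rot)}"
  have in_S: "P \<in> ?S" if "adjoint_ops P T" "\<And>q. T q \<in> so_rot" for P T
  proof (intro CollectI allI impI)
    fix T' q assume "adjoint_ops P T'"
    then show "T' q \<in> so_rot" using adjoint_ops_unique[OF that(1)] that(2)[of q] by simp
  qed
  have S: "left_ideal ?S"
    unfolding left_ideal_def
  proof (intro conjI ballI allI)
    show "0 \<in> ?S" by (rule in_S[OF adjoint_ops_0]) (auto intro: so_rot_ideal left_ideal_0[OF J])
  next
    fix P Q :: "('n \<times> 'n) weyl" assume "P \<in> ?S" "Q \<in> ?S"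
    moreover obtain S T where "adjoint_ops P S" "adjoint_ops Q T" using adjoint_ops_ex by metis
    ultimately show "P + Q \<in> ?S" by (intro in_S[OF adjoint_ops_add]) (auto intro: so_rot_add)
  next
    fix R P :: "('n \<times> 'n) weyl" assume "P \<in> ?S"
    moreover obtain S T where "adjoint_ops R S" "adjoint_ops P T" using adjoint_ops_ex by metis
    ultimately show "R * P \<in> ?S" by (intro in_S[OF adjoint_ops_mult]) auto
  qed
  have lie_S: "lie_gen i j \<in> ?S" for i j
  proof (rule in_S[OF adjoint_ops_lie_gen])
    show "- rot i j q \<in> so_rot" for q
      by (subst rot_swap[symmetric]) (rule so_rot_image[OF rot_in_rot_image])
  qed
  have dop_S: "dop f \<in> ?S" if "selfadjoint f" "f \<in> so_ideal" for f
  proof (rule in_S)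
    show "adjoint_ops (dop f) (\<lambda>q. f * q)" using that by (simp add: selfadjoint_def)
    show "f * q \<in> so_rot" for q using that by (intro so_rot_ideal left_ideal_mult_right[OF J])
  qed
  have gens_S: "dop (gram_cols i j) \<in> ?S" "dop (gram_rows i j) \<in> ?S" "dop (1 - det ymat) \<in> ?S" for i j
    by (intro dop_S selfadjoint_gens gram_cols_in gram_rows_in det_in)+
  have "so_weyl_ideal \<subseteq> ?S"
    unfolding so_gen_ideal_eq
  proof (rule hull_left_ideal_minimal[OF S], rule subsetI)
    fix Q :: "('n \<times> 'n) weyl"
    assume "Q \<in> {lie_gen i j |i j. True}
      \<union> dop ` ({gram_cols i j |i j. True} \<union> {gram_rows i j |i j. True} \<union> {1 - det ymat})"
    then consider i j where "Q = lie_gen i j" | i j where "Q = dop (gram_cols i j)"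
      | i j where "Q = dop (gram_rows i j)" | "Q = dop (1 - det ymat)" by blast
    then show "Q \<in> ?S" by cases (simp_all only: lie_S gens_S)
  qed
  then have "P \<in> ?S" using P by (rule subsetD)
  with T show ?thesis by simp
qed

text \<open>If \<open>m\<close> has minimal degree in \<open>p\<close>, then the adjoint of multiplication by \<open>p\<close> maps \<open>x\<^sup>m\<close>
  to a nonzero constant.\<close>

lemma multiplication_notin_so_weyl_ideal:
  fixes P :: "('n::finite \<times> 'n) weyl"
  assumes P: "P \<in> so_weyl_ideal" and p: "\<And>f. weyl_apply P f = p * f"
  shows "P = 0"
proof -
  have "p = 0"
  proof (rule ccontr)
    assume "p \<noteq> 0"
    then have "Poly_Mapping.keys p \<noteq> {}" by simp
    then obtain m where m: "m \<in> Poly_Mapping.keys p" and min: "\<And>k. k \<in> Poly_Mapping.keys p \<Longrightarrow> tdeg m \<le> tdeg k"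
      using arg_min_if_finite[of "Poly_Mapping.keys p" tdeg] finite_keys[of p] by (meson not_le)
    define c where "c = of_nat (mfact m) * Poly_Mapping.lookup p m"
    have c: "c \<noteq> 0" using m mfact_pos[of m] by (simp add: c_def in_keys_iff)
    \<comment> \<open>A contribution \<open>m = a + k\<close> with \<open>k \<noteq> 0\<close> would
      come from a term \<open>a\<close> of \<open>p\<close> of smaller degree than \<open>m\<close>;
      so only the constant term of \<open>f\<close> counts.\<close>
    have lk: "Poly_Mapping.lookup (p * f) m = Poly_Mapping.lookup p m * Poly_Mapping.lookup f 0" for f
    proof (induction f rule: pm_induct)
      case (single k v)
      show ?case
      proof (cases "k = 0")
        case True
        have "Poly_Mapping.lookup (q * Poly_Mapping.single 0 v) m = Poly_Mapping.lookup q m * v" for q :: "('n \<times> 'n) mpoly"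
          by (induction q rule: pm_induct) (auto simp: mult_single lookup_single when_def distrib_right lookup_add)
        then show ?thesis by (simp add: True)
      next
        case False
        have "m \<notin> Poly_Mapping.keys (p * Poly_Mapping.single k v)"
        proof
          assume "m \<in> Poly_Mapping.keys (p * Poly_Mapping.single k v)"
          then obtain a where "a \<in> Poly_Mapping.keys p" "m = a + k"
            using keys_mult[of p "Poly_Mapping.single k v"] by (auto split: if_splits)
          with min[of a] False show False by (simp add: tdeg_add tdeg_eq_0)
        qed
        with False show ?thesis by (simp add: in_keys_iff lookup_single)
      qed
    qed (simp add: distrib_left lookup_add)
    obtain T where T: "adjoint_ops P T" using adjoint_ops_ex by blast
    have "fischer f (T (Poly_Mapping.single m 1)) = fischer f (mconst (cnj c))" for f
    proof -
      have "fischer f (T (Poly_Mapping.single m 1)) = fischer (p * f) (Poly_Mapping.single m 1)"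
        using T p by (simp add: adjoint_ops_def)
      also have "\<dots> = fischer f (mconst (cnj c))"
        by (simp add: fischer_single_right lk mconst_def c_def mfact_def)
      finally show ?thesis .
    qed
    then have "T (Poly_Mapping.single m 1) = mconst (cnj c)" by (rule fischer_eqI)
    then have "mconst (cnj c) \<in> (so_rot :: ('n \<times> 'n) mpoly set)"
      using adjoint_so_weyl_ideal[OF P T, of "Poly_Mapping.single m 1"] by simp
    then have "mconst (1 / cnj c) * mconst (cnj c) \<in> (so_rot :: ('n \<times> 'n) mpoly set)" by (rule so_rot_const)
    then show False using c by (simp add: mconst_mult[symmetric] one_notin_so_rot)
  qed
  then show ?thesis by (intro weyl_eqI) (simp add: p)
qed

lemma one_notin_so_weyl_ideal: "1 \<notin> so_weyl_ideal"
  using multiplication_notin_so_weyl_ideal[of 1 1] by auto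

section \<open>Cayley charts\<close>

definition adjugate :: "'a::comm_ring_1^'n^'n \<Rightarrow> 'a^'n^'n"
  where "adjugate M = (\<chi> i j. det (\<chi> k. if k = j then axis i 1 else M $ k))"

text \<open>Row \<open>l\<close> of \<open>M\<close> is expanded into unit vectors: the entry of the
  product becomes the determinant of \<open>M\<close> with row \<open>j\<close> replaced by row
  \<open>l\<close>.\<close>

lemma mult_adjugate: "M ** adjugate M = mat (det M)"
proof -
  have "(M ** adjugate M) $ l $ j = (if l = j then det M else 0)" for l j
  proof -
    have e: "(\<Sum>i\<in>UNIV. M $ l $ i *s axis i 1) = M $ l"
      by (simp add: vec_eq_iff axis_def if_distrib[of "(*) _"] cong: if_cong)
    have "(if l = j then det M else 0) = det (\<chi> k. if k = j then \<Sum>i\<in>UNIV. M $ l $ i *s axis i 1 else M $ k)"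
      by (simp only: e det_row_replace)
    also have "\<dots> = (\<Sum>i\<in>UNIV. det (\<chi> k. if k = j then M $ l $ i *s axis i 1 else M $ k))"
      by (rule det_linear_row_sum) simp
    also have "\<dots> = (M ** adjugate M) $ l $ j"
      by (simp add: det_row_mul matrix_matrix_mult_def adjugate_def)
    finally show ?thesis by simp
  qed
  then show ?thesis by (simp add: vec_eq_iff mat_def)
qed

lemma mat_mult_nth: "(mat d ** M) $ i $ j = d * M $ i $ j" for d :: "'a::comm_ring_1"
  by (simp add: matrix_matrix_mult_def mat_def if_distrib[of "\<lambda>x. x * _"] cong: if_cong)

lemma mult_mat_nth: "(M ** mat d) $ i $ j = d * M $ i $ j" for d :: "'a::comm_ring_1"
  by (simp add: matrix_matrix_mult_def mat_def if_distrib[of "(*) _"] mult.commute cong: if_cong)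

lemma mat_commute: "mat d ** M = M ** mat d" for d :: "'a::comm_ring_1"
  by (simp add: vec_eq_iff mat_mult_nth mult_mat_nth)

lemma det_mat_mult: "det (mat d ** M) = d ^ CARD('n) * det M" for M :: "'a::comm_ring_1^'n^'n"
proof -
  have "mat d ** M = (\<chi> i. d *s M $ i)" by (simp add: vec_eq_iff mat_mult_nth)
  then show ?thesis using det_rows_mul[of "\<lambda>_. d" "\<lambda>i. M $ i"] by simp
qed

lemma det_mat: "det (mat d :: 'a::comm_ring_1^'n^'n) = d ^ CARD('n)"
  using det_mat_mult[of d "mat 1 :: 'a^'n^'n"] by simp

lemma matrix_diff_ldistrib: "A ** (B - C) = A ** B - A ** (C :: 'a::comm_ring_1^'n^'n)"
  by (simp add: vec_eq_iff matrix_matrix_mult_def right_diff_distrib sum_subtractf)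

text \<open>The fields \<open>E i j\<close> generate the right translations on the orthogonal group. In the chart
  \<open>det (1 + Y) \<noteq> 0\<close> the Cayley coordinates of \<open>Y\<close> are, up to the factor \<open>\<Delta>\<close>, the
  entries of the adjugate \<open>P\<close> of \<open>1 + Y\<close> above the diagonal.\<close>

locale cayley_chart =
  fixes Y :: "'a::comm_ring_1^'n::{finite,linorder}^'n::{finite,linorder}"
    and c :: "complex \<Rightarrow> 'a" and E :: "'n \<Rightarrow> 'n \<Rightarrow> 'a \<Rightarrow> 'a"
  assumes c_add: "c (x + y) = c x + c y" and c_mult: "c (x * y) = c x * c y" and c_1: "c 1 = 1"
    and YtY: "transpose Y ** Y = mat 1" and YYt: "Y ** transpose Y = mat 1"
    and E_der: "derivation (E i j)" and E_c: "E i j (c x) = 0"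
    and E_Y: "E i j (Y $ k $ l) = (if l = j then Y $ k $ i else 0) - (if l = i then Y $ k $ j else 0)"
begin

definition Z where "Z = mat 1 + Y"
definition \<Delta> where "\<Delta> = det Z"
definition P where "P = adjugate Z"
text \<open>The adjugate taken from the left side. \<open>QZ\<close> is the identity it satisfies,
  and \<open>\<Delta>Q\<close> compares it with \<open>P\<close> after multiplication by
  \<open>\<Delta>\<close>.\<close>

definition Q where "Q = transpose (adjugate (transpose Z))"

lemma c_0: "c 0 = 0"
  using c_add[of 0 0] by simp

lemma c_uminus: "c (- x) = - c x"
  using c_add[of x "- x"] c_0 by (simp add: eq_neg_iff_add_eq_0 add.commute)

lemma c_of_nat: "c (of_nat k) = of_nat k"
  by (induction k) (simp_all add: c_0 c_1 c_add)

lemma c_half: "c (1 / 2) * 2 = 1"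
proof -
  have "c (1 / 2) * c (of_nat 2) = c (1 / 2 * of_nat 2)" by (rule c_mult[symmetric])
  then show ?thesis by (simp add: c_of_nat c_1 del: of_nat_numeral) (simp add: c_1)
qed

lemma ZP: "Z ** P = mat \<Delta>"
  unfolding P_def \<Delta>_def by (rule mult_adjugate)

lemma QZ: "Q ** Z = mat \<Delta>"
proof -
  have "transpose Z ** adjugate (transpose Z) = mat \<Delta>" by (simp add: mult_adjugate \<Delta>_def)
  from arg_cong[OF this, of transpose] show ?thesis by (simp add: matrix_transpose_mul Q_def)
qed

lemma \<Delta>Q: "mat \<Delta> ** Q = mat \<Delta> ** P"
proof -
  have "Q ** mat \<Delta> = mat \<Delta> ** P"
    unfolding ZP[symmetric] matrix_mul_assoc QZ ..
  then show ?thesis by (simp add: mat_commute)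
qed

lemma \<Delta>PZ: "mat \<Delta> ** P ** Z = mat \<Delta> ** mat \<Delta>"
  by (metis \<Delta>Q QZ matrix_mul_assoc)

lemma Zt: "transpose Z = transpose Y ** Z" and YZt: "Y ** transpose Z = Z"
proof -
  have "transpose Z = mat 1 + transpose Y" by (simp add: Z_def transpose_def vec_eq_iff mat_def)
  then show "transpose Z = transpose Y ** Z" "Y ** transpose Z = Z"
    by (simp_all add: Z_def matrix_add_ldistrib YtY YYt add.commute)
qed

text \<open>Cleared of denominators: for orthogonal \<open>Y\<close> the inverse of
  \<open>1 + Y\<close> is one half plus a skew matrix. Hence the entries above the diagonal
  determine all of \<open>mat \<Delta> ** P\<close>.\<close>

lemma PPt: "mat \<Delta> ** transpose P + mat \<Delta> ** P = mat \<Delta> ** mat \<Delta>"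
proof -
  have "transpose P ** transpose Y ** Z = mat \<Delta>"
    using arg_cong[OF ZP, of transpose] by (simp add: matrix_transpose_mul Zt matrix_mul_assoc)
  then have "transpose P ** transpose Y ** (Z ** P) ** Y = mat \<Delta> ** P ** Y"
    by (simp add: matrix_mul_assoc)
  then have "transpose P ** (transpose Y ** Y) ** mat \<Delta> = mat \<Delta> ** P ** Y"
    by (simp add: ZP) (metis mat_commute matrix_mul_assoc)
  then have "mat \<Delta> ** transpose P = mat \<Delta> ** P ** Y" by (simp add: YtY mat_commute)
  then have "mat \<Delta> ** transpose P + mat \<Delta> ** P = mat \<Delta> ** P ** Z"
    by (simp add: Z_def matrix_add_ldistrib add.commute)
  then show ?thesis by (simp add: \<Delta>PZ)
qed

lemma PPt_nth: "\<Delta> * P $ j $ i + \<Delta> * P $ i $ j = (if i = j then \<Delta> * \<Delta> else 0)"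
  using arg_cong[OF PPt, of "\<lambda>M. M $ i $ j"] by (cases "i = j") (simp_all add: mat_mult_nth, simp_all add: transpose_def mat_def)

section \<open>Polynomials in the Cayley coordinates, with denominators cleared\<close>

definition mon :: "('n \<times> 'n \<Rightarrow>\<^sub>0 nat) \<Rightarrow> 'a"
  where "mon m = (\<Prod>p\<in>UNIV. P $ fst p $ snd p ^ Poly_Mapping.lookup m p)"

definition upper :: "('n \<times> 'n \<Rightarrow>\<^sub>0 nat) \<Rightarrow> bool"
  where "upper m \<longleftrightarrow> (\<forall>p\<in>Poly_Mapping.keys m. fst p < snd p)"

definition upolys :: "nat \<Rightarrow> ('n \<times> 'n) mpoly set"
  where "upolys N = {\<psi>. \<forall>m\<in>Poly_Mapping.keys \<psi>. upper m \<and> tdeg m \<le> N}"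

text \<open>This stands for \<open>\<Delta> ^ N\<close> times the value of \<open>\<psi>\<close> at
  the Cayley coordinates \<open>P / \<Delta>\<close>. The subtraction in the exponent is exact on
  \<open>upolys N\<close>, where degrees are at most \<open>N\<close>.\<close>

definition \<Phi> :: "nat \<Rightarrow> ('n \<times> 'n) mpoly \<Rightarrow> 'a"
  where "\<Phi> N \<psi> = (\<Sum>m\<in>Poly_Mapping.keys \<psi>. c (Poly_Mapping.lookup \<psi> m) * (\<Delta> ^ (N - tdeg m) * mon m))"

definition S :: "nat \<Rightarrow> 'a set"
  where "S N = \<Phi> N ` upolys N"

lemma mon_add: "mon (m + m') = mon m * mon m'"
  by (simp add: mon_def lookup_add power_add prod.distrib)

lemma mon_0 [simp]: "mon 0 = 1"
  by (simp add: mon_def)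

lemma mon_single: "mon (Poly_Mapping.single p 1) = P $ fst p $ snd p"
proof -
  have "mon (Poly_Mapping.single p 1) = (\<Prod>q\<in>UNIV. if q = p then P $ fst q $ snd q else 1)"
    unfolding mon_def by (rule prod.cong) (auto simp: lookup_single when_def)
  then show ?thesis by simp
qed

lemma \<Phi>_add: "\<Phi> N (\<psi> + \<omega>) = \<Phi> N \<psi> + \<Phi> N \<omega>"
  unfolding \<Phi>_def by (rule pm_sum_add) (auto simp: c_add c_0 algebra_simps)

lemma \<Phi>_single: "\<Phi> N (Poly_Mapping.single m x) = c x * (\<Delta> ^ (N - tdeg m) * mon m)"
  unfolding \<Phi>_def
  by (rule pm_sum_single[where h = "\<lambda>m x. c x * (\<Delta> ^ (N - tdeg m) * mon m)"]) (simp add: c_0)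

lemma \<Phi>_0 [simp]: "\<Phi> N 0 = 0"
  by (simp add: \<Phi>_def)

lemma \<Phi>_sum: "\<Phi> N (\<Sum>k\<in>A. f k) = (\<Sum>k\<in>A. \<Phi> N (f k))"
  by (induction A rule: infinite_finite_induct) (auto simp: \<Phi>_add)

lemma pm_eq_sum_single: "p = (\<Sum>m\<in>Poly_Mapping.keys p. Poly_Mapping.single m (Poly_Mapping.lookup p m))"
  for p :: "'k \<Rightarrow>\<^sub>0 'z::comm_monoid_add"
  by (rule poly_mapping_eqI) (auto simp: lookup_sum lookup_single when_def in_keys_iff sum.delta')

lemma upper_add: "upper m \<Longrightarrow> upper m' \<Longrightarrow> upper (m + m')"
  using keys_add[of m m'] by (auto simp: upper_def)

lemma S_add: "a \<in> S N \<Longrightarrow> b \<in> S N \<Longrightarrow> a + b \<in> S N"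
proof -
  assume "a \<in> S N" "b \<in> S N"
  then obtain \<psi> \<omega> where *: "a = \<Phi> N \<psi>" "b = \<Phi> N \<omega>" "\<psi> \<in> upolys N" "\<omega> \<in> upolys N" by (auto simp: S_def)
  then have "\<psi> + \<omega> \<in> upolys N" using keys_add[of \<psi> \<omega>] by (auto simp: upolys_def)
  then show ?thesis using * by (auto simp: S_def \<Phi>_add[symmetric])
qed

lemma S_mult:
  assumes "a \<in> S N" "b \<in> S M"
  shows "a * b \<in> S (N + M)"
proof -
  from assms obtain \<psi> \<omega> where *: "a = \<Phi> N \<psi>" "b = \<Phi> M \<omega>" "\<psi> \<in> upolys N" "\<omega> \<in> upolys M"
    by (auto simp: S_def)
  have u: "\<psi> * \<omega> \<in> upolys (N + M)"
    using keys_mult[of \<psi> \<omega>] *(3,4) by (fastforce simp: upolys_def tdeg_add intro: upper_add add_mono)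
  have prod_eq: "\<psi> * \<omega> = (\<Sum>m\<in>Poly_Mapping.keys \<psi>. \<Sum>m'\<in>Poly_Mapping.keys \<omega>.
      Poly_Mapping.single (m + m') (Poly_Mapping.lookup \<psi> m * Poly_Mapping.lookup \<omega> m'))"
    by (subst pm_eq_sum_single[of \<psi>], subst pm_eq_sum_single[of \<omega>]) (simp add: sum_product mult_single)
  have "\<Phi> (N + M) (\<psi> * \<omega>) = (\<Sum>m\<in>Poly_Mapping.keys \<psi>. \<Sum>m'\<in>Poly_Mapping.keys \<omega>.
      c (Poly_Mapping.lookup \<psi> m) * (\<Delta> ^ (N - tdeg m) * mon m) *
      (c (Poly_Mapping.lookup \<omega> m') * (\<Delta> ^ (M - tdeg m') * mon m')))"
    unfolding prod_eq \<Phi>_sum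
  proof (intro sum.cong refl)
    fix m m' assume "m \<in> Poly_Mapping.keys \<psi>" "m' \<in> Poly_Mapping.keys \<omega>"
    then have "tdeg m \<le> N" "tdeg m' \<le> M" using *(3,4) by (auto simp: upolys_def)
    then have "N + M - tdeg (m + m') = (N - tdeg m) + (M - tdeg m')" by (simp add: tdeg_add)
    then show "\<Phi> (N + M) (Poly_Mapping.single (m + m') (Poly_Mapping.lookup \<psi> m * Poly_Mapping.lookup \<omega> m'))
      = c (Poly_Mapping.lookup \<psi> m) * (\<Delta> ^ (N - tdeg m) * mon m) *
        (c (Poly_Mapping.lookup \<omega> m') * (\<Delta> ^ (M - tdeg m') * mon m'))"
      by (simp add: \<Phi>_single mon_add c_mult power_add algebra_simps)
  qed
  also have "\<dots> = a * b" unfolding * \<Phi>_def by (simp add: sum_product)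
  finally show ?thesis using u by (force simp: S_def)
qed

lemma S_const: "c x * \<Delta> ^ N \<in> S N"
proof -
  have "Poly_Mapping.single 0 x \<in> upolys N" by (auto simp: upolys_def upper_def)
  moreover have "\<Phi> N (Poly_Mapping.single 0 x) = c x * \<Delta> ^ N" by (simp add: \<Phi>_single)
  ultimately show ?thesis by (force simp: S_def)
qed

lemma S_\<Delta>: "\<Delta> ^ N \<in> S N"
  using S_const[of 1 N] by (simp add: c_1)

lemma S_\<Delta>_mult: "a \<in> S N \<Longrightarrow> \<Delta> ^ k * a \<in> S (k + N)"
  by (rule S_mult[OF S_\<Delta>])

lemma S_0: "0 \<in> S N"
  using S_const[of 0 N] by (simp add: c_0)

lemma S_1: "1 \<in> S 0"
  using S_\<Delta>[of 0] by simp

lemma S_c: "c x \<in> S 0"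
  using S_const[of x 0] by simp

lemma S_c_mult: "a \<in> S N \<Longrightarrow> c x * a \<in> S N"
  using S_mult[OF S_c[of x], of a N] by simp

lemma S_uminus: "a \<in> S N \<Longrightarrow> - a \<in> S N"
  using S_c_mult[of a N "-1"] by (simp add: c_uminus c_1)

lemma S_sum: "(\<And>k. k \<in> A \<Longrightarrow> f k \<in> S N) \<Longrightarrow> (\<Sum>k\<in>A. f k) \<in> S N"
  by (induction A rule: infinite_finite_induct) (auto intro: S_0 S_add)

lemma S_prod: "finite A \<Longrightarrow> (\<And>k. k \<in> A \<Longrightarrow> f k \<in> S (d k)) \<Longrightarrow> (\<Prod>k\<in>A. f k) \<in> S (\<Sum>k\<in>A. d k)"
  by (induction A rule: finite_induct) (auto intro: S_1 S_mult)

lemma S_det: "(\<And>k l. M $ k $ l \<in> S (d k)) \<Longrightarrow> det M \<in> S (\<Sum>k\<in>UNIV. d k)"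
proof -
  assume M: "\<And>k l. M $ k $ l \<in> S (d k)"
  have "of_int (sign p) * x \<in> S N" if "x \<in> S N" for p :: "'b \<Rightarrow> 'b" and x N
    using that by (auto simp: sign_def intro: S_uminus)
  then show ?thesis unfolding det_def by (intro S_sum) (simp add: S_prod M)
qed

text \<open>Entries on and below the diagonal are reached through \<open>PPt_nth\<close>, which
  carries a factor \<open>\<Delta>\<close>; this is why the index is 2 and not 1.\<close>

lemma \<Delta>P_in: "\<Delta> * P $ i $ j \<in> S 2"
proof -
  have u: "\<Delta> * P $ i $ j \<in> S 2" if "i < j" for i j
  proof -
    have "Poly_Mapping.single (Poly_Mapping.single (i, j) 1) 1 \<in> upolys 1"
      using that by (auto simp: upolys_def upper_def)
    moreover have "\<Phi> 1 (Poly_Mapping.single (Poly_Mapping.single (i, j) 1) 1) = P $ i $ j"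
      using mon_single[of "(i, j)"] by (simp add: \<Phi>_single c_1)
    ultimately have "P $ i $ j \<in> S 1" by (force simp: S_def)
    from S_\<Delta>_mult[OF this, of 1] show ?thesis by (simp add: numeral_2_eq_2)
  qed
  consider "i < j" | "i = j" | "j < i" by (rule linorder_cases)
  then show ?thesis
  proof cases
    case 2
    have "2 * (\<Delta> * P $ i $ i) = \<Delta> ^ 2"
      using PPt_nth[of i i] by (simp add: power2_eq_square)
    then have "c (1 / 2) * (2 * (\<Delta> * P $ i $ i)) = c (1 / 2) * \<Delta> ^ 2" by simp
    then have "\<Delta> * P $ i $ i = c (1 / 2) * \<Delta> ^ 2" by (simp only: mult.assoc[symmetric] c_half mult_1_left)
    then show ?thesis using S_const[of "1/2" 2] 2 by simp
  next
    case 3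
    have "\<Delta> * P $ i $ j = - (\<Delta> * P $ j $ i)"
      using PPt_nth[of i j] 3 by (simp add: eq_neg_iff_add_eq_0 add.commute)
    with S_uminus[OF u[OF 3]] show ?thesis by simp
  qed (rule u)
qed

lemma \<Delta>_det_P: "\<Delta> * det P = \<Delta> ^ CARD('n)"
  using arg_cong[OF ZP, of det] by (simp add: det_mul det_mat \<Delta>_def)

definition H where "H = mat \<Delta> ** P"

lemma det_H: "\<Delta> * det H = \<Delta> ^ (2 * CARD('n))"
proof -
  have "\<Delta> * det H = \<Delta> ^ CARD('n) * (\<Delta> * det P)" by (simp add: H_def det_mat_mult mult.left_commute)
  then show ?thesis by (simp only: \<Delta>_det_P mult_2 power_add)
qed

lemma H_in: "H $ i $ j \<in> S 2"
  by (simp add: H_def mat_mult_nth \<Delta>P_in)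

text \<open>In localised terms: the inverse of \<open>\<Delta>\<close> is the determinant of the
  inverse of \<open>Z\<close>, hence a polynomial in the coordinates. Each row of \<open>H\<close>
  counts 2, and the extra 1 is the factor \<open>\<Delta>\<close> in \<open>det_H\<close>.\<close>

lemma \<Delta>_pow_in: "\<Delta> ^ (2 * CARD('n)) \<in> S (2 * CARD('n) + 1)"
proof -
  have "det H \<in> S (\<Sum>k\<in>(UNIV :: 'n set). 2)" by (rule S_det) (rule H_in)
  from S_\<Delta>_mult[OF this, of 1] show ?thesis by (simp add: det_H mult.commute)
qed

text \<open>\<open>Z\<close> is the inverse of its own inverse, so \<open>Z\<close> divided by
  \<open>\<Delta>\<close> is the adjugate of \<open>P / \<Delta>\<close>, a polynomial in the
  coordinates. The n - 1 rows of \<open>H\<close> entering a cofactor count 2(n - 1), and three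
  further factors of \<open>\<Delta>\<close> make 2n + 1.\<close>

lemma \<Delta>_pow_Z_in: "\<Delta> ^ (2 * CARD('n)) * Z $ i $ j \<in> S (2 * CARD('n) + 1)"
proof -
  have "Z ** H = mat (\<Delta> * \<Delta>)"
    unfolding H_def mat_commute[of \<Delta> P] matrix_mul_assoc ZP
    by (simp add: vec_eq_iff mat_mult_nth) (simp add: mat_def)
  then have "Z ** mat (det H) = mat (\<Delta> * \<Delta>) ** adjugate H"
    by (metis matrix_mul_assoc mult_adjugate)
  from arg_cong[OF this, of "\<lambda>M. M $ i $ j"]
  have "det H * Z $ i $ j = \<Delta> * \<Delta> * adjugate H $ i $ j" by (simp add: mat_mult_nth mult_mat_nth)
  then have "\<Delta> * det H * Z $ i $ j = \<Delta> ^ 3 * adjugate H $ i $ j"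
    by (simp add: power3_eq_cube mult.assoc)
  then have e: "\<Delta> ^ (2 * CARD('n)) * Z $ i $ j = \<Delta> ^ 3 * adjugate H $ i $ j" by (simp add: det_H)
  have "adjugate H $ i $ j \<in> S (\<Sum>k\<in>UNIV. if k = j then 0 else 2)"
    unfolding adjugate_def by simp (rule S_det, auto simp: axis_def H_in S_0 S_1)
  also have "(\<Sum>k\<in>(UNIV :: 'n set). if k = j then 0 else 2) = (\<Sum>k\<in>UNIV - {j}. 2 :: nat)"
    by (rule sum.mono_neutral_cong_right) auto
  also have "\<dots> = 2 * (CARD('n) - 1)" by (simp add: card_Diff_singleton)
  finally have "\<Delta> ^ 3 * adjugate H $ i $ j \<in> S (3 + 2 * (CARD('n) - 1))" by (rule S_\<Delta>_mult)
  moreover have "CARD('n) \<ge> 1" by (simp add: Suc_le_eq)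
  then have "3 + 2 * (CARD('n) - 1) = 2 * CARD('n) + 1" by linarith
  ultimately show ?thesis by (simp only: e)
qed

lemma \<Delta>_pow_Y_in: "\<Delta> ^ (2 * CARD('n)) * Y $ i $ j \<in> S (2 * CARD('n) + 1)"
proof -
  have Y: "Y $ i $ j = Z $ i $ j + - (if i = j then 1 else 0)" by (simp add: Z_def mat_def)
  show ?thesis unfolding Y distrib_left
    using S_uminus[OF \<Delta>_pow_in] S_0 by (intro S_add \<Delta>_pow_Z_in) auto
qed

text \<open>\<open>\<pi>\<close> will be the quotient map onto the coordinate ring and
  \<open>s\<close> the row signs of the chart. Each variable costs a factor
  \<open>\<Delta> ^ (2 * CARD('n))\<close> and raises the index of \<open>S\<close> by
  \<open>2 * CARD('n) + 1\<close>.\<close>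

lemma \<Delta>_pow_monom_in:
  assumes pi_mult: "\<And>f g. \<pi> (f * g) = \<pi> f * \<pi> g" and pi_1: "\<pi> 1 = 1"
    and pi_var: "\<And>i j. \<pi> (mvar (i, j)) = c (s i) * Y $ i $ j"
    and m: "tdeg m \<le> e"
  shows "\<Delta> ^ (2 * CARD('n) * e) * \<pi> (Poly_Mapping.single m (1 :: complex)) \<in> S ((2 * CARD('n) + 1) * e)"
  using m
proof (induction e arbitrary: m)
  case 0
  then have "m = 0" by (simp add: tdeg_eq_0)
  then show ?case by (simp add: pi_1 S_1)
next
  case (Suc e)
  let ?d = "2 * CARD('n)"
  have exp: "\<Delta> ^ (?d * Suc e) = \<Delta> ^ ?d * \<Delta> ^ (?d * e)" "(?d + 1) * Suc e = (?d + 1) + (?d + 1) * e"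
    by (simp_all add: power_add[symmetric] del: power_add)
  show ?case
  proof (cases "tdeg m \<le> e")
    case True
    \<comment> \<open>A monomial of lower degree is padded with the power of \<open>\<Delta>\<close>
      from \<open>\<Delta>_pow_in\<close>.\<close>
    from S_mult[OF \<Delta>_pow_in Suc.IH[OF True]] show ?thesis unfolding exp by (simp only: mult.assoc)
  next
    case False
    with Suc.prems have tm: "tdeg m = Suc e" by simp
    then have "m \<noteq> 0" by auto
    then obtain p where p: "Poly_Mapping.lookup m p \<noteq> 0" by (metis lookup_zero poly_mapping_eqI)
    define m' where "m' = m - Poly_Mapping.single p 1"
    have mm: "m = Poly_Mapping.single p 1 + m'"
      unfolding m'_def using p
      by (intro poly_mapping_eqI) (auto simp: lookup_add lookup_minus lookup_single when_def)
    have tm': "tdeg m' \<le> e" using tm unfolding mm tdeg_add tdeg_single by simp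
    obtain i j where ij: "p = (i, j)" by (cases p)
    have "Poly_Mapping.single m (1 :: complex) = mvar p * Poly_Mapping.single m' 1"
      by (simp add: mm mvar_def mult_single)
    then have "\<Delta> ^ (?d * Suc e) * \<pi> (Poly_Mapping.single m (1 :: complex))
        = (c (s i) * (\<Delta> ^ ?d * Y $ i $ j)) * (\<Delta> ^ (?d * e) * \<pi> (Poly_Mapping.single m' 1))"
      unfolding exp by (simp add: pi_mult ij pi_var mult_ac)
    also have "\<dots> \<in> S ((?d + 1) + (?d + 1) * e)"
      by (intro S_mult S_c_mult \<Delta>_pow_Y_in Suc.IH tm')
    finally show ?thesis by (simp add: exp(2))
  qed
qed

section \<open>Coordinate derivations obtained from the rotation fields\<close>

definition B where "B i j = (\<chi> a b. (if a = i \<and> b = j then 1 else 0) - (if a = j \<and> b = i then 1 else (0 :: 'a)))"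

text \<open>The coefficients are chosen so that \<open>Z\<close> is sent to \<open>2 Z B Z\<close>;
  formally the inverse of \<open>Z\<close> is then sent to the constant \<open>-2 B\<close>. For
  \<open>i < j\<close> this is, up to the factor -2, the derivative in the coordinate
  \<open>(i, j)\<close>.\<close>

definition X :: "'n \<Rightarrow> 'n \<Rightarrow> 'a \<Rightarrow> 'a"
  where "X i j f = (\<Sum>k\<in>UNIV. \<Sum>l\<in>UNIV. (transpose Z ** B i j ** Z) $ k $ l * E k l f)"

definition B2 where "B2 i j = mat 2 ** B i j"

definition \<tau> where "\<tau> i j = trace (B2 i j ** Z)"

lemma X_der: "derivation (X i j)"
  unfolding derivation_def X_def
  by (auto simp: derivation_add[OF E_der] derivation_mult[OF E_der] algebra_simps sum.distrib sum_distrib_left)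

lemma X_c: "X i j (c x) = 0"
  by (simp add: X_def E_c)

lemma B_transpose: "transpose (B i j) = - B i j"
proof -
  have "transpose (B i j) $ a $ b = (- B i j) $ a $ b" for a b
    by (cases "a = i"; cases "a = j"; cases "b = i"; cases "b = j") (simp_all add: B_def transpose_def)
  then show ?thesis by (simp only: vec_eq_iff) blast
qed

text \<open>The coefficient matrix \<open>C\<close> is skew, so both halves of \<open>E_Y\<close>
  give the same term and \<open>Y\<close> is sent to \<open>2 Y C\<close>; \<open>YZt\<close> turns
  \<open>Y C\<close> into \<open>Z B Z\<close>.\<close>

lemma X_Z: "X i j (Z $ a $ b) = (Z ** (B2 i j ** Z)) $ a $ b"
proof -
  define C where "C = transpose Z ** B i j ** Z"
  have Ct: "transpose C = - C"
  proof -
    have "transpose C = transpose Z ** (- B i j) ** Z"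
      by (simp add: C_def matrix_transpose_mul B_transpose matrix_mul_assoc)
    also have "\<dots> = - C"
      by (simp add: C_def vec_eq_iff matrix_matrix_mult_def sum_negf)
    finally show ?thesis .
  qed
  have Ca: "C $ b $ a = - C $ a $ b" for a b
    using arg_cong[OF Ct, of "\<lambda>M. M $ a $ b"] by (simp only: transpose_def vec_lambda_beta vector_uminus_component)
  have "X i j (Z $ a $ b) = X i j (Y $ a $ b)"
    by (simp add: Z_def derivation_add[OF X_der] mat_def derivation_0[OF X_der] derivation_1[OF X_der])
  also have "\<dots> = (\<Sum>k\<in>UNIV. \<Sum>l\<in>UNIV. C $ k $ l * ((if b = l then Y $ a $ k else 0) - (if b = k then Y $ a $ l else 0)))"
    by (simp add: X_def E_Y C_def)
  also have "\<dots> = (\<Sum>k\<in>UNIV. \<Sum>l\<in>UNIV. if b = l then C $ k $ l * Y $ a $ k else 0)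
      - (\<Sum>k\<in>UNIV. \<Sum>l\<in>UNIV. if b = k then C $ k $ l * Y $ a $ l else 0)"
    unfolding sum_subtractf[symmetric] by (intro sum.cong refl) (auto simp: algebra_simps)
  also have "\<dots> = (\<Sum>k\<in>UNIV. C $ k $ b * Y $ a $ k) - (\<Sum>l\<in>UNIV. C $ b $ l * Y $ a $ l)"
    by (subst (2) sum.swap) simp
  also have "(\<Sum>l\<in>UNIV. C $ b $ l * Y $ a $ l) = - (\<Sum>l\<in>UNIV. C $ l $ b * Y $ a $ l)"
    unfolding sum_negf[symmetric] by (intro sum.cong refl) (metis Ca minus_mult_left)
  also have "(\<Sum>k\<in>UNIV. C $ k $ b * Y $ a $ k) - - (\<Sum>l\<in>UNIV. C $ l $ b * Y $ a $ l) = 2 * (Y ** C) $ a $ b"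
    by (simp add: matrix_matrix_mult_def mult.commute)
  also have "Y ** C = Z ** B i j ** Z" by (simp add: C_def matrix_mul_assoc YZt)
  also have "2 * (Z ** B i j ** Z) $ a $ b = (Z ** (B2 i j ** Z)) $ a $ b"
  proof -
    have "Z ** (B2 i j ** Z) = mat 2 ** (Z ** B i j ** Z)"
      by (simp add: B2_def matrix_mul_assoc mat_commute[of 2 Z])
    then show ?thesis by (simp add: mat_mult_nth)
  qed
  finally show ?thesis .
qed

lemma X_\<Delta>: "X i j \<Delta> = \<tau> i j * \<Delta>"
  unfolding \<Delta>_def \<tau>_def by (rule derivation_det_right[OF X_der X_Z])

text \<open>Differentiate \<open>ZP\<close> and solve for the derivative of \<open>P\<close> by
  multiplying with \<open>Q\<close> from the left, which costs the factor
  \<open>\<Delta>\<close>.\<close>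

lemma X_P: "\<Delta> * X i j (P $ a $ b) = \<tau> i j * \<Delta> * P $ a $ b - \<Delta> * \<Delta> * B2 i j $ a $ b"
proof -
  define XP where "XP = (\<chi> a b. X i j (P $ a $ b))"
  have "Z ** (B2 i j ** Z) ** P + Z ** XP = mat (\<tau> i j * \<Delta>)"
  proof -
    have "(Z ** (B2 i j ** Z) ** P + Z ** XP) $ a $ b = mat (\<tau> i j * \<Delta>) $ a $ b" for a b
    proof -
      have "mat (\<tau> i j * \<Delta>) $ a $ b = X i j (mat \<Delta> $ a $ b)"
        by (simp add: mat_def X_\<Delta> derivation_0[OF X_der])
      also have "\<dots> = X i j (\<Sum>k\<in>UNIV. Z $ a $ k * P $ k $ b)"
        using arg_cong[OF ZP, of "\<lambda>M. M $ a $ b"] by (simp add: matrix_matrix_mult_def)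
      also have "\<dots> = (\<Sum>k\<in>UNIV. (Z ** (B2 i j ** Z)) $ a $ k * P $ k $ b) + (\<Sum>k\<in>UNIV. Z $ a $ k * XP $ k $ b)"
        by (simp add: derivation_sum[OF X_der] derivation_mult[OF X_der] X_Z XP_def sum.distrib)
      also have "\<dots> = (Z ** (B2 i j ** Z) ** P + Z ** XP) $ a $ b"
        by (simp add: matrix_matrix_mult_def[of "Z ** (B2 i j ** Z)"] matrix_matrix_mult_def[of Z XP])
      finally show ?thesis by simp
    qed
    then show ?thesis by (simp add: vec_eq_iff)
  qed
  moreover have "Z ** (B2 i j ** Z) ** P = Z ** B2 i j ** mat \<Delta>"
    unfolding ZP[symmetric] matrix_mul_assoc ..
  ultimately have "Z ** XP = mat (\<tau> i j * \<Delta>) - Z ** B2 i j ** mat \<Delta>"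
    by (metis add_diff_cancel_left')
  then have "Q ** (Z ** XP) = Q ** mat (\<tau> i j * \<Delta>) - Q ** (Z ** B2 i j ** mat \<Delta>)"
    by (simp only: matrix_diff_ldistrib)
  then have "mat \<Delta> ** XP = Q ** mat (\<tau> i j * \<Delta>) - mat \<Delta> ** B2 i j ** mat \<Delta>"
    by (simp add: matrix_mul_assoc QZ)
  from arg_cong[OF this, of "\<lambda>M. M $ a $ b"]
  have "\<Delta> * XP $ a $ b = \<tau> i j * \<Delta> * Q $ a $ b - \<Delta> * \<Delta> * B2 i j $ a $ b"
    by (simp add: mat_mult_nth mult_mat_nth mult.assoc)
  moreover have "\<Delta> * Q $ a $ b = \<Delta> * P $ a $ b"
    using arg_cong[OF \<Delta>Q, of "\<lambda>M. M $ a $ b"] by (simp add: mat_mult_nth)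
  ultimately show ?thesis by (simp add: XP_def mult.assoc)
qed

lemma B2_nth: "i < j \<Longrightarrow> a < b \<Longrightarrow> B2 i j $ a $ b = (if (a, b) = (i, j) then 2 else 0)"
  for i j a b :: 'n
proof -
  assume "i < j" "a < b"
  then have no: "\<not> (a = j \<and> b = i)" by auto
  have "B2 i j $ a $ b = 2 * ((if a = i \<and> b = j then 1 else 0) - (if a = j \<and> b = i then 1 else 0))"
    by (simp only: B2_def mat_mult_nth B_def vec_lambda_beta)
  then show ?thesis by (simp only: no if_False diff_zero if_distrib[of "(*) 2"] mult_1_right mult_zero_right prod.inject)
qed

text \<open>Each factor of the monomial contributes \<open>\<tau> i j\<close>, the logarithmic
  derivative of \<open>\<Delta>\<close>; a factor equal to the coordinate \<open>(i, j)\<close>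
  contributes the actual derivative.\<close>

lemma X_mon:
  assumes "upper m" and ij: "i < j"
  shows "\<Delta> * X i j (mon m) = \<tau> i j * of_nat (tdeg m) * \<Delta> * mon m
     - 2 * of_nat (Poly_Mapping.lookup m (i, j)) * (\<Delta> * \<Delta>) * mon (m - Poly_Mapping.single (i, j) 1)"
  using assms(1)
proof (induction "tdeg m" arbitrary: m)
  case 0
  then have "m = 0" by (metis tdeg_eq_0)
  then show ?case by (simp add: derivation_1[OF X_der])
next
  case (Suc t)
  then have "m \<noteq> 0" by auto
  then obtain p where p: "Poly_Mapping.lookup m p \<noteq> 0" by (metis lookup_zero poly_mapping_eqI)
  define m' where "m' = m - Poly_Mapping.single p 1"
  have mm: "m = Poly_Mapping.single p 1 + m'"
    unfolding m'_def using p
    by (intro poly_mapping_eqI) (auto simp: lookup_add lookup_minus lookup_single when_def)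
  have t: "t = tdeg m'" using Suc.hyps(2) unfolding mm tdeg_add tdeg_single by simp
  have up: "upper m'"
    using Suc.prems unfolding upper_def m'_def by (auto simp: in_keys_iff lookup_minus)
  have lt: "fst p < snd p" using Suc.prems p by (auto simp: upper_def in_keys_iff)
  define x where "x = P $ fst p $ snd p"
  define e where "e = Poly_Mapping.single (i, j) (1::nat)"
  define r where "r = Poly_Mapping.lookup m' (i, j)"
  have mon: "mon m = x * mon m'" unfolding mm mon_add mon_single x_def ..
  have Xx: "\<Delta> * X i j x = \<tau> i j * \<Delta> * x - \<Delta> * \<Delta> * (if p = (i, j) then 2 else 0)"
    unfolding x_def X_P B2_nth[OF ij lt] by simp
  have IH: "\<Delta> * X i j (mon m') = \<tau> i j * of_nat t * \<Delta> * mon m' - 2 * of_nat r * (\<Delta> * \<Delta>) * mon (m' - e)"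
    using Suc.hyps(1)[OF t up] unfolding t r_def e_def .
  have "\<Delta> * X i j (mon m) = (\<Delta> * X i j x) * mon m' + x * (\<Delta> * X i j (mon m'))"
    unfolding mon by (simp add: derivation_mult[OF X_der] algebra_simps)
  also have "\<dots> = \<tau> i j * of_nat (Suc t) * \<Delta> * mon m
      - 2 * (\<Delta> * \<Delta>) * ((if p = (i, j) then mon m' else 0) + of_nat r * (x * mon (m' - e)))"
    unfolding Xx IH mon by (simp add: algebra_simps)
  also have "(if p = (i, j) then mon m' else 0) + of_nat r * (x * mon (m' - e))
      = of_nat (Poly_Mapping.lookup m (i, j)) * mon (m - e)"
  proof (cases "r = 0")
    case True
    show ?thesis
    proof (cases "p = (i, j)")
      case pij: True
      have "m - e = m'" unfolding mm e_def pij by simp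
      then show ?thesis using pij True by (simp add: mm lookup_add r_def)
    next
      case False
      then show ?thesis using True by (simp add: mm lookup_add r_def lookup_single)
    qed
  next
    case False
    then have "m' - e + Poly_Mapping.single p 1 = m - e"
      unfolding mm e_def r_def
      by (intro poly_mapping_eqI) (auto simp: lookup_add lookup_minus lookup_single when_def)
    then have xm: "x * mon (m' - e) = mon (m - e)" by (metis mon_add mon_single x_def mult.commute)
    have "m - e = m'" if "p = (i, j)" unfolding mm e_def that by simp
    then show ?thesis unfolding xm
      by (auto simp: mm lookup_add r_def lookup_single when_def algebra_simps)
  qed
  finally show ?case by (simp add: Suc.hyps(2)[symmetric] e_def algebra_simps)
qed

lemma X_\<Phi>_single:
  assumes up: "upper m" and tN: "tdeg m \<le> N" and ij: "i < j"
  shows "\<Delta> * X i j (\<Phi> N (Poly_Mapping.single m x)) = of_nat N * \<tau> i j * \<Delta> * \<Phi> N (Poly_Mapping.single m x)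
     - 2 * \<Phi> (N + 1) (mpderiv (i, j) (Poly_Mapping.single m x))"
proof -
  define k where "k = N - tdeg m"
  have N: "of_nat N = (of_nat k + of_nat (tdeg m) :: 'a)"
    using tN unfolding k_def by (simp add: of_nat_add[symmetric] del: of_nat_add)
  define e where "e = Poly_Mapping.single (i, j) (1::nat)"
  define r where "r = Poly_Mapping.lookup m (i, j)"
  have Xk: "X i j (\<Delta> ^ k) = of_nat k * \<tau> i j * \<Delta> ^ k"
    unfolding derivation_power[OF X_der] X_\<Delta> by (cases k) (simp_all add: algebra_simps)
  have "\<Delta> * X i j (\<Phi> N (Poly_Mapping.single m x))
      = c x * (\<Delta> * X i j (\<Delta> ^ k) * mon m + \<Delta> ^ k * (\<Delta> * X i j (mon m)))"
    by (simp add: \<Phi>_single derivation_mult[OF X_der] X_c k_def algebra_simps)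
  also have "\<dots> = of_nat N * \<tau> i j * \<Delta> * (c x * (\<Delta> ^ k * mon m)) - 2 * (c x * of_nat r * (\<Delta> ^ (k + 2) * mon (m - e)))"
    unfolding Xk X_mon[OF up ij] N r_def e_def by (simp add: algebra_simps)
  also have "c x * of_nat r * (\<Delta> ^ (k + 2) * mon (m - e)) = \<Phi> (N + 1) (mpderiv (i, j) (Poly_Mapping.single m x))"
  proof (cases "r = 0")
    case True
    then show ?thesis by (simp add: mpderiv_single r_def)
  next
    case False
    then have "m = e + (m - e)"
      unfolding r_def e_def by (intro poly_mapping_eqI) (auto simp: lookup_add lookup_minus lookup_single when_def)
    then have "tdeg m = 1 + tdeg (m - e)" by (metis tdeg_add tdeg_single e_def)
    \<comment> \<open>Differentiation lowers the degree by one and the index \<open>N\<close> rises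
      by one, so the exponent of \<open>\<Delta>\<close> rises by two.\<close>
    then have "N + 1 - tdeg (m - e) = k + 2" using tN by (simp add: k_def)
    then show ?thesis
      by (simp add: mpderiv_single \<Phi>_single e_def[symmetric] r_def[symmetric] c_mult c_of_nat mult_ac del: One_nat_def)
  qed
  finally show ?thesis by (simp add: \<Phi>_single k_def)
qed

text \<open>The quotient \<open>P / \<Delta>\<close> is differentiated like a coordinate, and the
  power \<open>\<Delta> ^ N\<close> adds \<open>N\<close> times \<open>\<tau> i j\<close>. The first
  summand is a multiple of \<open>\<Phi> N \<psi>\<close>, so an ideal stable under the fields also
  contains the second.\<close>

lemma X_\<Phi>:
  assumes \<psi>: "\<psi> \<in> upolys N" and ij: "i < j"
  shows "\<Delta> * X i j (\<Phi> N \<psi>) = of_nat N * \<tau> i j * \<Delta> * \<Phi> N \<psi> - 2 * \<Phi> (N + 1) (mpderiv (i, j) \<psi>)"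
proof -
  let ?s = "\<lambda>m. Poly_Mapping.single m (Poly_Mapping.lookup \<psi> m)"
  have "\<Delta> * X i j (\<Phi> N (\<Sum>m\<in>Poly_Mapping.keys \<psi>. ?s m))
      = (\<Sum>m\<in>Poly_Mapping.keys \<psi>. \<Delta> * X i j (\<Phi> N (?s m)))"
    by (simp add: \<Phi>_sum derivation_sum[OF X_der] sum_distrib_left)
  also have "\<dots> = (\<Sum>m\<in>Poly_Mapping.keys \<psi>. of_nat N * \<tau> i j * \<Delta> * \<Phi> N (?s m)
      - 2 * \<Phi> (N + 1) (mpderiv (i, j) (?s m)))"
    using \<psi> by (intro sum.cong refl X_\<Phi>_single ij) (auto simp: upolys_def)
  also have "\<dots> = of_nat N * \<tau> i j * \<Delta> * \<Phi> N (\<Sum>m\<in>Poly_Mapping.keys \<psi>. ?s m)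
      - 2 * \<Phi> (N + 1) (mpderiv (i, j) (\<Sum>m\<in>Poly_Mapping.keys \<psi>. ?s m))"
    by (simp add: \<Phi>_sum mpderiv_sum sum_subtractf sum_distrib_left)
  finally show ?thesis unfolding pm_eq_sum_single[of \<psi>, symmetric] .
qed

text \<open>Coordinate derivatives lower the degree until a nonzero constant times a power of
  \<open>\<Delta>\<close> is left; characteristic zero keeps a chosen coefficient from
  vanishing.\<close>

lemma \<Delta>_pow_in_ideal:
  assumes L: "left_ideal L" and LE: "\<And>i j f. f \<in> L \<Longrightarrow> E i j f \<in> L"
    and "\<psi> \<noteq> 0" "\<psi> \<in> upolys N" "\<Phi> N \<psi> \<in> L" "\<And>m. m \<in> Poly_Mapping.keys \<psi> \<Longrightarrow> tdeg m \<le> d"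
  shows "\<exists>M. \<Delta> ^ M \<in> L"
  using assms(3-)
proof (induction d arbitrary: \<psi> N)
  case 0
  then have "Poly_Mapping.keys \<psi> \<noteq> {}" "Poly_Mapping.keys \<psi> \<subseteq> {0}" by (auto simp: tdeg_eq_0)
  then have k: "Poly_Mapping.keys \<psi> = {0}" by (metis subset_singleton_iff)
  define z where "z = Poly_Mapping.lookup \<psi> 0"
  have z: "z \<noteq> 0" using k by (auto simp: z_def in_keys_iff[symmetric])
  have "\<Phi> N \<psi> = c z * \<Delta> ^ N" by (simp add: \<Phi>_def k z_def)
  then have "c (1 / z) * (c z * \<Delta> ^ N) \<in> L" using left_ideal_mult[OF L \<open>\<Phi> N \<psi> \<in> L\<close>] by metis
  then have "\<Delta> ^ N \<in> L" using z by (simp add: mult.assoc[symmetric] c_mult[symmetric] c_1)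
  then show ?case ..
next
  case (Suc d)
  show ?case
  proof (cases "\<forall>m\<in>Poly_Mapping.keys \<psi>. m = 0")
    case True
    then show ?thesis using Suc.prems by (intro Suc.IH) auto
  next
    case False
    then obtain m where m: "m \<in> Poly_Mapping.keys \<psi>" "m \<noteq> 0" by auto
    then obtain p where p: "Poly_Mapping.lookup m p \<noteq> 0" by (metis lookup_zero poly_mapping_eqI)
    obtain i j where pij: "p = (i, j)" by (cases p)
    have "upper m" using m Suc.prems by (auto simp: upolys_def)
    from this[unfolded upper_def, THEN bspec, of p] p have ij: "i < j" by (simp add: in_keys_iff pij)
    define \<psi>' where "\<psi>' = mpderiv (i, j) \<psi>"
    have key: "k + Poly_Mapping.single (i, j) 1 \<in> Poly_Mapping.keys \<psi>" if "k \<in> Poly_Mapping.keys \<psi>'" for k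
      using that by (auto simp: \<psi>'_def in_keys_iff lookup_mpderiv)
    have "m - Poly_Mapping.single p 1 + Poly_Mapping.single p 1 = m"
      using p by (intro poly_mapping_eqI) (auto simp: lookup_add lookup_minus lookup_single when_def)
    then have "Poly_Mapping.lookup \<psi>' (m - Poly_Mapping.single p 1) \<noteq> 0"
      unfolding \<psi>'_def pij[symmetric] lookup_mpderiv using m(1) p
      by (simp add: in_keys_iff del: of_nat_Suc)
    then have "\<psi>' \<noteq> 0" by auto
    moreover have "\<psi>' \<in> upolys (N + 1)"
    proof -
      have "upper k \<and> tdeg k \<le> N + 1" if "k \<in> Poly_Mapping.keys \<psi>'" for k
      proof -
        have "upper (k + Poly_Mapping.single (i, j) 1)" "tdeg (k + Poly_Mapping.single (i, j) 1) \<le> N"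
          using key[OF that] Suc.prems(2) by (auto simp: upolys_def)
        then show ?thesis by (auto simp: upper_def tdeg_add in_keys_iff lookup_add)
      qed
      then show ?thesis by (simp add: upolys_def)
    qed
    moreover have "\<Phi> (N + 1) \<psi>' \<in> L"
    proof -
      have "X i j (\<Phi> N \<psi>) \<in> L"
        unfolding X_def by (intro left_ideal_sum[OF L] left_ideal_mult[OF L] LE Suc.prems)
      then have "of_nat N * \<tau> i j * \<Delta> * \<Phi> N \<psi> - \<Delta> * X i j (\<Phi> N \<psi>) \<in> L"
        by (intro left_ideal_diff[OF L] left_ideal_mult[OF L] Suc.prems)
      then have "2 * \<Phi> (N + 1) \<psi>' \<in> L"
        unfolding X_\<Phi>[OF Suc.prems(2) ij] \<psi>'_def by simp
      then have "c (1 / 2) * (2 * \<Phi> (N + 1) \<psi>') \<in> L" by (rule left_ideal_mult[OF L])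
      then show ?thesis by (simp only: mult.assoc[symmetric] c_half mult_1_left)
    qed
    moreover have "tdeg k \<le> d" if "k \<in> Poly_Mapping.keys \<psi>'" for k
      using Suc.prems(4)[OF key[OF that]] by (simp add: tdeg_add)
    ultimately show ?thesis by (rule Suc.IH)
  qed
qed

text \<open>After inverting \<open>\<Delta>\<close> a stable ideal is everything or zero. An element
  that no power of \<open>\<Delta>\<close> kills becomes, after multiplication by such a power, the
  value of a nonzero polynomial in the coordinates, to which the differentiation argument
  applies.\<close>

lemma chart_dichotomy:
  assumes L: "left_ideal L" and LE: "\<And>i j f. f \<in> L \<Longrightarrow> E i j f \<in> L"
    and pi_add: "\<And>f g. \<pi> (f + g) = \<pi> f + \<pi> g"
    and pi_mult: "\<And>f g. \<pi> (f * g) = \<pi> f * \<pi> g" and pi_const: "\<And>x. \<pi> (mconst x) = c x"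
    and pi_var: "\<And>i j. \<pi> (mvar (i, j)) = c (s i) * Y $ i $ j" and pi_surj: "surj \<pi>"
  shows "(\<exists>M. \<Delta> ^ M \<in> L) \<or> (\<forall>f\<in>L. \<exists>M. \<Delta> ^ M * f = 0)"
proof -
  have "\<exists>M. \<Delta> ^ M \<in> L" if f: "f \<in> L" and nz: "\<And>M. \<Delta> ^ M * f \<noteq> 0" for f
  proof -
    obtain g where g: "f = \<pi> g" using pi_surj by (metis surjD)
    obtain e where e: "g \<in> polys_le e" using polys_le_ex by blast
    let ?K = "2 * CARD('n) * e" and ?N = "(2 * CARD('n) + 1) * e"
    have pi0: "\<pi> 0 = 0" using pi_add[of 0 0] by simp
    have pi1: "\<pi> 1 = 1" using pi_const[of 1] by (simp add: c_1)
    have pis: "\<pi> (\<Sum>m\<in>A. h m) = (\<Sum>m\<in>A. \<pi> (h m))" for A and h :: "('n \<times> 'n \<Rightarrow>\<^sub>0 nat) \<Rightarrow> ('n \<times> 'n) mpoly"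
      by (induction A rule: infinite_finite_induct) (auto simp: pi0 pi_add)
    have "\<Delta> ^ ?K * \<pi> g = (\<Sum>m\<in>Poly_Mapping.keys g. c (Poly_Mapping.lookup g m) * (\<Delta> ^ ?K * \<pi> (Poly_Mapping.single m 1)))"
      by (subst mpoly_eq_sum[of g]) (simp add: pis pi_mult pi_const sum_distrib_left mult.left_commute)
    also have "\<dots> \<in> S ?N"
      using e by (intro S_sum S_c_mult \<Delta>_pow_monom_in[where s = s] pi_mult pi1 pi_var) (auto simp: polys_le_def)
    finally obtain \<psi> where \<psi>: "\<psi> \<in> upolys ?N" "\<Delta> ^ ?K * f = \<Phi> ?N \<psi>" by (auto simp: S_def g)
    have "\<psi> \<noteq> 0" using nz[of ?K] \<psi>(2) by auto
    moreover have "\<Phi> ?N \<psi> \<in> L" unfolding \<psi>(2)[symmetric] by (rule left_ideal_mult[OF L f])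
    ultimately show ?thesis
      using \<psi>(1) by (intro \<Delta>_pow_in_ideal[OF L LE, where \<psi> = \<psi> and N = "?N" and d = "?N"]) (auto simp: upolys_def)
  qed
  then show ?thesis by blast
qed

end

section \<open>Invariant ideals of the coordinate ring\<close>

lemma so_ideal_eqI: "f = g \<Longrightarrow> f - g \<in> so_ideal"
  using left_ideal_0[OF left_ideal_so_ideal] by simp

lemma so_ideal_mult_cong:
  assumes "a - a' \<in> so_ideal" "b - b' \<in> so_ideal"
  shows "a * b - a' * b' \<in> so_ideal"
proof -
  have "a * b - a' * b' = b * (a - a') + a' * (b - b')" by (simp add: algebra_simps)
  then show ?thesis using assms by (simp add: left_ideal_add left_ideal_mult left_ideal_so_ideal)
qed

lemma so_ideal_add_cong: "a - a' \<in> so_ideal \<Longrightarrow> b - b' \<in> so_ideal \<Longrightarrow> a + b - (a' + b') \<in> so_ideal"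
  unfolding add_diff_add by (rule left_ideal_add[OF left_ideal_so_ideal])

lemma so_ideal_uminus_cong:
  assumes "a - a' \<in> so_ideal"
  shows "- a - - a' \<in> so_ideal"
  using left_ideal_uminus[OF left_ideal_so_ideal assms] by simp

lemma so_ideal_diff_cong: "a - a' \<in> so_ideal \<Longrightarrow> b - b' \<in> so_ideal \<Longrightarrow> a - b - (a' - b') \<in> so_ideal"
  using so_ideal_add_cong[OF _ so_ideal_uminus_cong] by fastforce

\<comment> \<open>The chart computations are identities in a commutative ring over which the matrix
  is exactly orthogonal, so the coordinate ring is made a type of its own.\<close>
quotient_type (overloaded) 'n so_ring = "('n::finite \<times> 'n) mpoly" / "\<lambda>f g. f - g \<in> so_ideal"
proof (rule equivpI)
  note L = left_ideal_so_ideal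
  show "reflp (\<lambda>f g :: ('n \<times> 'n) mpoly. f - g \<in> so_ideal)"
    by (simp add: reflp_def left_ideal_0[OF L])
  show "symp (\<lambda>f g :: ('n \<times> 'n) mpoly. f - g \<in> so_ideal)"
    using left_ideal_uminus[OF L] by (force simp: symp_def)
  show "transp (\<lambda>f g :: ('n \<times> 'n) mpoly. f - g \<in> so_ideal)"
    using left_ideal_add[OF L] by (force simp: transp_def)
qed

instantiation so_ring :: (finite) comm_ring_1
begin

lift_definition zero_so_ring :: "'a so_ring" is 0 .
lift_definition one_so_ring :: "'a so_ring" is 1 .
lift_definition plus_so_ring :: "'a so_ring \<Rightarrow> 'a so_ring \<Rightarrow> 'a so_ring" is "(+)"
  by (rule so_ideal_add_cong)
lift_definition uminus_so_ring :: "'a so_ring \<Rightarrow> 'a so_ring" is uminus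
  by (rule so_ideal_uminus_cong)
lift_definition minus_so_ring :: "'a so_ring \<Rightarrow> 'a so_ring \<Rightarrow> 'a so_ring" is "(-)"
  by (rule so_ideal_diff_cong)
lift_definition times_so_ring :: "'a so_ring \<Rightarrow> 'a so_ring \<Rightarrow> 'a so_ring" is "(*)"
  by (rule so_ideal_mult_cong)

instance
proof
  fix a b c :: "'a so_ring"
  show "a * b * c = a * (b * c)" by transfer (rule so_ideal_eqI, simp add: algebra_simps)
  show "a * b = b * a" by transfer (rule so_ideal_eqI, simp add: algebra_simps)
  show "1 * a = a" by transfer (rule so_ideal_eqI, simp add: algebra_simps)
  show "(a + b) * c = a * c + b * c" by transfer (rule so_ideal_eqI, simp add: algebra_simps)
  show "a + b + c = a + (b + c)" by transfer (rule so_ideal_eqI, simp add: algebra_simps)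
  show "a + b = b + a" by transfer (rule so_ideal_eqI, simp add: algebra_simps)
  show "0 + a = a" by transfer (rule so_ideal_eqI, simp add: algebra_simps)
  show "- a + a = 0" by transfer (rule so_ideal_eqI, simp add: algebra_simps)
  show "a - b = a + - b" by transfer (rule so_ideal_eqI, simp add: algebra_simps)
  show "(0 :: 'a so_ring) \<noteq> 1"
  proof (transfer, rule notI)
    assume "(0 :: ('a \<times> 'a) mpoly) - 1 \<in> so_ideal"
    from left_ideal_uminus[OF left_ideal_so_ideal this] show False by (simp add: one_notin_so_ideal)
  qed
qed

end

definition so_class :: "('n::finite \<times> 'n) mpoly \<Rightarrow> 'n so_ring"
  where "so_class = abs_so_ring"

lift_definition rot_class :: "'n::finite \<Rightarrow> 'n \<Rightarrow> 'n so_ring \<Rightarrow> 'n so_ring" is rot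
  by (simp add: derivation_diff[OF derivation_rot, symmetric] rot_so_ideal)

lemma so_class_add: "so_class (f + g) = so_class f + so_class g"
  by (simp add: so_class_def plus_so_ring.abs_eq)

lemma so_class_mult: "so_class (f * g) = so_class f * so_class g"
  by (simp add: so_class_def times_so_ring.abs_eq)

lemma so_class_diff: "so_class (f - g) = so_class f - so_class g"
  by (simp add: so_class_def minus_so_ring.abs_eq)

lemma so_class_0 [simp]: "so_class 0 = 0"
  by (simp add: so_class_def zero_so_ring_def)

lemma so_class_1 [simp]: "so_class 1 = 1"
  by (simp add: so_class_def one_so_ring_def)

lemma so_class_uminus: "so_class (- f) = - so_class f"
  using so_class_diff[of 0 f] by simp

lemma so_class_eq_0: "so_class f = 0 \<longleftrightarrow> f \<in> so_ideal"
  by (simp add: so_class_def zero_so_ring_def so_ring.abs_eq_iff)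

lemma so_class_sum: "so_class (\<Sum>k\<in>S. f k) = (\<Sum>k\<in>S. so_class (f k))"
  by (induction S rule: infinite_finite_induct) (simp_all add: so_class_add)

lemma so_class_prod: "so_class (\<Prod>k\<in>S. f k) = (\<Prod>k\<in>S. so_class (f k))"
  by (induction S rule: infinite_finite_induct) (simp_all add: so_class_mult)

lemma so_class_power: "so_class (f ^ n) = so_class f ^ n"
  by (induction n) (simp_all add: so_class_mult)

lemma so_class_of_int: "so_class (of_int z) = of_int z"
proof -
  have n: "so_class (of_nat k) = of_nat k" for k
    by (induction k) (simp_all add: so_class_add)
  show ?thesis by (cases z rule: int_cases2) (simp_all add: n so_class_uminus)
qed

lemma so_class_det: "so_class (det M) = det (\<chi> i j. so_class (M $ i $ j))"
  by (simp add: det_def so_class_sum so_class_mult so_class_of_int so_class_prod)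

lemma surj_so_class: "surj so_class"
  unfolding surj_def
proof
  fix y :: "'a so_ring"
  show "\<exists>x. y = so_class x" by (induction y) (metis so_class_def)
qed

lemma rot_class_class: "rot_class i j (so_class f) = so_class (rot i j f)"
  by (simp add: so_class_def rot_class.abs_eq)

lemma derivation_rot_class: "derivation (rot_class i j)"
  unfolding derivation_def
proof (intro conjI allI)
  fix a b :: "'a so_ring"
  show "rot_class i j (a + b) = rot_class i j a + rot_class i j b"
    by transfer (rule so_ideal_eqI, simp add: derivation_add[OF derivation_rot])
  show "rot_class i j (a * b) = rot_class i j a * b + a * rot_class i j b"
    by transfer (rule so_ideal_eqI, simp add: derivation_mult[OF derivation_rot])
qed

definition so_mat :: "'n so_ring^'n::finite^'n::finite"
  where "so_mat = (\<chi> i j. so_class (mvar (i, j)))"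

lemma so_mat_orth:
  "transpose so_mat ** so_mat = (mat 1 :: 'n::finite so_ring^'n::finite^'n::finite)"
  "so_mat ** transpose so_mat = (mat 1 :: 'n::finite so_ring^'n::finite^'n::finite)"
proof -
  have g: "so_class (gram_cols i j) = 0" "so_class (gram_rows i j) = 0" for i j :: 'n
    by (simp_all add: so_class_eq_0 gram_cols_in gram_rows_in)
  have "(\<Sum>k\<in>UNIV. so_class (mvar (k, i)) * so_class (mvar (k, j))) = (if i = j then 1 else 0)" for i j :: 'n
    using g(1)[of i j] unfolding gram_cols_def so_class_diff so_class_sum so_class_mult
    by (cases "i = j") simp_all
  then show "transpose so_mat ** so_mat = (mat 1 :: 'n so_ring^'n^'n)"
    by (simp add: vec_eq_iff matrix_matrix_mult_def transpose_def so_mat_def mat_def)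
  have "(\<Sum>k\<in>UNIV. so_class (mvar (i, k)) * so_class (mvar (j, k))) = (if i = j then 1 else 0)" for i j :: 'n
    using g(2)[of i j] unfolding gram_rows_def so_class_diff so_class_sum so_class_mult
    by (cases "i = j") simp_all
  then show "so_mat ** transpose so_mat = (mat 1 :: 'n so_ring^'n^'n)"
    by (simp add: vec_eq_iff matrix_matrix_mult_def transpose_def so_mat_def mat_def)
qed

lemma so_mat_det: "det so_mat = 1"
proof -
  have "so_class (1 - det ymat) = 0" by (simp add: so_class_eq_0 det_in)
  then show ?thesis by (simp add: so_class_diff so_class_det ymat_def so_mat_def)
qed

section \<open>Sign matrices and the covering by Cayley charts\<close>

definition signs :: "('n::finite \<Rightarrow> int) set"
  where "signs = PiE UNIV (\<lambda>_. {1, -1})"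

text \<open>Multiplication by a diagonal sign matrix from the left commutes with right rotations, so
  the same fields \<open>rot_class\<close> serve in every chart.\<close>

definition row_scale :: "('n::finite \<Rightarrow> int) \<Rightarrow> 'a::comm_ring_1^'n^'n \<Rightarrow> 'a^'n^'n"
  where "row_scale e M = (\<chi> i j. of_int (e i) * M $ i $ j)"

lemma signs_square: "e \<in> signs \<Longrightarrow> e i * e i = 1"
  using PiE_mem[of e UNIV "\<lambda>_. {1, -1}" i] by (auto simp: signs_def)

lemma row_scale_orth:
  assumes e: "e \<in> signs"
  shows "transpose (row_scale e M) ** row_scale e M = transpose M ** M"
proof -
  have "(of_int (e k) * M $ k $ i) * (of_int (e k) * M $ k $ j) = M $ k $ i * M $ k $ j" for i j k
  proof -
    have "(of_int (e k) * M $ k $ i) * (of_int (e k) * M $ k $ j) = of_int (e k * e k) * (M $ k $ i * M $ k $ j)"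
      by (simp add: mult_ac)
    then show ?thesis by (simp add: signs_square[OF e])
  qed
  then show ?thesis by (simp add: matrix_matrix_mult_def transpose_def row_scale_def)
qed

lemma row_scale_orth':
  fixes M :: "'a::comm_ring_1^'n^'n"
  assumes e: "e \<in> signs" and M: "M ** transpose M = mat 1"
  shows "row_scale e M ** transpose (row_scale e M) = mat 1"
proof -
  have "(row_scale e M ** transpose (row_scale e M)) $ i $ j = of_int (e i * e j) * (M ** transpose M) $ i $ j" for i j
    by (simp add: matrix_matrix_mult_def transpose_def row_scale_def sum_distrib_left mult.assoc mult.left_commute)
  moreover have "of_int (e i) * of_int (e i) = (1 :: 'a)" for i
    by (metis of_int_mult of_int_1 signs_square[OF e])
  ultimately show ?thesis unfolding M by (simp add: vec_eq_iff mat_def)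
qed

lemma cayley_chart_so:
  fixes e :: "'n::{finite,linorder} \<Rightarrow> int"
  assumes e: "e \<in> signs"
  shows "cayley_chart (row_scale e so_mat) (\<lambda>x. so_class (mconst x)) rot_class"
proof
  fix x y and i j k l :: 'n
  show "so_class (mconst (x + y)) = so_class (mconst x) + so_class (mconst y)"
    by (simp add: mconst_add so_class_add)
  show "so_class (mconst (x * y)) = so_class (mconst x) * so_class (mconst y)"
    by (simp add: mconst_mult so_class_mult)
  show "so_class (mconst 1) = 1" by simp
  show "transpose (row_scale e so_mat) ** row_scale e so_mat = mat 1"
    by (simp add: row_scale_orth[OF e] so_mat_orth)
  show "row_scale e so_mat ** transpose (row_scale e so_mat) = mat 1"
    by (rule row_scale_orth'[OF e so_mat_orth(2)])
  show "derivation (rot_class i j :: 'n so_ring \<Rightarrow> 'n so_ring)" by (rule derivation_rot_class)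
  show "rot_class i j (so_class (mconst x)) = 0" by (simp add: rot_class_class)
  show "rot_class i j (row_scale e so_mat $ k $ l) = (if l = j then row_scale e so_mat $ k $ i else 0)
      - (if l = i then row_scale e so_mat $ k $ j else 0)"
    by (auto simp: row_scale_def so_mat_def derivation_mult[OF derivation_rot_class] rot_class_class
        derivation_of_int[OF derivation_rot_class] rot_var so_class_diff right_diff_distrib)
qed

definition cayley_det :: "('n::finite \<Rightarrow> int) \<Rightarrow> 'n so_ring"
  where "cayley_det e = det (mat 1 + row_scale e so_mat)"

lemma chart_Delta:
  fixes e :: "'n::{finite,linorder} \<Rightarrow> int"
  assumes e: "e \<in> signs"
  shows "cayley_chart.\<Delta> (row_scale e so_mat) = cayley_det e"
proof -
  interpret cayley_chart "row_scale e so_mat" "\<lambda>x. so_class (mconst x)" rot_class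
    by (rule cayley_chart_so[OF e])
  show ?thesis by (simp add: \<Delta>_def Z_def cayley_det_def)
qed

text \<open>Averaging over the signs with product \<open>1\<close> kills all principal minors except the empty
  one and the full one.\<close>

lemma sum_cayley_det:
  fixes M :: "'a::comm_ring_1^'n^'n"
  shows "(\<Sum>e\<in>signs. (1 + of_int (\<Prod>i\<in>UNIV. e i)) * det (mat 1 + row_scale e M)) = 2 ^ CARD('n) * (1 + det M)"
proof -
  define d r where "d p i = (mat 1 :: 'a^'n^'n) $ i $ p i" and "r p i = M $ i $ p i" for p :: "'n \<Rightarrow> 'n" and i
  have "(1 + of_int (\<Prod>i\<in>UNIV. e i)) * det (mat 1 + row_scale e M)
      = (\<Sum>p | p permutes UNIV. of_int (sign p) * ((\<Prod>i\<in>UNIV. d p i + of_int (e i) * r p i)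
          + (\<Prod>i\<in>UNIV. of_int (e i) * d p i + r p i)))" if e: "e \<in> signs" for e
  proof -
    have "of_int (e i) * (d p i + of_int (e i) * r p i) = of_int (e i) * d p i + r p i" for p i
    proof -
      have "of_int (e i) * (d p i + of_int (e i) * r p i) = of_int (e i) * d p i + of_int (e i * e i) * r p i"
        by (simp add: distrib_left mult.assoc)
      then show ?thesis by (simp add: signs_square[OF e])
    qed
    \<comment> \<open>Multiplying row \<open>i\<close> by \<open>e i\<close> turns the chart matrix
      \<open>1 + e M\<close> into \<open>e + M\<close>.\<close>
    then have "of_int (\<Prod>i\<in>UNIV. e i) * (\<Prod>i\<in>UNIV. d p i + of_int (e i) * r p i)
        = (\<Prod>i\<in>UNIV. of_int (e i) * d p i + r p i)" for p
      by (simp add: prod.distrib[symmetric])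
    then have "(1 + of_int (\<Prod>i\<in>UNIV. e i)) * (of_int (sign p) * (\<Prod>i\<in>UNIV. d p i + of_int (e i) * r p i))
        = of_int (sign p) * ((\<Prod>i\<in>UNIV. d p i + of_int (e i) * r p i) + (\<Prod>i\<in>UNIV. of_int (e i) * d p i + r p i))" for p
      by (simp only: distrib_right distrib_left mult_1_left mult.left_commute)
    then show ?thesis
      by (simp add: det_def sum_distrib_left row_scale_def d_def r_def)
  qed
  then have "(\<Sum>e\<in>signs. (1 + of_int (\<Prod>i\<in>UNIV. e i)) * det (mat 1 + row_scale e M))
      = (\<Sum>p | p permutes UNIV. of_int (sign p) * ((\<Sum>e\<in>signs. \<Prod>i\<in>UNIV. d p i + of_int (e i) * r p i)
          + (\<Sum>e\<in>signs. \<Prod>i\<in>UNIV. of_int (e i) * d p i + r p i)))"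
    by (simp add: sum.swap[of _ signs] sum_distrib_left distrib_left sum.distrib)
  also have "\<dots> = (\<Sum>p | p permutes UNIV. of_int (sign p) * ((\<Prod>i\<in>UNIV. 2 * d p i) + (\<Prod>i\<in>UNIV. 2 * r p i)))"
  proof (rule sum.cong[OF refl])
    fix p
    \<comment> \<open>The sum over all sign vectors factors over the rows, and in each row the two
      signed terms cancel.\<close>
    have "(\<Prod>i\<in>UNIV. \<Sum>x\<in>{1, -1}. d p i + of_int x * r p i) = (\<Sum>e\<in>signs. \<Prod>i\<in>UNIV. d p i + of_int (e i) * r p i)"
      unfolding signs_def by (rule prod_sum_PiE) auto
    moreover have "(\<Prod>i\<in>UNIV. \<Sum>x\<in>{1, -1}. of_int x * d p i + r p i) = (\<Sum>e\<in>signs. \<Prod>i\<in>UNIV. of_int (e i) * d p i + r p i)"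
      unfolding signs_def by (rule prod_sum_PiE) auto
    ultimately show "of_int (sign p) * ((\<Sum>e\<in>signs. \<Prod>i\<in>UNIV. d p i + of_int (e i) * r p i)
          + (\<Sum>e\<in>signs. \<Prod>i\<in>UNIV. of_int (e i) * d p i + r p i))
        = of_int (sign p) * ((\<Prod>i\<in>UNIV. 2 * d p i) + (\<Prod>i\<in>UNIV. 2 * r p i))"
      by simp
  qed
  also have "\<dots> = 2 ^ CARD('n) * (det (mat 1 :: 'a^'n^'n) + det M)"
    by (simp add: prod.distrib det_def d_def r_def sum.distrib sum_distrib_left distrib_left mult.left_commute)
  finally show ?thesis by simp
qed

text \<open>The dichotomy yields only powers of the chart determinants, so membership in the radical
  has to be carried through the covering argument.\<close>

lemma radical_add:
  fixes a b :: "'a::comm_ring_1"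
  assumes L: "left_ideal L" and "a ^ M \<in> L" "b ^ N \<in> L"
  shows "(a + b) ^ (M + N) \<in> L"
  unfolding binomial_ring
proof (rule left_ideal_sum[OF L])
  fix k assume "k \<in> {..M + N}"
  show "of_nat (M + N choose k) * a ^ k * b ^ (M + N - k) \<in> L"
  proof (cases "M \<le> k")
    case True
    then have "a ^ k = a ^ (k - M) * a ^ M" by (simp add: power_add[symmetric])
    then have "of_nat (M + N choose k) * a ^ k * b ^ (M + N - k) = (of_nat (M + N choose k) * a ^ (k - M) * b ^ (M + N - k)) * a ^ M"
      by (simp add: mult_ac)
    then show ?thesis using assms by (simp add: left_ideal_mult)
  next
    case False
    then have "b ^ (M + N - k) = b ^ (M - k) * b ^ N" by (simp add: power_add[symmetric])
    then have "of_nat (M + N choose k) * a ^ k * b ^ (M + N - k) = (of_nat (M + N choose k) * a ^ k * b ^ (M - k)) * b ^ N"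
      by (simp add: mult_ac)
    then show ?thesis using assms by (simp add: left_ideal_mult)
  qed
qed

lemma radical_sum:
  fixes g :: "'b \<Rightarrow> 'a::comm_ring_1"
  assumes L: "left_ideal L" and "finite A" and "\<And>x. x \<in> A \<Longrightarrow> \<exists>M. g x ^ M \<in> L"
  shows "\<exists>M. (\<Sum>x\<in>A. r x * g x) ^ M \<in> L"
  using assms(2,3)
proof induction
  case empty
  show ?case by (rule exI[of _ 1]) (simp add: left_ideal_0[OF L])
next
  case (insert x A)
  obtain M where "g x ^ M \<in> L" using insert.prems[of x] by auto
  then have M: "(r x * g x) ^ M \<in> L" by (simp add: power_mult_distrib left_ideal_mult[OF L])
  obtain N where N: "(\<Sum>x\<in>A. r x * g x) ^ N \<in> L" using insert.IH insert.prems by auto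
  show ?case using insert(1,2) radical_add[OF L M N] by auto
qed

lemma so_two_unit: "so_class (mconst (1 / 2)) * 2 = 1"
proof -
  have "so_class (mconst (1 / 2)) * (so_class (mconst 1) + so_class (mconst 1)) = 1"
    unfolding so_class_add[symmetric] so_class_mult[symmetric] mconst_add[symmetric] mconst_mult[symmetric]
    by simp
  then show ?thesis by simp
qed

text \<open>Since \<open>det so_mat = 1\<close>, twice the determinants of the charts with sign
  product 1 add up to a power of 2, a unit. If each of them has a power in \<open>L\<close>, then
  \<open>1\<close> is in the radical of \<open>L\<close>, hence in \<open>L\<close>.\<close>

lemma cayley_det_generate:
  fixes L :: "'n::finite so_ring set"
  assumes L: "left_ideal L" and "\<And>e. e \<in> signs \<Longrightarrow> (\<Prod>i\<in>UNIV. e i) = 1 \<Longrightarrow> \<exists>M. cayley_det e ^ M \<in> L"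
  shows "1 \<in> L"
proof -
  let ?A = "{e :: 'n \<Rightarrow> int. e \<in> signs \<and> (\<Prod>i\<in>UNIV. e i) = 1}"
  have fin: "finite (signs :: ('n \<Rightarrow> int) set)" unfolding signs_def by (intro finite_PiE) auto
  have pm: "(\<Prod>i\<in>UNIV. e i) = 1 \<or> (\<Prod>i\<in>UNIV. e i) = -1" if "e \<in> signs" for e :: "'n \<Rightarrow> int"
  proof -
    have "(\<Prod>i\<in>UNIV. e i) * (\<Prod>i\<in>UNIV. e i) = 1"
      by (simp add: prod.distrib[symmetric] signs_square[OF that])
    then show ?thesis by (simp only: zmult_eq_1_iff) blast
  qed
  have "(\<Sum>e\<in>?A. 2 * cayley_det e) = (\<Sum>e\<in>signs. (1 + of_int (\<Prod>i\<in>UNIV. e i)) * cayley_det e)"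
  proof (rule sum.mono_neutral_cong_left[OF fin])
    show "?A \<subseteq> signs" by auto
    show "\<forall>e\<in>signs - ?A. (1 + of_int (\<Prod>i\<in>UNIV. e i)) * cayley_det e = 0"
    proof
      fix e :: "'n \<Rightarrow> int" assume "e \<in> signs - ?A"
      then have "(\<Prod>i\<in>UNIV. e i) = -1" using pm[of e] by blast
      then show "(1 + of_int (\<Prod>i\<in>UNIV. e i)) * cayley_det e = 0" by (simp only:) simp
    qed
    fix e :: "'n \<Rightarrow> int" assume "e \<in> ?A"
    then have "(\<Prod>i\<in>UNIV. e i) = 1" by blast
    then show "2 * cayley_det e = (1 + of_int (\<Prod>i\<in>UNIV. e i)) * cayley_det e" by (simp only:) simp
  qed
  also have "\<dots> = 2 ^ (CARD('n) + 1)"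
    unfolding cayley_det_def sum_cayley_det by (simp add: so_mat_det)
  finally have s: "(\<Sum>e\<in>?A. 2 * cayley_det e) = 2 ^ (CARD('n) + 1)" .
  have "finite ?A" using fin by auto
  from radical_sum[OF L this, of cayley_det "\<lambda>_. 2"] assms(2)
  obtain M where "(\<Sum>e\<in>?A. 2 * cayley_det e) ^ M \<in> L" by auto
  then have "(so_class (mconst (1 / 2)) ^ (CARD('n) + 1)) ^ M * (2 ^ (CARD('n) + 1)) ^ M \<in> L"
    unfolding s by (rule left_ideal_mult[OF L])
  then show ?thesis by (simp only: power_mult_distrib[symmetric] so_two_unit power_one)
qed

text \<open>The elements of \<open>T\<close> are paired off and each pair carries a quarter turn:
  \<open>K\<close> is a complex structure on the coordinates in \<open>T\<close> and zero
  elsewhere.\<close>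

lemma skew_square_exists:
  fixes T :: "'n::finite set"
  assumes "even (card T)"
  shows "\<exists>K :: complex^'n^'n. (\<forall>i j. K $ j $ i = - K $ i $ j) \<and> (\<forall>i j. i \<notin> T \<longrightarrow> K $ i $ j = 0)
    \<and> (\<forall>i j. (K ** K) $ i $ j = (if i = j \<and> i \<in> T then -1 else 0))"
  using assms
proof (induction "card T" arbitrary: T rule: less_induct)
  case less
  show ?case
  proof (cases "T = {}")
    case True
    then show ?thesis by (intro exI[of _ 0]) (simp add: matrix_matrix_mult_def)
  next
    case False
    then obtain a where a: "a \<in> T" by auto
    then have "odd (card (T - {a}))" using less.prems by (simp add: card_Diff_singleton card_gt_0_iff False)
    then have "T - {a} \<noteq> {}" by (metis card.empty even_zero)
    then obtain b where b: "b \<in> T" "b \<noteq> a" by auto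
    define T' where "T' = T - {a, b}"
    have cT: "card T = card T' + 2"
    proof -
      have "insert a (insert b T') = T" using a b by (auto simp: T'_def)
      then have "card T = card (insert a (insert b T'))" by (simp only:)
      also have "\<dots> = card T' + 2" using b by (simp add: T'_def)
      finally show ?thesis .
    qed
    then have "card T' < card T" "even (card T')" using less.prems by auto
    from less.hyps[OF this] obtain K where K: "\<And>i j. (K :: complex^'n^'n) $ j $ i = - K $ i $ j"
      "\<And>i j. i \<notin> T' \<Longrightarrow> K $ i $ j = 0" "\<And>i j. (K ** K) $ i $ j = (if i = j \<and> i \<in> T' then -1 else 0)"
      by blast
    have K0: "K $ i $ j = 0" if "j \<notin> T'" for i j using K(1)[of i j] K(2)[OF that, of i] by simp
    \<comment> \<open>The quarter turn in the plane of \<open>a\<close> and \<open>b\<close>. Its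
      rows and columns avoid \<open>T'\<close>, so both mixed products with \<open>K\<close>
      vanish.\<close>
    define e :: "'n \<Rightarrow> 'n \<Rightarrow> complex"
      where "e i j = (if i = a then if j = b then 1 else 0 else if i = b then if j = a then -1 else 0 else 0)" for i j
    have e0: "e i j = 0" if "i \<noteq> a" "i \<noteq> b" for i j using that by (simp add: e_def)
    have eskew: "e j i = - e i j" for i j using b by (simp add: e_def)
    have eleft: "(\<Sum>k\<in>UNIV. e i k * X k) = (if i = a then X b else if i = b then - X a else 0)" for i and X :: "'n \<Rightarrow> complex"
    proof -
      have "(\<Sum>k\<in>UNIV. e i k * X k)
          = (\<Sum>k\<in>UNIV. if k = (if i = a then b else a) then (if i = a then X k else if i = b then - X k else 0) else 0)"
        by (rule sum.cong) (auto simp: e_def)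
      then show ?thesis by simp
    qed
    have eright: "(\<Sum>k\<in>UNIV. X k * e k j) = (if j = a then - X b else if j = b then X a else 0)" for j and X :: "'n \<Rightarrow> complex"
    proof -
      have "(\<Sum>k\<in>UNIV. X k * e k j) = - (\<Sum>k\<in>UNIV. e j k * X k)"
        unfolding sum_negf[symmetric] by (rule sum.cong) (simp_all add: eskew[of _ j] mult.commute)
      then show ?thesis unfolding eleft by auto
    qed
    define M where "M = (\<chi> i j. K $ i $ j + e i j)"
    have "(M ** M) $ i $ j = (if i = j \<and> i \<in> T then -1 else 0)" for i j
    proof -
      have "(M ** M) $ i $ j = (K ** K) $ i $ j + (\<Sum>k\<in>UNIV. K $ i $ k * e k j)
          + (\<Sum>k\<in>UNIV. e i k * K $ k $ j) + (\<Sum>k\<in>UNIV. e i k * e k j)"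
        by (simp add: M_def matrix_matrix_mult_def sum.distrib[symmetric] algebra_simps)
      also have "(\<Sum>k\<in>UNIV. K $ i $ k * e k j) = 0" unfolding eright by (auto simp: K0 T'_def)
      also have "(\<Sum>k\<in>UNIV. e i k * K $ k $ j) = 0" unfolding eleft by (auto simp: K(2) T'_def)
      also have "(\<Sum>k\<in>UNIV. e i k * e k j) = (if i = j \<and> (i = a \<or> i = b) then -1 else 0)"
        unfolding eleft using b by (auto simp: e_def)
      finally show ?thesis using a b by (auto simp: K(3) T'_def)
    qed
    moreover have "M $ j $ i = - M $ i $ j" for i j
      using K(1)[of i j] eskew[of i j] by (simp add: M_def)
    moreover have "M $ i $ j = 0" if "i \<notin> T" for i j
      using that a b by (auto simp: M_def K(2) T'_def e_def)
    ultimately show ?thesis by blast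
  qed
qed

lemma matrix_add_rdistrib: "(A + B) ** C = A ** C + B ** (C :: 'a::comm_ring_1^'n^'n)"
  by (simp add: vec_eq_iff matrix_matrix_mult_def distrib_right sum.distrib)

lemma matrix_diff_rdistrib: "(A - B) ** C = A ** C - B ** (C :: 'a::comm_ring_1^'n^'n)"
  by (simp add: vec_eq_iff matrix_matrix_mult_def left_diff_distrib sum_subtractf)

lemma det_nonzeroI:
  fixes A B :: "complex^'n^'n"
  assumes "A ** B = mat 1 + mat 1"
  shows "det A \<noteq> 0"
proof
  assume "det A = 0"
  then have "det (mat 1 + mat 1 :: complex^'n^'n) = 0" using arg_cong[OF assms, of det] by (simp add: det_mul)
  moreover have "(mat 1 + mat 1 :: complex^'n^'n) = mat 2" by (simp add: vec_eq_iff mat_def)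
  ultimately show False by (simp add: det_mat)
qed

definition sign_mat :: "('n::finite \<Rightarrow> int) \<Rightarrow> complex^'n^'n"
  where "sign_mat e = (\<chi> i j. if i = j then of_int (e i) else 0)"

lemma sign_mat_mult: "sign_mat e ** M = row_scale e M"
  by (simp add: vec_eq_iff matrix_matrix_mult_def sign_mat_def row_scale_def if_distrib[of "\<lambda>x. x * _"] cong: if_cong)

text \<open>Rotation by a right angle in pairs of coordinate directions lies in both charts.\<close>

lemma rotation_in_charts:
  assumes e: "e \<in> signs" "(\<Prod>i\<in>UNIV. e i) = 1"
  shows "\<exists>h :: complex^'n^'n. transpose h ** h = mat 1 \<and> det h = 1 \<and>
    det (mat 1 + h) \<noteq> 0 \<and> det (mat 1 + row_scale e h) \<noteq> 0"
proof -
  define T where "T = {i. e i = -1}"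
  have "(\<Prod>i\<in>UNIV. e i) = (\<Prod>i\<in>UNIV. if i \<in> T then -1 else 1)"
    using PiE_mem[of e UNIV "\<lambda>_. {1, -1}"] e(1) by (intro prod.cong) (auto simp: T_def signs_def)
  also have "\<dots> = (-1) ^ card T" by (simp add: prod.If_cases)
  finally have "even (card T)" using e(2) by (metis (full_types) minus_one_power_iff one_neq_neg_one)
  from skew_square_exists[OF this] obtain K :: "complex^'n^'n" where
    K: "\<And>i j. K $ j $ i = - K $ i $ j" "\<And>i j. i \<notin> T \<Longrightarrow> K $ i $ j = 0"
    "\<And>i j. (K ** K) $ i $ j = (if i = j \<and> i \<in> T then -1 else 0)" by blast
  define G :: "complex^'n^'n" where "G = (\<chi> i j. if i = j \<and> i \<in> T then 1 else 0)"
  define F :: "complex^'n^'n" where "F = (\<chi> i j. if i = j \<and> i \<notin> T then 1 else 0)"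
  have K0: "K $ i $ j = 0" if "j \<notin> T" for i j using K(1)[of i j] K(2)[OF that, of i] by simp
  have diagL: "((\<chi> i j. if i = j \<and> P i then 1 else 0) ** M) $ i $ j = (if P i then M $ i $ j else 0)"
    for P and M :: "complex^'n^'n" and i j
  proof -
    have "((\<chi> i j. if i = j \<and> P i then 1 else 0) ** M) $ i $ j = (\<Sum>k\<in>UNIV. if k = i then if P i then M $ i $ j else 0 else 0)"
      unfolding matrix_matrix_mult_def vec_lambda_beta by (rule sum.cong) auto
    then show ?thesis by simp
  qed
  have diagR: "(M ** (\<chi> i j. if i = j \<and> P i then 1 else 0)) $ i $ j = (if P j then M $ i $ j else 0)"
    for P and M :: "complex^'n^'n" and i j
  proof -
    have "(M ** (\<chi> i j. if i = j \<and> P i then 1 else 0)) $ i $ j = (\<Sum>k\<in>UNIV. if k = j then if P j then M $ i $ j else 0 else 0)"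
      unfolding matrix_matrix_mult_def vec_lambda_beta by (rule sum.cong) auto
    then show ?thesis by simp
  qed
  have r: "G ** K = K" "K ** G = K" "F ** K = 0" "K ** F = 0" "F ** F = F" "G ** G = G" "F ** G = 0" "G ** F = 0"
    unfolding G_def F_def
    by (simp_all add: vec_eq_iff diagL diagR K(2) K0)
  have KK: "K ** K = - G" using K(3) by (simp add: vec_eq_iff G_def)
  have FG: "F + G = mat 1" by (simp add: vec_eq_iff F_def G_def mat_def)
  \<comment> \<open>\<open>F\<close> is the identity outside \<open>T\<close> and \<open>K\<close> a
    quarter turn inside, so \<open>h\<close> has no eigenvalue -1; neither has the matrix obtained
    by flipping the rows in \<open>T\<close>.\<close>
  define h where "h = F - K"
  have ht: "transpose h = F + K"
  proof -
    have "transpose h $ i $ j = (F + K) $ i $ j" for i j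
      using K(1)[of i j] by (auto simp: h_def transpose_def F_def)
    then show ?thesis by (simp add: vec_eq_iff)
  qed
  note ms = matrix_add_rdistrib matrix_diff_rdistrib matrix_add_ldistrib matrix_diff_ldistrib r KK
  have "(F + K) ** (F - K) = F + G" by (simp add: ms)
  then have orth: "transpose h ** h = mat 1" unfolding ht by (simp add: h_def FG)
  have IK: "transpose (mat 1 - K) = mat 1 + K"
  proof -
    have "transpose (mat 1 - K) $ i $ j = (mat 1 + K) $ i $ j" for i j
      using K(1)[of i j] by (simp add: transpose_def mat_def)
    then show ?thesis by (simp add: vec_eq_iff)
  qed
  have "(mat 1 + G) ** (mat 1 + F) = mat 1 + (F + G)" by (simp add: ms)
  then have "(mat 1 + G) ** (mat 1 + F) = mat 1 + mat 1" by (simp only: FG)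
  then have "det (mat 1 + G) \<noteq> 0" by (rule det_nonzeroI)
  moreover have "(mat 1 + K) ** (mat 1 - K) = mat 1 + G" by (simp add: ms)
  ultimately have dK: "det (mat 1 + K) \<noteq> 0" by (metis det_mul mult_zero_left)
  \<comment> \<open>\<open>1 - K\<close> is the transpose of \<open>1 + K\<close>, so comparing
    determinants gives \<open>det h = 1\<close>.\<close>
  have "(mat 1 + K) ** h = (F + G) - K" by (simp add: h_def ms)
  then have "(mat 1 + K) ** h = mat 1 - K" by (simp only: FG)
  then have "det (mat 1 + K) * det h = det (mat 1 - K)" by (metis det_mul)
  also have "det (mat 1 - K) = det (mat 1 + K)" by (metis IK det_transpose)
  finally have dh: "det h = 1" using dK by simp
  have "(mat 1 + h) ** (mat 1 + K) = mat 1 + (F + G)" by (simp add: h_def ms)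
  then have "(mat 1 + h) ** (mat 1 + K) = mat 1 + mat 1" by (simp only: FG)
  then have d1: "det (mat 1 + h) \<noteq> 0" by (rule det_nonzeroI)
  have "sign_mat e = F - G"
    using PiE_mem[of e UNIV "\<lambda>_. {1, -1}"] e(1) by (auto simp: vec_eq_iff sign_mat_def F_def G_def T_def signs_def)
  then have "row_scale e h = F + K" by (simp add: sign_mat_mult[symmetric] h_def ms)
  then have "(mat 1 + row_scale e h) ** (mat 1 - K) = mat 1 + (F + G)" by (simp add: ms)
  then have "(mat 1 + row_scale e h) ** (mat 1 - K) = mat 1 + mat 1" by (simp only: FG)
  then have "det (mat 1 + row_scale e h) \<noteq> 0" by (rule det_nonzeroI)
  with orth dh d1 show ?thesis by blast
qed

lemma cayley_det_class: "cayley_det e = so_class (det (mat 1 + row_scale e ymat))"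
proof -
  have "(\<chi> i j. so_class ((mat 1 + row_scale e ymat) $ i $ j)) = mat 1 + row_scale e so_mat"
    by (simp add: vec_eq_iff so_class_add so_class_mult so_class_of_int row_scale_def ymat_def so_mat_def mat_def)
  then show ?thesis by (simp only: cayley_det_def so_class_det)
qed

lemma meval_cayley_det:
  "meval (\<lambda>(i, j). g $ i $ j) (det (mat 1 + row_scale e ymat)) = det (mat 1 + row_scale e g)"
proof -
  have "(\<chi> i j. meval (\<lambda>(i, j). g $ i $ j) ((mat 1 + row_scale e ymat) $ i $ j)) = mat 1 + row_scale e g"
    by (simp add: vec_eq_iff meval_add meval_mult meval_of_int row_scale_def ymat_def mat_def)
  then show ?thesis by (simp only: meval_det)
qed

text \<open>A point \<open>h\<close> in the chart of the identity and in that of the product signs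
  \<open>d\<close> is translated by \<open>e'\<close>; the translate \<open>g\<close> lies in the
  charts of \<open>e\<close> and \<open>e'\<close>, so neither determinant vanishes there.\<close>

lemma cayley_det_product_nonzero:
  fixes e e' :: "'n::finite \<Rightarrow> int"
  assumes e: "e \<in> signs" "(\<Prod>i\<in>UNIV. e i) = 1" and e': "e' \<in> signs" "(\<Prod>i\<in>UNIV. e' i) = 1"
  shows "cayley_det e ^ M * cayley_det e' ^ N \<noteq> 0"
proof
  assume z: "cayley_det e ^ M * cayley_det e' ^ N = 0"
  define d where "d i = e i * e' i" for i
  have "e i \<in> {1, -1}" "e' i \<in> {1, -1}" for i
    using PiE_mem[of e UNIV "\<lambda>_. {1, -1}" i] PiE_mem[of e' UNIV "\<lambda>_. {1, -1}" i] e(1) e'(1) by (auto simp: signs_def)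
  then have "d i \<in> {1, -1}" for i unfolding d_def by (metis (no_types, lifting) insertE insertI1 insertI2 mult_1 mult_minus1 singletonD minus_minus)
  then have "d \<in> signs" unfolding signs_def by (intro PiE_I) auto
  moreover have "(\<Prod>i\<in>UNIV. d i) = 1" using e(2) e'(2) by (simp add: d_def prod.distrib)
  ultimately have d: "d \<in> signs" "(\<Prod>i\<in>UNIV. d i) = 1" by auto
  obtain h :: "complex^'n^'n" where h: "transpose h ** h = mat 1" "det h = 1"
    "det (mat 1 + h) \<noteq> 0" "det (mat 1 + row_scale d h) \<noteq> 0"
    using rotation_in_charts[OF d] by blast
  define g where "g = row_scale e' h"
  have "row_scale e' g = h"
  proof -
    have "of_int (e' i) * (of_int (e' i) * x) = (x :: complex)" for i x
      by (metis mult.assoc of_int_mult signs_square[OF e'(1)] of_int_1 mult_1)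
    then show ?thesis by (simp add: g_def row_scale_def vec_eq_iff)
  qed
  moreover have "row_scale e g = row_scale d h"
    by (simp add: g_def row_scale_def vec_eq_iff d_def mult.assoc)
  moreover have "det g = 1"
  proof -
    have "det (sign_mat e') = (\<Prod>i\<in>UNIV. of_int (e' i))"
      by (subst det_diagonal) (auto simp: sign_mat_def)
    also have "\<dots> = 1" using e'(2) by (metis of_int_prod of_int_1)
    finally show ?thesis by (simp add: g_def sign_mat_mult[symmetric] det_mul h)
  qed
  moreover have "transpose g ** g = mat 1" by (simp add: g_def row_scale_orth[OF e'(1)] h)
  moreover have "det (mat 1 + row_scale e ymat) ^ M * det (mat 1 + row_scale e' ymat) ^ N \<in> so_ideal"
    using z by (simp add: cayley_det_class so_class_power[symmetric] so_class_mult[symmetric] so_class_eq_0)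
  ultimately show False
    using so_ideal_vanishes[of g] h by (fastforce simp: meval_mult meval_power meval_cayley_det)
qed

text \<open>If one chart determinant has a power in \<open>L\<close>, the torsion alternative fails
  in every other chart, because powers of two chart determinants have nonzero product; so all of
  them have powers in \<open>L\<close>, which gives \<open>1\<close>. Otherwise the annihilator of
  each \<open>f\<close> in \<open>L\<close> contains a power of every chart determinant, and
  \<open>f = 0\<close>.\<close>

lemma rot_stable_so_ring:
  fixes L :: "'n::{finite,linorder} so_ring set"
  assumes L: "left_ideal L" and LE: "\<And>i j f. f \<in> L \<Longrightarrow> rot_class i j f \<in> L"
  shows "1 \<in> L \<or> L = {0}"
proof -
  have dich: "(\<exists>M. cayley_det e ^ M \<in> L) \<or> (\<forall>f\<in>L. \<exists>M. cayley_det e ^ M * f = 0)" if e: "e \<in> signs" for e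
  proof -
    interpret cayley_chart "row_scale e so_mat" "\<lambda>x. so_class (mconst x)" rot_class
      by (rule cayley_chart_so[OF e])
    have es: "of_int (e i) * of_int (e i) = (1 :: 'n so_ring)" for i
      by (metis of_int_mult of_int_1 signs_square[OF e])
    have "so_class (mvar (i, j)) = so_class (mconst (of_int (e i))) * row_scale e so_mat $ i $ j" for i j
      by (simp add: mconst_of_int so_class_of_int row_scale_def so_mat_def mult.assoc[symmetric] es)
    from chart_dichotomy[OF L LE so_class_add so_class_mult refl this surj_so_class]
    show ?thesis unfolding chart_Delta[OF e] .
  qed
  show ?thesis
  proof (cases "\<exists>e\<in>signs. (\<Prod>i\<in>UNIV. e i) = 1 \<and> (\<exists>M. cayley_det e ^ M \<in> L)")
    case True
    then obtain e0 M where e0: "e0 \<in> signs" "(\<Prod>i\<in>UNIV. e0 i) = 1" "cayley_det e0 ^ M \<in> L" by blast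
    have "\<exists>M. cayley_det e ^ M \<in> L" if "e \<in> signs" "(\<Prod>i\<in>UNIV. e i) = 1" for e
      using dich[OF that(1)] e0(3) cayley_det_product_nonzero[OF that e0(1,2)] by blast
    then show ?thesis using cayley_det_generate[OF L] by blast
  next
    case False
    have "f = 0" if f: "f \<in> L" for f
    proof -
      have ann: "left_ideal {g. g * f = 0}"
        by (auto simp: left_ideal_def distrib_right mult.assoc)
      have "1 \<in> {g. g * f = 0}"
        by (rule cayley_det_generate[OF ann]) (use dich False f in blast)
      then show ?thesis by simp
    qed
    then show ?thesis using left_ideal_0[OF L] by auto
  qed
qed

lemma rot_stable_ideal:
  fixes L :: "('n::{finite,linorder} \<times> 'n) mpoly set"
  assumes L: "left_ideal L" and J: "so_ideal \<subseteq> L" and LE: "\<And>i j f. f \<in> L \<Longrightarrow> rot i j f \<in> L"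
  shows "1 \<in> L \<or> L = so_ideal"
proof -
  have in_L: "f \<in> L" if "so_class f = so_class g" "g \<in> L" for f g
  proof -
    have "f - g \<in> so_ideal" using that(1) by (simp add: so_class_eq_0[symmetric] so_class_diff)
    then have "(f - g) + g \<in> L" using J that(2) by (intro left_ideal_add[OF L]) auto
    then show ?thesis by simp
  qed
  have "left_ideal (so_class ` L)"
    unfolding left_ideal_def
  proof (intro conjI ballI allI)
    show "0 \<in> so_class ` L" using left_ideal_0[OF L] so_class_0 by (metis image_eqI)
    show "a + b \<in> so_class ` L" if "a \<in> so_class ` L" "b \<in> so_class ` L" for a b
      using that left_ideal_add[OF L] by (auto simp: so_class_add[symmetric])
    show "r * a \<in> so_class ` L" if "a \<in> so_class ` L" for r a
    proof -
      obtain r' where "r = so_class r'" using surj_so_class by (metis surjD)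
      then show ?thesis using that left_ideal_mult[OF L] by (auto simp: so_class_mult[symmetric])
    qed
  qed
  moreover have "rot_class i j f \<in> so_class ` L" if "f \<in> so_class ` L" for i j f
    using that LE by (auto simp: rot_class_class)
  ultimately have "1 \<in> so_class ` L \<or> so_class ` L = {0}" by (rule rot_stable_so_ring)
  then show ?thesis
  proof
    assume "1 \<in> so_class ` L"
    then show ?thesis using in_L[of 1] by force
  next
    assume "so_class ` L = {0}"
    then have "L \<subseteq> so_ideal" by (auto simp: so_class_eq_0[symmetric])
    with J show ?thesis by blast
  qed
qed

text \<open>The torsion ideal of the determinant cannot be the unit ideal, because the determinant
  is not nilpotent; the dichotomy leaves only zero.\<close>

lemma cayley_det_regular:
  fixes f :: "'n::{finite,linorder} so_ring"
  assumes e: "e \<in> signs" "(\<Prod>i\<in>UNIV. e i) = 1" and f: "cayley_det e ^ M * f = 0"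
  shows "f = 0"
proof -
  let ?D = "cayley_det e"
  define L where "L = {f. \<exists>M. ?D ^ M * f = 0}"
  have pow: "?D ^ k * f = 0" if "?D ^ M * f = 0" "M \<le> k" for M k f
  proof -
    have "?D ^ k = ?D ^ (k - M) * ?D ^ M" using that(2) by (simp add: power_add[symmetric])
    then show ?thesis by (simp add: mult.assoc that(1))
  qed
  have L: "left_ideal L"
    unfolding left_ideal_def
  proof (intro conjI ballI allI)
    show "0 \<in> L" by (simp add: L_def)
    show "a + b \<in> L" if ab: "a \<in> L" "b \<in> L" for a b
    proof -
      obtain M N where "?D ^ M * a = 0" "?D ^ N * b = 0" using ab by (auto simp: L_def)
      then have "?D ^ (M + N) * (a + b) = 0" by (simp add: distrib_left pow[of M a] pow[of N b])
      then show ?thesis by (auto simp: L_def)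
    qed
    show "r * a \<in> L" if a: "a \<in> L" for r a
    proof -
      obtain M where "?D ^ M * a = 0" using a by (auto simp: L_def)
      then have "?D ^ M * (r * a) = 0" by (simp add: mult.left_commute[of _ r])
      then show ?thesis unfolding L_def by blast
    qed
  qed
  have "rot_class i j a \<in> L" if a: "a \<in> L" for i j a
  proof -
    note D = derivation_rot_class[of i j]
    obtain M where M: "?D ^ M * a = 0" using a by (auto simp: L_def)
    \<comment> \<open>One more factor of the determinant compensates the one lost when its power is
      differentiated.\<close>
    have "0 = ?D * rot_class i j (?D ^ M * a)" by (simp add: M derivation_0[OF D])
    also have "\<dots> = ?D * rot_class i j (?D ^ M) * a + ?D ^ Suc M * rot_class i j a"
      by (simp add: derivation_mult[OF D] algebra_simps)
    also have "?D * rot_class i j (?D ^ M) = of_nat M * rot_class i j ?D * ?D ^ M"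
      by (cases M) (simp_all add: derivation_power[OF D] derivation_1[OF D] algebra_simps del: power_Suc, simp add: algebra_simps)
    also have "of_nat M * rot_class i j ?D * ?D ^ M * a = 0" by (simp only: mult.assoc M mult_zero_right)
    finally have "?D ^ Suc M * rot_class i j a = 0" by (simp only: add_0_left)
    then show ?thesis unfolding L_def by blast
  qed
  from rot_stable_so_ring[OF L this] consider "1 \<in> L" | "L = {0}" by blast
  then show ?thesis
  proof cases
    case 1
    then obtain M where "?D ^ M = 0" by (auto simp: L_def)
    then show ?thesis using cayley_det_product_nonzero[OF e e, of M 0] by simp
  next
    case 2
    then show ?thesis using f by (auto simp: L_def)
  qed
qed

section \<open>Growth of the coordinate ring\<close>

text \<open>Multiplication by a power of \<open>\<Delta>\<close> is injective and carries the
  monomials of degree at most \<open>e\<close> into the span of the chart monomials in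
  \<open>U\<close>. So at most \<open>card U\<close> of them are independent modulo
  \<open>so_ideal\<close>, and a maximal independent set of monomials spans.\<close>

lemma so_ideal_growth:
  fixes e :: nat
  defines "p \<equiv> card {q :: 'n::{finite,linorder} \<times> 'n. fst q < snd q}"
  shows "\<exists>B :: ('n \<times> 'n \<Rightarrow>\<^sub>0 nat) set. B \<subseteq> {m. tdeg m \<le> e} \<and> card B \<le> ((2 * CARD('n) + 1) * e + 1) ^ p \<and>
    (\<forall>f\<in>polys_le e. \<exists>a. f - (\<Sum>m\<in>B. mconst (a m) * Poly_Mapping.single m 1) \<in> so_ideal)"
proof -
  \<comment> \<open>One chart suffices for counting; all signs are 1.\<close>
  define e1 :: "'n \<Rightarrow> int" where "e1 = (\<lambda>_. 1)"
  have e1: "e1 \<in> signs" "(\<Prod>i\<in>UNIV. e1 i) = 1" by (auto simp: e1_def signs_def)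
  interpret cayley_chart "row_scale e1 so_mat" "\<lambda>x. so_class (mconst x)" rot_class
    by (rule cayley_chart_so[OF e1(1)])
  define K where "K = 2 * CARD('n) * e"
  define N where "N = (2 * CARD('n) + 1) * e"
  define U where "U = {m. upper m \<and> tdeg m \<le> N}"
  define Mons where "Mons = {m :: 'n \<times> 'n \<Rightarrow>\<^sub>0 nat. tdeg m \<le> e}"
  define lin where "lin B a = (\<Sum>m\<in>B. mconst (a m) * Poly_Mapping.single m 1)"
    for B :: "('n \<times> 'n \<Rightarrow>\<^sub>0 nat) set" and a :: "('n \<times> 'n \<Rightarrow>\<^sub>0 nat) \<Rightarrow> complex"
  note L = left_ideal_so_ideal
  have finU: "finite U" using finite_tdeg_le[of N] by (rule rev_finite_subset) (auto simp: U_def)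
  have finM: "finite Mons" unfolding Mons_def by (rule finite_tdeg_le)
  have cardU: "card U \<le> (N + 1) ^ p"
  proof -
    let ?S = "{q :: 'n \<times> 'n. fst q < snd q}"
    let ?r = "\<lambda>m :: 'n \<times> 'n \<Rightarrow>\<^sub>0 nat. restrict (Poly_Mapping.lookup m) ?S"
    have "inj_on ?r U"
    proof (rule inj_onI, rule poly_mapping_eqI)
      fix m m' q assume m: "m \<in> U" "m' \<in> U" and eq: "?r m = ?r m'"
      show "Poly_Mapping.lookup m q = Poly_Mapping.lookup m' q"
      proof (cases "q \<in> ?S")
        case True
        then show ?thesis using fun_cong[OF eq, of q] by simp
      next
        case False
        then have "q \<notin> Poly_Mapping.keys m" "q \<notin> Poly_Mapping.keys m'" using m by (auto simp: U_def upper_def)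
        then show ?thesis by (simp add: in_keys_iff)
      qed
    qed
    moreover have "?r ` U \<subseteq> PiE ?S (\<lambda>_. {..N})"
    proof (rule image_subsetI)
      fix m assume "m \<in> U"
      then have "Poly_Mapping.lookup m q \<le> N" for q
        using lookup_le_tdeg[of m q] by (simp add: U_def)
      then show "?r m \<in> PiE ?S (\<lambda>_. {..N})" by (intro restrict_PiE_iff[THEN iffD2]) simp
    qed
    moreover have "finite (PiE ?S (\<lambda>_. {..N}))" by (intro finite_PiE) auto
    ultimately have "card U \<le> card (PiE ?S (\<lambda>_. {..N}))" by (rule card_inj_on_le)
    then show ?thesis by (simp add: card_PiE p_def)
  qed
  have "so_class (mvar (i, j)) = so_class (mconst 1) * row_scale e1 so_mat $ i $ j" for i j
    by (simp add: row_scale_def e1_def so_mat_def)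
  from \<Delta>_pow_monom_in[where s = "\<lambda>_. 1", OF so_class_mult so_class_1 this]
  have "\<exists>\<psi>\<in>upolys N. \<Delta> ^ K * so_class (Poly_Mapping.single m 1) = \<Phi> N \<psi>" if "m \<in> Mons" for m
    using that unfolding S_def K_def N_def Mons_def by fast
  then obtain \<psi> where \<psi>: "\<And>m. m \<in> Mons \<Longrightarrow> \<psi> m \<in> upolys N"
    "\<And>m. m \<in> Mons \<Longrightarrow> \<Delta> ^ K * so_class (Poly_Mapping.single m 1) = \<Phi> N (\<psi> m)" by metis
  have \<Phi>U: "\<Phi> N (\<psi> m) = (\<Sum>u\<in>U. so_class (mconst (Poly_Mapping.lookup (\<psi> m) u)) * (\<Delta> ^ (N - tdeg u) * mon u))"
    if "m \<in> Mons" for m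
    unfolding \<Phi>_def using \<psi>(1)[OF that] finU
    by (intro sum.mono_neutral_left) (auto simp: upolys_def U_def in_keys_iff)
  define indep where "indep B \<longleftrightarrow> (\<forall>a. lin B a \<in> so_ideal \<longrightarrow> (\<forall>m\<in>B. a m = 0))" for B
  have indep_card: "card B \<le> card U" if B: "B \<subseteq> Mons" "indep B" for B
  proof (rule ccontr)
    assume "\<not> card B \<le> card U"
    then have "card U < card B" by simp
    from homogeneous_system_solution[OF finU finite_subset[OF B(1) finM] this, of "\<lambda>m u. Poly_Mapping.lookup (\<psi> m) u"]
    obtain a where a: "\<exists>m\<in>B. a m \<noteq> 0" "\<And>u. u \<in> U \<Longrightarrow> (\<Sum>m\<in>B. a m * Poly_Mapping.lookup (\<psi> m) u) = 0" by blast
    have "\<Delta> ^ K * so_class (lin B a) = (\<Sum>m\<in>B. so_class (mconst (a m)) * (\<Delta> ^ K * so_class (Poly_Mapping.single m 1)))"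
      by (simp add: lin_def so_class_sum so_class_mult sum_distrib_left mult.left_commute)
    also have "\<dots> = (\<Sum>m\<in>B. so_class (mconst (a m)) * \<Phi> N (\<psi> m))"
      using B(1) by (intro sum.cong) (auto simp: \<psi>(2))
    also have "\<dots> = (\<Sum>m\<in>B. \<Sum>u\<in>U. so_class (mconst (a m * Poly_Mapping.lookup (\<psi> m) u)) * (\<Delta> ^ (N - tdeg u) * mon u))"
      using B(1) by (intro sum.cong) (auto simp: \<Phi>U sum_distrib_left mconst_mult so_class_mult mult.assoc)
    also have "\<dots> = (\<Sum>u\<in>U. so_class (mconst (\<Sum>m\<in>B. a m * Poly_Mapping.lookup (\<psi> m) u)) * (\<Delta> ^ (N - tdeg u) * mon u))"
    proof -
      have s: "so_class (mconst (\<Sum>m\<in>B. h m)) = (\<Sum>m\<in>B. so_class (mconst (h m)))" for h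
        by (induction B rule: infinite_finite_induct) (auto simp: mconst_add so_class_add)
      show ?thesis by (subst sum.swap) (simp add: s sum_distrib_right)
    qed
    also have "\<dots> = 0" by (simp add: a(2))
    finally have "so_class (lin B a) = 0"
      using cayley_det_regular[OF e1] by (simp only: chart_Delta[OF e1(1)])
    then have "lin B a \<in> so_ideal" by (simp add: so_class_eq_0)
    with B(2) a(1) show False unfolding indep_def by blast
  qed
  define \<B> where "\<B> = {B \<in> Pow Mons. indep B}"
  have "indep {}" unfolding indep_def by blast
  then have "{} \<in> \<B>" unfolding \<B>_def by blast
  then have ne: "\<B> \<noteq> {}" by blast
  have "finite \<B>" unfolding \<B>_def using finM by simp
  from finite_has_maximal[OF this ne] obtain B where B': "B \<in> \<B>" "\<forall>B'\<in>\<B>. B \<subseteq> B' \<longrightarrow> B = B'" by blast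
  then have B: "B \<subseteq> Mons" "indep B" unfolding \<B>_def by blast+
  have max: "B = B'" if "B' \<subseteq> Mons" "indep B'" "B \<subseteq> B'" for B'
    using B'(2) that unfolding \<B>_def by blast
  have finB: "finite B" using B(1) finM by (rule finite_subset)
  define spanned where "spanned f \<longleftrightarrow> (\<exists>a. f - lin B a \<in> so_ideal)" for f
  have lin_add: "lin B (\<lambda>m. a m + b m) = lin B a + lin B b" for a b
    by (simp add: lin_def mconst_add distrib_right sum.distrib)
  have lin_const: "lin B (\<lambda>m. c * a m) = mconst c * lin B a" for c a
    by (simp add: lin_def mconst_mult sum_distrib_left mult.assoc)
  have sp_add: "spanned (f + g)" if fg: "spanned f" "spanned g" for f g
  proof -
    obtain a b where "f - lin B a \<in> so_ideal" "g - lin B b \<in> so_ideal" using fg by (auto simp: spanned_def)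
    from left_ideal_add[OF L this] have "(f + g) - lin B (\<lambda>m. a m + b m) \<in> so_ideal"
      by (simp only: lin_add add_diff_add)
    then show ?thesis unfolding spanned_def by (rule exI[of _ "\<lambda>m. a m + b m"])
  qed
  have sp_const: "spanned (mconst c * f)" if f: "spanned f" for c f
  proof -
    obtain a where "f - lin B a \<in> so_ideal" using f by (auto simp: spanned_def)
    from left_ideal_mult[OF L this, of "mconst c"] have "mconst c * f - lin B (\<lambda>m. c * a m) \<in> so_ideal"
      by (simp only: lin_const right_diff_distrib)
    then show ?thesis unfolding spanned_def by (rule exI[of _ "\<lambda>m. c * a m"])
  qed
  have sp_0: "spanned 0"
    unfolding spanned_def by (intro exI[of _ "\<lambda>_. 0"]) (simp add: lin_def left_ideal_0[OF L])
  have sp_mono: "spanned (Poly_Mapping.single m 1)" if m: "m \<in> Mons" for m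
  proof (cases "m \<in> B")
    case True
    have "lin B (\<lambda>k. if k = m then 1 else 0) = (\<Sum>k\<in>B. if k = m then Poly_Mapping.single k 1 else 0)"
      unfolding lin_def by (rule sum.cong) auto
    then have "lin B (\<lambda>k. if k = m then 1 else 0) = Poly_Mapping.single m 1" using True finB by simp
    then show ?thesis unfolding spanned_def
      by (intro exI[of _ "\<lambda>k. if k = m then 1 else 0"]) (simp add: left_ideal_0[OF L])
  next
    case False
    \<comment> \<open>By maximality the enlarged set has a relation, and independence of
      \<open>B\<close> makes the coefficient of \<open>m\<close> nonzero.\<close>
    have "\<not> indep (insert m B)" using max[of "insert m B"] B(1) m False by auto
    then obtain a where a: "lin (insert m B) a \<in> so_ideal" "\<exists>k\<in>insert m B. a k \<noteq> 0" by (auto simp: indep_def)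
    have ins: "lin (insert m B) a = mconst (a m) * Poly_Mapping.single m 1 + lin B a"
      using False finB by (simp add: lin_def)
    have am: "a m \<noteq> 0"
    proof
      assume "a m = 0"
      then have "lin B a \<in> so_ideal" using a(1) ins by simp
      then show False using B(2) a(2) \<open>a m = 0\<close> unfolding indep_def by blast
    qed
    have "mconst (1 / a m) * lin (insert m B) a = Poly_Mapping.single m 1 - lin B (\<lambda>k. - (1 / a m) * a k)"
    proof -
      have "mconst (1 / a m) * lin (insert m B) a
          = mconst (1 / a m * a m) * Poly_Mapping.single m 1 + mconst (1 / a m) * lin B a"
        unfolding ins distrib_left mconst_mult by (simp only: mult.assoc)
      then show ?thesis using am by (simp only: lin_const mconst_uminus) simp
    qed
    then show ?thesis
      using left_ideal_mult[OF L a(1), of "mconst (1 / a m)"] unfolding spanned_def by metis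
  qed
  have "\<exists>a. f - lin B a \<in> so_ideal" if f: "f \<in> polys_le e" for f
  proof -
    have sp_sum: "spanned (\<Sum>m\<in>A. mconst (Poly_Mapping.lookup f m) * Poly_Mapping.single m 1)" if "A \<subseteq> Mons" for A
      using that by (induction A rule: infinite_finite_induct) (auto intro!: sp_0 sp_add sp_const sp_mono)
    have "Poly_Mapping.keys f \<subseteq> Mons" using f by (auto simp: polys_le_def Mons_def)
    from sp_sum[OF this] have "spanned f" by (simp only: mpoly_eq_sum[symmetric])
    then show ?thesis by (simp add: spanned_def)
  qed
  moreover have "card B \<le> (N + 1) ^ p" using indep_card[OF B] cardU by simp
  ultimately show ?thesis using B(1) unfolding lin_def N_def Mons_def by blast
qed

section \<open>The filtration by words in the linear vector fields\<close>

text \<open>With \<open>x\<close> read as minus the derivative in \<open>y\<close>, this is the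
  vector field with coefficients \<open>y (k, a)\<close> in the directions \<open>(k, b)\<close>;
  the minus sign makes its commutator with functions the derivation
  \<open>euler a b\<close>.\<close>

definition wop :: "'n::finite \<Rightarrow> 'n \<Rightarrow> ('n \<times> 'n) weyl"
  where "wop a b = - (\<Sum>k\<in>UNIV. weyl_d (k, a) * weyl_x (k, b))"

definition euler :: "'n::finite \<Rightarrow> 'n \<Rightarrow> ('n \<times> 'n) mpoly \<Rightarrow> ('n \<times> 'n) mpoly"
  where "euler a b f = (\<Sum>k\<in>UNIV. mvar (k, a) * mpderiv (k, b) f)"

lemma weyl_x_dop: "weyl_x i * dop f = dop f * weyl_x i - dop (mpderiv i f)"
  by (simp add: dop_x)

lemma wop_dop: "wop a b * dop f = dop f * wop a b + dop (euler a b f)"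
proof -
  have "wop a b * dop f = - (\<Sum>k\<in>UNIV. weyl_d (k, a) * (dop f * weyl_x (k, b) - dop (mpderiv (k, b) f)))"
    by (simp add: wop_def sum_distrib_right mult.assoc weyl_x_dop)
  also have "\<dots> = - (\<Sum>k\<in>UNIV. dop f * (weyl_d (k, a) * weyl_x (k, b)) - dop (mvar (k, a) * mpderiv (k, b) f))"
    by (simp add: right_diff_distrib dop_mult dop_var mult.assoc[symmetric] dop_commute[of f "mvar _", unfolded dop_var])
  also have "\<dots> = dop f * wop a b + dop (euler a b f)"
    by (simp add: wop_def euler_def sum_subtractf sum_distrib_left dop_sum)
  finally show ?thesis .
qed

lemma wop_x: "wop a b * weyl_x (k, l) = weyl_x (k, l) * wop a b - (if l = a then weyl_x (k, b) else 0)"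
proof -
  have "wop a b * weyl_x (k, l) = - (\<Sum>m\<in>UNIV. (weyl_d (m, a) * weyl_x (k, l)) * weyl_x (m, b))"
    by (simp add: wop_def sum_distrib_right mult.assoc weyl_x_commute)
  also have "\<dots> = - (\<Sum>m\<in>UNIV. weyl_x (k, l) * (weyl_d (m, a) * weyl_x (m, b)) + (if m = k then if l = a then weyl_x (k, b) else 0 else 0))"
    by (intro arg_cong[where f = uminus] sum.cong refl) (auto simp: weyl_d_x distrib_right mult.assoc)
  also have "\<dots> = weyl_x (k, l) * wop a b - (if l = a then weyl_x (k, b) else 0)"
    by (simp add: wop_def sum.distrib sum_distrib_left)
  finally show ?thesis .
qed

lemma euler_var: "euler a b (mvar (k, l)) = (if l = b then mvar (k, a) else 0)"
proof -
  have "euler a b (mvar (k, l)) = (\<Sum>m\<in>UNIV. if m = k then if l = b then mvar (k, a) else 0 else 0)"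
    unfolding euler_def by (rule sum.cong) (auto simp: mpderiv_var)
  then show ?thesis by simp
qed

lemma derivation_euler: "derivation (euler a b)"
  unfolding derivation_def euler_def
  by (auto simp: mpderiv_add mpderiv_mult algebra_simps sum.distrib sum_distrib_left sum_distrib_right)

lemma euler_rot: "euler i j f - euler j i f = rot i j f"
  by (simp add: euler_def rot_def sum_subtractf)

lemma wop_d: "wop a b * weyl_d (k, l) = weyl_d (k, l) * wop a b + (if l = b then weyl_d (k, a) else 0)"
  using wop_dop[of a b "mvar (k, l)"] by (simp add: dop_var euler_var split: if_splits)

text \<open>These are the relations of matrix units: a commutator of two letters is a combination of
  letters, so reordering a word produces only shorter words.\<close>

lemma wop_wop: "wop a b * wop c d = wop c d * wop a b + (if b = c then wop a d else 0) - (if a = d then wop c b else 0)"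
proof -
  have "wop a b * wop c d = - (\<Sum>k\<in>UNIV. (wop a b * weyl_d (k, c)) * weyl_x (k, d))"
    by (simp add: wop_def[of c d] sum_distrib_left mult.assoc)
  also have "\<dots> = - (\<Sum>k\<in>UNIV. weyl_d (k, c) * (wop a b * weyl_x (k, d)) + (if b = c then weyl_d (k, a) * weyl_x (k, d) else 0))"
    by (intro arg_cong[where f = uminus] sum.cong refl) (auto simp: wop_d distrib_right mult.assoc)
  also have "\<dots> = - (\<Sum>k\<in>UNIV. weyl_d (k, c) * weyl_x (k, d) * wop a b
      - (if a = d then weyl_d (k, c) * weyl_x (k, b) else 0) + (if b = c then weyl_d (k, a) * weyl_x (k, d) else 0))"
    by (intro arg_cong[where f = uminus] sum.cong refl) (auto simp: wop_x right_diff_distrib mult.assoc)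
  also have "\<dots> = wop c d * wop a b + (if b = c then wop a d else 0) - (if a = d then wop c b else 0)"
    by (simp add: wop_def sum.distrib sum_subtractf sum_distrib_right sum_negf)
  finally show ?thesis .
qed

lemma wop_skew: "wop i j - wop j i = lie_gen i j"
proof -
  have "wop i j - wop j i = (\<Sum>k\<in>UNIV. weyl_d (k, j) * weyl_x (k, i) - weyl_d (k, i) * weyl_x (k, j))"
    by (simp add: wop_def sum_subtractf)
  also have "\<dots> = lie_gen i j"
    unfolding lie_gen_def by (rule sum.cong) (auto simp: weyl_d_x)
  finally show ?thesis .
qed

lemma lie_gen_dop: "lie_gen i j * dop f = dop f * lie_gen i j + dop (rot i j f)"
  by (simp add: wop_skew[symmetric] left_diff_distrib right_diff_distrib wop_dop euler_rot[symmetric] dop_diff)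

fun wword :: "('n::finite \<times> 'n) list \<Rightarrow> ('n \<times> 'n) weyl" where
  "wword [] = 1"
| "wword (p # w) = wop (fst p) (snd p) * wword w"

text \<open>The ideal is built in, so this is the preimage of a layer of the module. Words are
  strictly shorter than \<open>k\<close>: level 0 is the ideal itself, and at level 1 only functions
  are added. \<open>T\<close> bounds the functions to the right of the words.\<close>

inductive_set words :: "('n::finite \<times> 'n) mpoly set \<Rightarrow> nat \<Rightarrow> ('n \<times> 'n) weyl set"
  for T :: "('n \<times> 'n) mpoly set" and k :: nat where
  base: "u \<in> so_weyl_ideal \<Longrightarrow> u \<in> words T k"
| step: "u \<in> words T k \<Longrightarrow> length w < k \<Longrightarrow> f \<in> T \<Longrightarrow> wword w * dop f + u \<in> words T k"

lemma words_0_eq: "words T 0 = so_weyl_ideal"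
proof
  show "words T 0 \<subseteq> so_weyl_ideal"
  proof
    fix u assume "u \<in> words T 0"
    then show "u \<in> so_weyl_ideal" by induction auto
  qed
qed (auto intro: words.base)

lemma words_gen: "length w < k \<Longrightarrow> f \<in> T \<Longrightarrow> wword w * dop f \<in> words T k"
  using words.step[OF words.base[OF left_ideal_0[OF left_ideal_so_weyl_ideal]], of w k f T] by simp

lemma words_zero: "0 \<in> words T k"
  by (rule words.base[OF left_ideal_0[OF left_ideal_so_weyl_ideal]])

lemma words_add: "u \<in> words T k \<Longrightarrow> v \<in> words T k \<Longrightarrow> u + v \<in> words T k"
proof (induction rule: words.induct)
  case (base u)
  from base(2,1) show ?case
  proof (induction rule: words.induct)
    case (base v)
    then show ?case by (intro words.base left_ideal_add[OF left_ideal_so_weyl_ideal])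
  next
    case (step v w f)
    then have "wword w * dop f + (u + v) \<in> words T k" by (intro words.step)
    then show ?case by (simp add: add.left_commute)
  qed
next
  case (step u w f)
  then have "wword w * dop f + (u + v) \<in> words T k" by (intro words.step)
  then show ?case by (simp add: add.assoc)
qed

lemma words_sum: "(\<And>i. i \<in> A \<Longrightarrow> h i \<in> words T k) \<Longrightarrow> (\<Sum>i\<in>A. h i) \<in> words T k"
  by (induction A rule: infinite_finite_induct) (auto intro: words_zero words_add)

lemma words_mono: "u \<in> words T k \<Longrightarrow> k \<le> k' \<Longrightarrow> T \<subseteq> T' \<Longrightarrow> u \<in> words T' k'"
  by (induction rule: words.induct) (auto intro: words.base words.step)

definition const_closed :: "('n::finite \<times> 'n) mpoly set \<Rightarrow> bool"
  where "const_closed T \<longleftrightarrow> (\<forall>c. \<forall>f\<in>T. mconst c * f \<in> T)"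

definition rot_closed :: "('n::finite \<times> 'n) mpoly set \<Rightarrow> bool"
  where "rot_closed T \<longleftrightarrow> (\<forall>i j. \<forall>f\<in>T. rot i j f \<in> T)"

lemma words_const: "const_closed T \<Longrightarrow> u \<in> words T k \<Longrightarrow> weyl_const c * u \<in> words T k"
proof (rotate_tac, induction rule: words.induct)
  case (base u)
  then show ?case by (intro words.base left_ideal_mult[OF left_ideal_so_weyl_ideal])
next
  case (step u w f)
  have "weyl_const c * (wword w * dop f) = wword w * dop (mconst c * f)"
    by (simp only: dop_mult dop_const mult.assoc[symmetric] weyl_const_commute[of c "wword w"])
  moreover have "mconst c * f \<in> T" using step by (auto simp: const_closed_def)
  ultimately show ?case using step by (simp add: distrib_left words.step)
qed

lemma weyl_const_neg1: "weyl_const (-1) = -1"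
  using weyl_const_add[of 1 "-1"] by (simp add: eq_neg_iff_add_eq_0 add.commute)

lemma words_uminus: "const_closed T \<Longrightarrow> u \<in> words T k \<Longrightarrow> - u \<in> words T k"
  using words_const[of T u k "-1"] by (simp add: weyl_const_neg1)

lemma words_diff: "const_closed T \<Longrightarrow> u \<in> words T k \<Longrightarrow> v \<in> words T k \<Longrightarrow> u - v \<in> words T k"
  using words_add[of u T k "- v"] by (simp add: words_uminus)

lemma wop_words: "u \<in> words T k \<Longrightarrow> wop a b * u \<in> words T (Suc k)"
proof (induction rule: words.induct)
  case (base u)
  then show ?case by (intro words.base left_ideal_mult[OF left_ideal_so_weyl_ideal])
next
  case (step u w f)
  have "wop a b * (wword w * dop f + u) = wword ((a, b) # w) * dop f + wop a b * u"
    by (simp add: distrib_left mult.assoc)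
  then show ?case using step by (simp only:) (intro words.step, simp_all)
qed

lemma words_extend:
  assumes "\<And>w f. length w < k \<Longrightarrow> f \<in> T \<Longrightarrow> R * (wword w * dop f) \<in> words T' k'" "u \<in> words T k"
  shows "R * u \<in> words T' k'"
  using assms(2)
proof (induction rule: words.induct)
  case (base u)
  then show ?case by (intro words.base left_ideal_mult[OF left_ideal_so_weyl_ideal])
next
  case (step u w f)
  then show ?case by (simp add: distrib_left words_add assms(1))
qed

lemma lie_gen_wop: "lie_gen i j * wop a b = wop a b * lie_gen i j
    + ((if j = a then wop i b else 0) - (if i = b then wop a j else 0)
     - (if i = a then wop j b else 0) + (if j = b then wop a i else 0))"
  by (simp add: wop_skew[symmetric] left_diff_distrib right_diff_distrib wop_wop[of i j a b] wop_wop[of j i a b])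

text \<open>A rotation does not lengthen words: its commutator with a letter is a combination of
  letters, its action on \<open>f\<close> stays in \<open>T\<close>, and as a right factor it falls
  into the ideal.\<close>

lemma lie_gen_word:
  assumes T: "const_closed T" "rot_closed T" and f: "f \<in> T"
  shows "lie_gen i j * (wword w * dop f) \<in> words T (Suc (length w))"
proof (induction w)
  case Nil
  have "dop f * lie_gen i j \<in> words T 1"
    by (intro words.base left_ideal_mult[OF left_ideal_so_weyl_ideal] lie_gen_in)
  moreover have "wword [] * dop (rot i j f) \<in> words T 1"
    using T f by (intro words_gen) (auto simp: rot_closed_def)
  ultimately show ?case by (simp add: lie_gen_dop words_add)
next
  case (Cons p w)
  obtain a b where p: "p = (a, b)" by (cases p)
  define X where "X = wword w * dop f"
  have W: "wop c d * X \<in> words T (Suc (Suc (length w)))" for c d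
    using words_gen[OF _ f, of "(c, d) # w" "Suc (length (p # w))"] by (simp add: X_def mult.assoc)
  have "lie_gen i j * (wword (p # w) * dop f) = (lie_gen i j * wop a b) * X"
    by (simp add: p X_def mult.assoc)
  also have "\<dots> = wop a b * (lie_gen i j * X)
    + ((if j = a then wop i b * X else 0) - (if i = b then wop a j * X else 0)
     - (if i = a then wop j b * X else 0) + (if j = b then wop a i * X else 0))"
    by (simp add: lie_gen_wop distrib_right left_diff_distrib mult.assoc)
  also have "\<dots> \<in> words T (Suc (length (p # w)))"
    using wop_words[OF Cons.IH, of a b]
    by (intro words_add words_diff T(1)) (auto simp: X_def[symmetric] W words_zero)
  finally show ?case .
qed

text \<open>The equations are inhomogeneous, so the linear field yields a Kronecker term besides
  equations. It is this constant that removes a letter in \<open>gram_word\<close>.\<close>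

lemma euler_gram: "euler a b (gram_cols c d) =
   (if b = c then gram_cols a d - (if a = d then 1 else 0) else 0)
 + (if b = d then gram_cols c a - (if a = c then 1 else 0) else 0)"
proof -
  note D = derivation_euler[of a b]
  have "euler a b (gram_cols c d) = - (\<Sum>k\<in>UNIV. euler a b (mvar (k, c)) * mvar (k, d) + mvar (k, c) * euler a b (mvar (k, d)))"
    by (simp add: gram_cols_def derivation_diff[OF D] derivation_sum[OF D] derivation_mult[OF D] derivation_0[OF D] derivation_1[OF D])
  also have "\<dots> = - (if b = c then \<Sum>k\<in>UNIV. mvar (k, a) * mvar (k, d) else 0) - (if b = d then \<Sum>k\<in>UNIV. mvar (k, c) * mvar (k, a) else 0)"
    by (auto simp: euler_var sum.distrib)
  finally show ?thesis by (auto simp: gram_cols_def)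
qed

lemma dop_wop: "dop f * wop a b = wop a b * dop f - dop (euler a b f)"
  by (simp add: wop_dop)

text \<open>Moving the equation to the right past a letter leaves equations, possibly without that
  letter, or drops both; next to \<open>f\<close> an equation falls into the ideal. One level is
  gained, as the word itself has level \<open>Suc (length w)\<close>.\<close>

lemma gram_word:
  assumes T: "const_closed T" and f: "f \<in> T"
  shows "dop (gram_cols c d) * (wword w * dop f) \<in> words T (length w)"
proof (induction w arbitrary: c d)
  case Nil
  show ?case
    by (simp add: words_0_eq dop_commute[of "gram_cols c d"] left_ideal_mult[OF left_ideal_so_weyl_ideal] dop_in gram_cols_in)
next
  case (Cons p w)
  obtain a b where p: "p = (a, b)" by (cases p)
  define X where "X = wword w * dop f"
  have X: "X \<in> words T (Suc (length w))" unfolding X_def by (rule words_gen) (use f in auto)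
  have g: "dop (gram_cols c d) * X \<in> words T (Suc (length w))" for c d
    using words_mono[OF Cons.IH, of "Suc (length w)" T] by (simp add: X_def)
  have "dop (gram_cols c d) * (wword (p # w) * dop f) = (dop (gram_cols c d) * wop a b) * X"
    by (simp add: p X_def mult.assoc)
  also have "\<dots> = wop a b * (dop (gram_cols c d) * X)
     - ((if b = c then dop (gram_cols a d) * X - (if a = d then X else 0) else 0)
      + (if b = d then dop (gram_cols c a) * X - (if a = c then X else 0) else 0))"
    by (simp add: dop_wop left_diff_distrib euler_gram dop_add dop_diff distrib_right mult.assoc)
  also have "\<dots> \<in> words T (Suc (length w))"
    using wop_words[OF Cons.IH, of a b]
    by (intro words_add words_diff T) (auto simp: X_def[symmetric] X g words_zero intro!: words_diff T)
  finally show ?case by simp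
qed

lemma gram_words:
  assumes T: "const_closed T" and u: "u \<in> words T (Suc k)"
  shows "dop (gram_cols c d) * u \<in> words T k"
  by (rule words_extend[OF _ u]) (rule words_mono[OF gram_word[OF T]], auto)

definition wop_gram :: "('n::finite \<times> 'n) weyl"
  where "wop_gram = (\<Sum>c\<in>UNIV. \<Sum>d\<in>UNIV. wop c d * dop (gram_cols c d))"

text \<open>Modulo shorter words this operator multiplies a word by twice its length, like an Euler
  field in the directions normal to the orthogonal group.\<close>

lemma wop_gram_word:
  assumes T: "const_closed T" "rot_closed T" and f: "f \<in> T"
  shows "wop_gram * (wword w * dop f) - of_nat (2 * length w) * (wword w * dop f) \<in> words T (length w)"
proof (induction w)
  case Nil
  have "wop_gram * dop f = (\<Sum>c\<in>UNIV. \<Sum>d\<in>UNIV. (wop c d * dop f) * dop (gram_cols c d))"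
    by (simp add: wop_gram_def sum_distrib_right mult.assoc dop_commute[of f])
  also have "\<dots> \<in> so_weyl_ideal"
    by (intro left_ideal_sum[OF left_ideal_so_weyl_ideal] left_ideal_mult[OF left_ideal_so_weyl_ideal] dop_in gram_cols_in)
  finally show ?case by (simp add: words_0_eq)
next
  case (Cons p w)
  obtain a b where p: "p = (a, b)" by (cases p)
  define X where "X = wword w * dop f"
  define n where "n = length w"
  have gX: "dop (gram_cols c d) * X \<in> words T n" for c d
    unfolding X_def n_def by (rule gram_word[OF T(1) f])
  have WgX: "wop c' d' * (dop (gram_cols c d) * X) \<in> words T (Suc n)" for c d c' d'
    by (rule wop_words[OF gX])
  have LX: "lie_gen i j * X \<in> words T (Suc n)" for i j
    unfolding X_def n_def by (rule lie_gen_word[OF T f])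
  have e: "wop c d * dop (gram_cols c d) * (wop a b * X)
      = wop a b * (wop c d * (dop (gram_cols c d) * X))
      + ((if d = a then wop c b * (dop (gram_cols c d) * X) else 0) - (if c = b then wop a d * (dop (gram_cols c d) * X) else 0)
      - (if b = c then wop c d * (dop (gram_cols a d) * X) else 0)
      - (if b = d then wop c d * (dop (gram_cols c a) * X) else 0))
      + ((if b = c then if a = d then wop c d * X else 0 else 0) + (if b = d then if a = c then wop c d * X else 0 else 0))"
    for c d
  proof -
    have "wop c d * dop (gram_cols c d) * (wop a b * X) = wop c d * ((dop (gram_cols c d) * wop a b) * X)"
      by (simp add: mult.assoc)
    also have "\<dots> = (wop c d * wop a b) * (dop (gram_cols c d) * X) - wop c d * (dop (euler a b (gram_cols c d)) * X)"
      by (simp add: dop_wop left_diff_distrib right_diff_distrib mult.assoc)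
    also have "(wop c d * wop a b) * (dop (gram_cols c d) * X) = wop a b * (wop c d * (dop (gram_cols c d) * X))
      + (if d = a then wop c b * (dop (gram_cols c d) * X) else 0) - (if c = b then wop a d * (dop (gram_cols c d) * X) else 0)"
      by (simp add: wop_wop[of c d a b] distrib_right left_diff_distrib mult.assoc)
    also have "wop c d * (dop (euler a b (gram_cols c d)) * X)
      = (if b = c then wop c d * (dop (gram_cols a d) * X) else 0) + (if b = d then wop c d * (dop (gram_cols c a) * X) else 0)
      - ((if b = c then if a = d then wop c d * X else 0 else 0) + (if b = d then if a = c then wop c d * X else 0 else 0))"
      by (simp add: euler_gram dop_add dop_diff distrib_right distrib_left left_diff_distrib right_diff_distrib)
    finally show ?thesis by (simp add: algebra_simps)
  qed
  \<comment> \<open>\<open>R\<close> collects the terms that still contain an equation in front of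
    \<open>X\<close>; they lie in a level below that of the word \<open>p # w\<close>.\<close>
  define R where "R = (\<Sum>c\<in>UNIV. \<Sum>d\<in>UNIV. (if d = a then wop c b * (dop (gram_cols c d) * X) else 0)
      - (if c = b then wop a d * (dop (gram_cols c d) * X) else 0)
      - (if b = c then wop c d * (dop (gram_cols a d) * X) else 0)
      - (if b = d then wop c d * (dop (gram_cols c a) * X) else 0))"
  have R: "R \<in> words T (Suc n)"
    unfolding R_def by (intro words_sum words_diff T(1)) (auto simp: WgX words_zero)
  have 1: "wop_gram * (wop a b * X) = wop a b * (wop_gram * X) + R + (wop b a * X + wop a b * X)"
  proof -
    have "(\<Sum>c\<in>UNIV. \<Sum>d\<in>UNIV. (if b = c then if a = d then wop c d * X else 0 else 0) + (if b = d then if a = c then wop c d * X else 0 else 0))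
        = wop b a * X + wop a b * X"
    proof -
      have "(\<Sum>c\<in>UNIV. \<Sum>d\<in>UNIV. if b = c then if a = d then wop c d * X else 0 else 0)
          = (\<Sum>c\<in>UNIV. if b = c then wop c a * X else 0)"
        by (intro sum.cong) auto
      moreover have "(\<Sum>c\<in>UNIV. \<Sum>d\<in>UNIV. if b = d then if a = c then wop c d * X else 0 else 0)
          = (\<Sum>c\<in>UNIV. if a = c then wop c b * X else 0)"
        by (intro sum.cong) auto
      ultimately show ?thesis by (simp add: sum.distrib)
    qed
    moreover have "wop a b * (wop_gram * X) = (\<Sum>c\<in>UNIV. \<Sum>d\<in>UNIV. wop a b * (wop c d * (dop (gram_cols c d) * X)))"
      by (simp only: wop_gram_def sum_distrib_right sum_distrib_left mult.assoc)
    moreover have "wop_gram * (wop a b * X) = (\<Sum>c\<in>UNIV. \<Sum>d\<in>UNIV. wop c d * dop (gram_cols c d) * (wop a b * X))"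
      by (simp only: wop_gram_def sum_distrib_right)
    ultimately show ?thesis
      by (simp only: e sum.distrib R_def)
  qed
  \<comment> \<open>The two Kronecker terms are \<open>wop b a * X\<close> and
    \<open>wop a b * X\<close>; they differ by a rotation, which gives the 2 per letter.\<close>
  have 2: "wop b a * X = wop a b * X - lie_gen a b * X"
    by (simp add: wop_skew[symmetric] left_diff_distrib)
  have "wop_gram * (wword (p # w) * dop f) - of_nat (2 * length (p # w)) * (wword (p # w) * dop f)
      = wop a b * (wop_gram * X - of_nat (2 * n) * X) + R - lie_gen a b * X"
  proof -
    have "wop a b * (of_nat (2 * n) * X) = of_nat (2 * n) * (wop a b * X)"
      by (simp only: mult.assoc[symmetric] mult_of_nat_commute[of _ "wop a b"])
    moreover have "of_nat (2 * length (p # w)) * (wop a b * X) = of_nat (2 * n) * (wop a b * X) + (wop a b * X + wop a b * X)"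
      by (simp add: n_def distrib_right mult_2[symmetric] mult.assoc)
    moreover have "wword (p # w) * dop f = wop a b * X" by (simp add: p X_def mult.assoc)
    ultimately show ?thesis by (simp only: 1 2 right_diff_distrib) (simp add: algebra_simps)
  qed
  also have "\<dots> \<in> words T (Suc n)"
    using wop_words[OF Cons.IH, of a b] by (intro words_diff[OF T(1)] words_add R LX) (simp add: X_def n_def)
  finally show ?case by (simp add: n_def)
qed

lemma weyl_of_nat: "of_nat n = weyl_const (of_nat n)"
  by (induction n) (simp_all add: weyl_const_add)

lemma wop_gram_words:
  fixes u :: "('n::finite \<times> 'n) weyl"
  assumes T: "const_closed T" "rot_closed T" and u: "u \<in> words T (Suc n)"
  shows "wop_gram * u - of_nat (2 * n) * u \<in> words T n"
proof -
  have "(wop_gram - of_nat (2 * n)) * u \<in> words T n"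
  proof (rule words_extend[OF _ u])
    fix w :: "('n \<times> 'n) list" and f :: "('n \<times> 'n) mpoly" assume w: "length w < Suc n" and f: "f \<in> T"
    let ?X = "wword w * dop f"
    have 1: "wop_gram * ?X - of_nat (2 * length w) * ?X \<in> words T n"
      by (rule words_mono[OF wop_gram_word[OF T f]]) (use w in auto)
    show "(wop_gram - of_nat (2 * n)) * ?X \<in> words T n"
    proof (cases "length w = n")
      case True
      then show ?thesis using 1 by (simp add: left_diff_distrib)
    next
      \<comment> \<open>Shorter words belong to another scalar, but they already lie in the lower
        level.\<close>
      case False
      then have "?X \<in> words T n" using w f by (intro words_gen) auto
      then have "weyl_const (of_nat (2 * length w)) * ?X - weyl_const (of_nat (2 * n)) * ?X \<in> words T n"
        by (intro words_diff[OF T(1)] words_const[OF T(1)])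
      from words_add[OF 1 this] show ?thesis
        by (simp only: weyl_of_nat[symmetric] left_diff_distrib) simp
    qed
  qed
  then show ?thesis by (simp add: left_diff_distrib)
qed

section \<open>Action of the generators of the Weyl algebra on the filtration\<close>

lemma closed_polys_le: "const_closed (polys_le e)" "rot_closed (polys_le e)"
  using polys_le_mult[OF polys_le_const[of _ 0]] by (auto simp: const_closed_def rot_closed_def polys_le_rot)

lemma d_words:
  fixes u :: "('n::finite \<times> 'n) weyl"
  assumes u: "u \<in> words (polys_le e) k"
  shows "weyl_d (k', l) * u \<in> words (polys_le (Suc e)) k"
proof (rule words_extend[OF _ u])
  fix w :: "('n \<times> 'n) list" and f :: "('n \<times> 'n) mpoly" assume w: "length w < k" and f: "f \<in> polys_le e"
  have "weyl_d (k', l) * (wword w * dop f) \<in> words (polys_le (Suc e)) (Suc (length w))"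
  proof (induction w arbitrary: l)
    case Nil
    have "mvar (k', l) * f \<in> polys_le (Suc e)" using polys_le_mult[OF polys_le_var[OF order_refl] f] by simp
    from words_gen[OF _ this, of "[]" 1] show ?case by (simp add: dop_mult dop_var)
  next
    case (Cons p w)
    obtain a b where p: "p = (a, b)" by (cases p)
    have dw: "weyl_d (k', l) * wop a b = wop a b * weyl_d (k', l) - (if l = b then weyl_d (k', a) else 0)"
      by (simp add: wop_d)
    have "weyl_d (k', l) * (wword (p # w) * dop f) = (weyl_d (k', l) * wop a b) * (wword w * dop f)"
      by (simp add: p mult.assoc)
    also have "\<dots> = wop a b * (weyl_d (k', l) * (wword w * dop f)) - (if l = b then weyl_d (k', a) * (wword w * dop f) else 0)"
      by (simp add: dw left_diff_distrib mult.assoc)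
    also have "\<dots> \<in> words (polys_le (Suc e)) (Suc (Suc (length w)))"
      using words_mono[OF Cons.IH, of "Suc (Suc (length w))"]
      by (intro words_diff closed_polys_le wop_words Cons.IH) (auto simp: words_zero)
    finally show ?case by simp
  qed
  then show "weyl_d (k', l) * (wword w * dop f) \<in> words (polys_le (Suc e)) k"
    by (rule words_mono) (use w in auto)
qed

text \<open>On the group the rows of \<open>y\<close> are orthonormal, so \<open>x\<close> is
  recovered from the fields \<open>wop a b\<close> up to multiples of the row equations.\<close>

lemma x_gram: "weyl_x (k, b) = (\<Sum>l\<in>UNIV. dop (gram_rows k l) * weyl_x (l, b)) - (\<Sum>a\<in>UNIV. weyl_d (k, a) * wop a b)"
proof -
  have "(\<Sum>l\<in>UNIV. dop (gram_rows k l) * weyl_x (l, b))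
      = (\<Sum>l\<in>UNIV. if k = l then weyl_x (l, b) else 0) - (\<Sum>l\<in>UNIV. \<Sum>a\<in>UNIV. weyl_d (k, a) * (weyl_d (l, a) * weyl_x (l, b)))"
    unfolding sum_subtractf[symmetric]
    by (rule sum.cong) (auto simp: gram_rows_def dop_diff dop_sum dop_mult dop_var left_diff_distrib sum_distrib_right mult.assoc)
  also have "(\<Sum>l\<in>UNIV. \<Sum>a\<in>UNIV. weyl_d (k, a) * (weyl_d (l, a) * weyl_x (l, b))) = - (\<Sum>a\<in>UNIV. weyl_d (k, a) * wop a b)"
    by (subst sum.swap) (simp add: wop_def sum_distrib_left sum_negf)
  finally show ?thesis by simp
qed

lemma x_words:
  fixes u :: "('n::finite \<times> 'n) weyl"
  assumes u: "u \<in> words (polys_le e) k"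
  shows "weyl_x (k', b) * u \<in> words (polys_le (Suc e)) (Suc k)"
proof (rule words_extend[OF _ u])
  fix w :: "('n \<times> 'n) list" and f :: "('n \<times> 'n) mpoly" assume w: "length w < k" and f: "f \<in> polys_le e"
  have "weyl_x (k', b) * (wword w * dop f) \<in> words (polys_le (Suc e)) (Suc (Suc (length w)))"
  proof (induction w arbitrary: b)
    case Nil
    have r2: "gram_rows k' l \<in> polys_le 2" for l
      unfolding gram_rows_def using polys_le_mult[OF polys_le_var[OF order_refl] polys_le_var[OF order_refl]]
      by (intro polys_le_diff polys_le_sum) (auto simp: numeral_2_eq_2)
    \<comment> \<open>Moved to the right the row equation falls into the ideal; what remains is its
      first derivative, of degree at most 1.\<close>
    have 1: "dop (gram_rows k' l) * weyl_x (l, b) * dop f \<in> words (polys_le (Suc e)) 2" for l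
    proof -
      have "dop (gram_rows k' l) * weyl_x (l, b) * dop f
          = weyl_x (l, b) * dop f * dop (gram_rows k' l) + wword [] * dop (mpderiv (l, b) (gram_rows k' l) * f)"
        by (simp add: dop_x distrib_right dop_mult mult.assoc dop_commute)
      moreover have "weyl_x (l, b) * dop f * dop (gram_rows k' l) \<in> words (polys_le (Suc e)) 2"
        by (intro words.base left_ideal_mult[OF left_ideal_so_weyl_ideal] dop_in gram_rows_in)
      moreover have "mpderiv (l, b) (gram_rows k' l) * f \<in> polys_le (Suc e)"
        using polys_le_mult[OF polys_le_deriv[OF r2] f] by simp
      ultimately show ?thesis by (simp only:) (intro words_add words_gen, simp_all)
    qed
    have 2: "weyl_d (k', a) * (wop a b * dop f) \<in> words (polys_le (Suc e)) 2" for a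
    proof -
      have "wword [(a, b)] * dop f \<in> words (polys_le e) 2" by (rule words_gen) (use f in auto)
      from d_words[OF this] show ?thesis by simp
    qed
    have "weyl_x (k', b) * dop f = (\<Sum>l\<in>UNIV. dop (gram_rows k' l) * weyl_x (l, b) * dop f)
        - (\<Sum>a\<in>UNIV. weyl_d (k', a) * (wop a b * dop f))"
      by (subst x_gram) (simp add: left_diff_distrib sum_distrib_right mult.assoc)
    also have "\<dots> \<in> words (polys_le (Suc e)) 2" by (intro words_diff closed_polys_le words_sum 1 2)
    finally show ?case by (simp add: numeral_2_eq_2)
  next
    case (Cons p w)
    obtain c d where p: "p = (c, d)" by (cases p)
    have xw: "weyl_x (k', b) * wop c d = wop c d * weyl_x (k', b) + (if b = c then weyl_x (k', d) else 0)"
      by (simp add: wop_x)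
    have "weyl_x (k', b) * (wword (p # w) * dop f) = (weyl_x (k', b) * wop c d) * (wword w * dop f)"
      by (simp add: p mult.assoc)
    also have "\<dots> = wop c d * (weyl_x (k', b) * (wword w * dop f)) + (if b = c then weyl_x (k', d) * (wword w * dop f) else 0)"
      by (simp add: xw distrib_right mult.assoc)
    also have "\<dots> \<in> words (polys_le (Suc e)) (Suc (Suc (Suc (length w))))"
      using words_mono[OF Cons.IH, of "Suc (Suc (Suc (length w)))"]
      by (intro words_add wop_words Cons.IH) (auto simp: words_zero)
    finally show ?case by simp
  qed
  then show "weyl_x (k', b) * (wword w * dop f) \<in> words (polys_le (Suc e)) (Suc k)"
    by (rule words_mono) (use w in auto)
qed

lemma words_exhaust: "\<exists>e k. R \<in> words (polys_le e) k"
proof -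
  have "\<exists>e' k'. R * u \<in> words (polys_le e') k'" if "u \<in> words (polys_le e) k" for u e k
    using that
  proof (induction R arbitrary: u e k rule: weyl_induct)
    case (const c)
    then show ?case using words_const[OF closed_polys_le(1)] by blast
  next
    case (x i)
    then show ?case using x_words by (cases i) blast
  next
    case (d i)
    then show ?case using d_words by (cases i) blast
  next
    case (add S T)
    from add.IH(1)[OF add.prems] add.IH(2)[OF add.prems]
    obtain e1 k1 e2 k2 where 1: "S * u \<in> words (polys_le e1) k1" and 2: "T * u \<in> words (polys_le e2) k2" by blast
    have "S * u \<in> words (polys_le (max e1 e2)) (max k1 k2)" "T * u \<in> words (polys_le (max e1 e2)) (max k1 k2)"
      using words_mono[OF 1] words_mono[OF 2] polys_le_mono by (metis max.cobounded1 max.cobounded2 subsetI)+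
    from words_add[OF this] show ?case by (auto simp: distrib_right)
  next
    case (mult S T)
    from mult.IH(2)[OF mult.prems] obtain e1 k1 where "T * u \<in> words (polys_le e1) k1" by blast
    from mult.IH(1)[OF this] show ?case by (simp add: mult.assoc)
  qed
  from this[of 1 0 1] show ?thesis using words_gen[of "[]" 1 1 "polys_le 0"] by simp
qed

section \<open>Maximality of the left ideal\<close>

lemma words_1: "u \<in> words T 1 \<Longrightarrow> \<exists>f. u - dop f \<in> so_weyl_ideal"
proof (induction rule: words.induct)
  case (base u)
  then show ?case by (intro exI[of _ 0]) simp
next
  case (step u w f)
  then obtain g where "u - dop g \<in> so_weyl_ideal" by blast
  then show ?case using step.hyps by (intro exI[of _ "f + g"]) (simp add: dop_add)
qed

text \<open>Take an element of \<open>N\<close> outside the ideal at the lowest possible level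
  \<open>Suc n\<close>. The column equations lower its level, so by minimality they send it into the
  ideal, and with them \<open>wop_gram\<close> does. But \<open>wop_gram\<close> acts on the top
  layer by \<open>2 * n\<close>, so for \<open>n \<noteq> 0\<close> the element would already lie
  lower.\<close>

lemma left_ideal_contains_function:
  assumes N: "left_ideal N" and IN: "so_weyl_ideal \<subseteq> N" and ne: "N \<noteq> so_weyl_ideal"
  shows "\<exists>f. dop f \<in> N \<and> dop f \<notin> so_weyl_ideal"
proof -
  note I = left_ideal_so_weyl_ideal
  define Q where "Q k \<longleftrightarrow> (\<exists>u e. u \<in> N \<and> u \<notin> so_weyl_ideal \<and> u \<in> words (polys_le e) k)" for k
  have "\<exists>k. Q k" using IN ne words_exhaust unfolding Q_def by blast
  define k where "k = (LEAST k. Q k)"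
  have Qk: "Q k" unfolding k_def using \<open>\<exists>k. Q k\<close> by (rule LeastI_ex)
  have min: "\<not> Q j" if "j < k" for j using that not_less_Least unfolding k_def by blast
  from Qk obtain u e where u: "u \<in> N" "u \<notin> so_weyl_ideal" "u \<in> words (polys_le e) k" by (auto simp: Q_def)
  then obtain n where n: "k = Suc n" by (cases k) (auto simp: words_0_eq)
  have uw: "u \<in> words (polys_le e) (Suc n)" using u(3) by (simp only: n)
  have small: "v \<in> so_weyl_ideal" if "v \<in> N" "v \<in> words (polys_le e) n" for v
    using min[of n] that unfolding Q_def n by blast
  have "n = 0"
  proof (rule ccontr)
    assume n0: "n \<noteq> 0"
    have gu: "dop (gram_cols c d) * u \<in> so_weyl_ideal" for c d
      using gram_words[OF closed_polys_le(1) uw] left_ideal_mult[OF N u(1)] by (intro small)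
    then have "wop_gram * u \<in> so_weyl_ideal"
      unfolding wop_gram_def sum_distrib_right mult.assoc by (intro left_ideal_sum[OF I]) (rule left_ideal_mult[OF I gu])
    then have "wop_gram * u \<in> words (polys_le e) n" by (rule words.base)
    from words_diff[OF closed_polys_le(1) this wop_gram_words[OF closed_polys_le uw]]
    have "weyl_const (of_nat (2 * n)) * u \<in> words (polys_le e) n" by (simp only: weyl_of_nat) simp
    from words_const[OF closed_polys_le(1) this, of "1 / of_nat (2 * n)"] n0
    have "u \<in> words (polys_le e) n" by (simp add: mult.assoc[symmetric] weyl_const_mult[symmetric])
    with small u show False by blast
  qed
  with uw obtain f where f: "u - dop f \<in> so_weyl_ideal" using words_1[of u "polys_le e"] by auto
  have "dop f \<in> N" using left_ideal_diff[OF N u(1), of "u - dop f"] f IN by auto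
  moreover have "dop f \<notin> so_weyl_ideal" using left_ideal_add[OF I f, of "dop f"] u(2) by auto
  ultimately show ?thesis by blast
qed

lemma maximal_so_weyl_ideal: "maximal_left_ideal (so_weyl_ideal :: ('n::{finite,linorder} \<times> 'n) weyl set)"
  unfolding maximal_left_ideal_def
proof (intro conjI allI impI)
  show "left_ideal so_weyl_ideal" by (rule left_ideal_so_weyl_ideal)
  show "so_weyl_ideal \<noteq> (UNIV :: ('n \<times> 'n) weyl set)"
    using one_notin_so_weyl_ideal by blast
next
  fix N :: "('n \<times> 'n) weyl set"
  assume "left_ideal N \<and> so_weyl_ideal \<subseteq> N"
  then have N: "left_ideal N" and IN: "so_weyl_ideal \<subseteq> N" by auto
  show "N = so_weyl_ideal \<or> N = UNIV"
  proof (rule disjCI)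
    assume "N \<noteq> UNIV"
    then have 1: "1 \<notin> N" using left_ideal_eq_UNIV[OF N] by blast
    define L where "L = {f. dop f \<in> N}"
    have "left_ideal L" using N by (auto simp: L_def left_ideal_def dop_add dop_mult)
    moreover have "so_ideal \<subseteq> L" using dop_in IN by (auto simp: L_def)
    moreover have "rot i j f \<in> L" if "f \<in> L" for i j f
    proof -
      \<comment> \<open>Since \<open>lie_gen i j\<close> lies in \<open>N\<close>, both products in
        the commutator do.\<close>
      have "dop (rot i j f) = lie_gen i j * dop f - dop f * lie_gen i j" by (simp add: lie_gen_dop)
      moreover have "lie_gen i j \<in> N" using lie_gen_in IN by blast
      ultimately show ?thesis
        using that N by (simp add: L_def left_ideal_diff left_ideal_mult)
    qed
    ultimately have "1 \<in> L \<or> L = so_ideal" by (rule rot_stable_ideal)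
    with 1 have "L = so_ideal" by (simp add: L_def)
    then have "\<not> (\<exists>f. dop f \<in> N \<and> dop f \<notin> so_weyl_ideal)" using dop_in by (auto simp: L_def)
    then show "N = so_weyl_ideal" using left_ideal_contains_function[OF N IN] by blast
  qed
qed

section \<open>Growth of the cyclic module\<close>

text \<open>Each exchange of \<open>p\<close> with a neighbour costs a commutator, which replaces
  two letters by combinations of one. The level in the conclusion is that of words of length at most
  \<open>length u + length v\<close>.\<close>

lemma word_move:
  assumes T: "const_closed T" and f: "f \<in> T"
  shows "wword (u @ p # v) * dop f - wword (p # u @ v) * dop f \<in> words T (Suc (length u + length v))"
proof (induction u)
  case Nil
  show ?case by (simp add: words_zero)
next
  case (Cons r u)
  obtain a b c d where pr: "r = (a, b)" "p = (c, d)" by (cases r, cases p)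
  define X where "X = wword (u @ v) * dop f"
  have W: "wop i j * X \<in> words T (Suc (Suc (length u + length v)))" for i j
    using words_gen[OF _ f, of "(i, j) # u @ v"] by (simp add: X_def mult.assoc)
  have "wword ((r # u) @ p # v) * dop f - wword (p # (r # u) @ v) * dop f
      = wop a b * (wword (u @ p # v) * dop f - wword (p # u @ v) * dop f) + (wop a b * wop c d - wop c d * wop a b) * X"
    by (simp add: pr X_def algebra_simps)
  also have "\<dots> = wop a b * (wword (u @ p # v) * dop f - wword (p # u @ v) * dop f)
      + ((if b = c then wop a d * X else 0) - (if a = d then wop c b * X else 0))"
    by (simp add: wop_wop[of a b c d] distrib_right left_diff_distrib)
  also have "\<dots> \<in> words T (Suc (Suc (length u + length v)))"
    using wop_words[OF Cons.IH, of a b] by (intro words_add words_diff T) (auto simp: W words_zero)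
  finally show ?case by simp
qed

lemma word_perm:
  assumes T: "const_closed T" and f: "f \<in> T"
  shows "mset w = mset w' \<Longrightarrow> wword w * dop f - wword w' * dop f \<in> words T (length w)"
proof (induction w arbitrary: w')
  case Nil
  then show ?case by (simp add: words_zero)
next
  case (Cons p w)
  then have "p \<in> set w'" by (metis list.set_intros(1) set_mset_mset)
  then obtain u v where w': "w' = u @ p # v" by (meson split_list)
  then have m: "mset w = mset (u @ v)" using Cons.prems by simp
  have len: "length w = length u + length v" using arg_cong[OF m, of size] by simp
  have "wword (p # w) * dop f - wword w' * dop f
      = wop (fst p) (snd p) * (wword w * dop f - wword (u @ v) * dop f)
        - (wword (u @ p # v) * dop f - wword (p # u @ v) * dop f)"
    by (simp add: w' algebra_simps)
  also have "\<dots> \<in> words T (Suc (length w))"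
  proof (rule words_diff[OF T])
    show "wop (fst p) (snd p) * (wword w * dop f - wword (u @ v) * dop f) \<in> words T (Suc (length w))"
      by (rule wop_words[OF Cons.IH[OF m]])
    show "wword (u @ p # v) * dop f - wword (p # u @ v) * dop f \<in> words T (Suc (length w))"
      unfolding len by (rule word_move[OF T f])
  qed
  finally show ?case by simp
qed

definition sort_pair :: "'n::linorder \<times> 'n \<Rightarrow> 'n \<times> 'n"
  where "sort_pair p = (if fst p \<le> snd p then p else (snd p, fst p))"

text \<open>\<open>wop a b\<close> and \<open>wop b a\<close> differ by a rotation, which does not
  lengthen the rest of the word. So letters with \<open>a \<le> b\<close> suffice.\<close>

lemma word_flip:
  assumes T: "const_closed T" "rot_closed T" and f: "f \<in> T"
  shows "wword w * dop f - wword (map sort_pair w) * dop f \<in> words T (length w)"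
proof (induction w)
  case Nil
  show ?case by (simp add: words_zero)
next
  case (Cons p w)
  obtain a b where p: "p = (a, b)" by (cases p)
  obtain c d where sp: "sort_pair p = (c, d)" by (cases "sort_pair p")
  define X where "X = wword w * dop f"
  have "wop a b - wop c d = (if a \<le> b then 0 else lie_gen a b)"
    using sp by (auto simp: p sort_pair_def wop_skew split: if_splits)
  then have e: "wop a b * X - wop c d * X = (if a \<le> b then 0 else lie_gen a b * X)"
    by (simp add: left_diff_distrib[symmetric])
  have "wword (p # w) * dop f - wword (map sort_pair (p # w)) * dop f
      = (wop a b * X - wop c d * X) + wop c d * (wword w * dop f - wword (map sort_pair w) * dop f)"
    by (simp add: p sp[unfolded p] X_def algebra_simps)
  also have "\<dots> \<in> words T (Suc (length w))"
    unfolding e using lie_gen_word[OF T f, of a b w] wop_words[OF Cons.IH, of c d]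
    by (intro words_add) (auto simp: X_def words_zero)
  finally show ?case by simp
qed

text \<open>Any arrangement of the letters will do, since the order matters only modulo shorter
  words.\<close>

definition canonical_word :: "'b multiset \<Rightarrow> 'b list"
  where "canonical_word M = (SOME w. mset w = M)"

lemma mset_canonical_word: "mset (canonical_word M) = M"
  unfolding canonical_word_def by (rule someI_ex) (rule ex_mset)

definition pair_multisets :: "nat \<Rightarrow> ('n::linorder \<times> 'n) multiset set"
  where "pair_multisets k = {M. set_mset M \<subseteq> {q. fst q \<le> snd q} \<and> size M < k}"

lemma card_pair_multisets:
  "finite (pair_multisets (Suc k) :: ('n::{finite,linorder} \<times> 'n) multiset set)"
  "card (pair_multisets (Suc k) :: ('n \<times> 'n) multiset set) \<le> (k + 1) ^ card {q :: 'n \<times> 'n. fst q \<le> snd q}"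
proof -
  let ?S = "{q :: 'n \<times> 'n. fst q \<le> snd q}" and ?M = "pair_multisets (Suc k) :: ('n \<times> 'n) multiset set"
  let ?r = "\<lambda>M :: ('n \<times> 'n) multiset. restrict (count M) ?S"
  have inj: "inj_on ?r ?M"
  proof (rule inj_onI, rule multiset_eqI)
    fix M M' q assume m: "M \<in> ?M" "M' \<in> ?M" and eq: "?r M = ?r M'"
    show "count M q = count M' q"
    proof (cases "q \<in> ?S")
      case True
      then show ?thesis using fun_cong[OF eq, of q] by simp
    next
      case False
      then have "q \<notin># M" "q \<notin># M'" using m by (auto simp: pair_multisets_def)
      then show ?thesis by (simp add: not_in_iff)
    qed
  qed
  have sub: "?r ` ?M \<subseteq> PiE ?S (\<lambda>_. {..k})"
  proof (rule image_subsetI)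
    fix M assume "M \<in> ?M"
    then have "count M q \<le> k" for q using count_le_size[of M q] by (simp add: pair_multisets_def)
    then show "?r M \<in> PiE ?S (\<lambda>_. {..k})" by (intro restrict_PiE_iff[THEN iffD2]) simp
  qed
  have fin: "finite (PiE ?S (\<lambda>_. {..k}))" by (intro finite_PiE) auto
  show "finite ?M" using finite_imageD[OF finite_subset[OF sub fin] inj] .
  have "card ?M \<le> card (PiE ?S (\<lambda>_. {..k}))" using inj sub fin by (rule card_inj_on_le)
  then show "card ?M \<le> (k + 1) ^ card ?S" by (simp add: card_PiE)
qed

definition word_basis :: "('n::{finite,linorder} \<times> 'n) multiset \<times> ('n \<times> 'n \<Rightarrow>\<^sub>0 nat) \<Rightarrow> ('n \<times> 'n) weyl"
  where "word_basis x = wword (canonical_word (fst x)) * dop (Poly_Mapping.single (snd x) 1)"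

text \<open>Induction on the level: flipping and sorting the letters costs shorter words, and a
  function to the right of a word may be replaced by its expansion in \<open>B\<close>, because the
  left ideal absorbs words times \<open>dop\<close> of \<open>so_ideal\<close>.\<close>

lemma words_span:
  fixes B :: "('n::{finite,linorder} \<times> 'n \<Rightarrow>\<^sub>0 nat) set" and K :: nat
  assumes B: "\<And>f. f \<in> polys_le e \<Longrightarrow> \<exists>a. f - (\<Sum>m\<in>B. mconst (a m) * Poly_Mapping.single m 1) \<in> so_ideal"
    and finB: "finite B"
  shows "u \<in> words (polys_le e) (Suc K) \<Longrightarrow>
    \<exists>a. u - (\<Sum>x\<in>pair_multisets (Suc K) \<times> B. weyl_const (a x) * word_basis x) \<in> so_weyl_ideal"
proof -
  note I = left_ideal_so_weyl_ideal
  let ?G = "pair_multisets (Suc K) \<times> B"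
  define lin where "lin a = (\<Sum>x\<in>?G. weyl_const (a x) * word_basis x)" for a
  have lin_add: "lin (\<lambda>x. a x + b x) = lin a + lin b" for a b
    by (simp add: lin_def weyl_const_add distrib_right sum.distrib)
  define spanned where "spanned u \<longleftrightarrow> (\<exists>a. u - lin a \<in> so_weyl_ideal)" for u
  have sp_add: "spanned (u + v)" if uv: "spanned u" "spanned v" for u v
  proof -
    obtain a b where "u - lin a \<in> so_weyl_ideal" "v - lin b \<in> so_weyl_ideal" using uv by (auto simp: spanned_def)
    from left_ideal_add[OF I this] have "(u + v) - lin (\<lambda>x. a x + b x) \<in> so_weyl_ideal"
      by (simp only: lin_add add_diff_add)
    then show ?thesis unfolding spanned_def by (rule exI[of _ "\<lambda>x. a x + b x"])
  qed
  have sp_I: "spanned u" if "u \<in> so_weyl_ideal" for u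
    unfolding spanned_def using that by (intro exI[of _ "\<lambda>_. 0"]) (simp add: lin_def)
  have sp_canonical: "spanned (wword (canonical_word M) * dop f)" if M: "M \<in> pair_multisets (Suc K)" and f: "f \<in> polys_le e" for M f
  proof -
    obtain b where b: "f - (\<Sum>m\<in>B. mconst (b m) * Poly_Mapping.single m 1) \<in> so_ideal" using B[OF f] by blast
    define a where "a x = (if fst x = M then b (snd x) else 0)" for x :: "('n \<times> 'n) multiset \<times> ('n \<times> 'n \<Rightarrow>\<^sub>0 nat)"
    have "lin a = (\<Sum>M'\<in>pair_multisets (Suc K). \<Sum>m\<in>B. weyl_const (a (M', m)) * word_basis (M', m))"
      by (simp add: lin_def sum.cartesian_product case_prod_unfold)
    also have "\<dots> = (\<Sum>M'\<in>pair_multisets (Suc K). if M' = M then \<Sum>m\<in>B. weyl_const (b m) * word_basis (M, m) else 0)"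
      by (rule sum.cong) (auto simp: a_def)
    also have "\<dots> = (\<Sum>m\<in>B. weyl_const (b m) * word_basis (M, m))"
      using M by (simp add: sum.delta[OF card_pair_multisets(1)])
    also have "\<dots> = wword (canonical_word M) * dop (\<Sum>m\<in>B. mconst (b m) * Poly_Mapping.single m 1)"
      unfolding dop_sum sum_distrib_left
      by (rule sum.cong[OF refl])
         (simp only: word_basis_def dop_mult dop_const fst_conv snd_conv mult.assoc[symmetric]
            weyl_const_commute[of _ "wword (canonical_word M)"])
    finally have "wword (canonical_word M) * dop f - lin a
        = wword (canonical_word M) * dop (f - (\<Sum>m\<in>B. mconst (b m) * Poly_Mapping.single m 1))"
      by (simp only: dop_diff right_diff_distrib)
    then have "wword (canonical_word M) * dop f - lin a \<in> so_weyl_ideal"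
      by (simp only: left_ideal_mult[OF I dop_in[OF b]])
    then show ?thesis unfolding spanned_def by (rule exI[of _ a])
  qed
  have "spanned u" if "u \<in> words (polys_le e) k" "k \<le> Suc K" for u k
    using that
  proof (induction k arbitrary: u rule: less_induct)
    case (less k)
    from less.prems(1) show ?case
    proof (induction rule: words.induct)
      case (base u)
      then show ?case by (rule sp_I)
    next
      case (step u w f)
      let ?s = "map sort_pair w"
      let ?c = "canonical_word (mset ?s)"
      have lt: "length w < k" "length w \<le> Suc K" using step.hyps less.prems(2) by auto
      have "wword w * dop f - wword ?s * dop f \<in> words (polys_le e) (length w)"
        by (rule word_flip[OF closed_polys_le step.hyps(3)])
      then have s1: "spanned (wword w * dop f - wword ?s * dop f)" by (rule less.IH[OF lt(1) _ lt(2)])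
      have "wword ?s * dop f - wword ?c * dop f \<in> words (polys_le e) (length ?s)"
        by (rule word_perm[OF closed_polys_le(1) step.hyps(3)]) (simp only: mset_canonical_word)
      then have "wword ?s * dop f - wword ?c * dop f \<in> words (polys_le e) (length w)" by (simp only: length_map)
      then have s2: "spanned (wword ?s * dop f - wword ?c * dop f)" by (rule less.IH[OF lt(1) _ lt(2)])
      have "mset ?s \<in> pair_multisets (Suc K)"
        using lt less.prems(2) by (auto simp: pair_multisets_def sort_pair_def)
      from sp_canonical[OF this step.hyps(3)] have s3: "spanned (wword ?c * dop f)" .
      have "spanned ((wword w * dop f - wword ?s * dop f) + ((wword ?s * dop f - wword ?c * dop f) + wword ?c * dop f))"
        by (intro sp_add s1 s2 s3)
      then have "spanned (wword w * dop f)" by (simp only: diff_add_cancel)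
      then show ?case using step.IH by (rule sp_add)
    qed
  qed
  from this[of u "Suc K"] show "u \<in> words (polys_le e) (Suc K) \<Longrightarrow>
    \<exists>a. u - (\<Sum>x\<in>pair_multisets (Suc K) \<times> B. weyl_const (a x) * word_basis x) \<in> so_weyl_ideal"
    by (simp add: spanned_def lin_def)
qed

text \<open>The derivations of a normally ordered monomial form a function behind the empty word;
  each variable on their left adds at most one to the length and to the degree.\<close>

lemma weyl_monom_words:
  fixes m :: "('n::finite \<times> 'n) + ('n \<times> 'n) \<Rightarrow>\<^sub>0 nat"
  shows "weyl_monom m \<in> words (polys_le (tdeg m)) (Suc (tdeg m))"
proof (induction "\<Sum>i\<in>UNIV. Poly_Mapping.lookup m (Inl i)" arbitrary: m)
  case 0
  then have z: "Poly_Mapping.lookup m (Inl i) = 0" for i by (metis finite iso_tuple_UNIV_I sum_eq_0_iff)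
  have "tdeg m = (\<Sum>i\<in>UNIV. Poly_Mapping.lookup m (Inl i)) + (\<Sum>i\<in>UNIV. Poly_Mapping.lookup m (Inr i))"
    unfolding tdeg_def UNIV_sum by (subst sum.union_disjoint) (auto simp: sum.reindex)
  then have "tdeg (pm_right m) = tdeg m" by (simp add: z tdeg_def pm_right.rep_eq)
  then have "Poly_Mapping.single (pm_right m) 1 \<in> polys_le (tdeg m)" by (intro polys_le_single) simp
  from words_gen[OF _ this, of "[]" "Suc (tdeg m)"]
  have "dop (Poly_Mapping.single (pm_right m) 1) \<in> words (polys_le (tdeg m)) (Suc (tdeg m))" by simp
  moreover have "weyl_monom m = dop (Poly_Mapping.single (pm_right m) 1)"
    by (simp add: weyl_monom_def z cprod_1 dop_single pm_right.rep_eq)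
  ultimately show ?case by simp
next
  case (Suc s)
  obtain i where i: "Poly_Mapping.lookup m (Inl i) \<noteq> 0"
  proof (rule ccontr)
    assume "\<not> thesis"
    then have "Poly_Mapping.lookup m (Inl i) = 0" for i using that by blast
    then show False using Suc.hyps(2) by simp
  qed
  define m' where "m' = m - Poly_Mapping.single (Inl i) 1"
  have mm: "m = m' + Poly_Mapping.single (Inl i) 1"
    unfolding m'_def using i
    by (intro poly_mapping_eqI) (auto simp: lookup_add lookup_minus lookup_single when_def)
  have "(\<Sum>j\<in>UNIV. Poly_Mapping.lookup m (Inl j)) = (\<Sum>j\<in>UNIV. Poly_Mapping.lookup m' (Inl j)) + (\<Sum>j\<in>UNIV. if j = i then 1 else 0)"
    unfolding sum.distrib[symmetric] mm by (rule sum.cong) (auto simp: lookup_add lookup_single when_def)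
  then have "s = (\<Sum>j\<in>UNIV. Poly_Mapping.lookup m' (Inl j))" using Suc.hyps(2) by simp
  from Suc.hyps(1)[OF this] have IH: "weyl_monom m' \<in> words (polys_le (tdeg m')) (Suc (tdeg m'))" .
  obtain a b where ab: "i = (a, b)" by (cases i)
  have "weyl_monom m = weyl_x (a, b) * weyl_monom m'" unfolding mm ab by (rule x_weyl_monom[symmetric])
  moreover have "tdeg m = Suc (tdeg m')" unfolding mm tdeg_add tdeg_single by simp
  ultimately show ?case using x_words[OF IH, of a b] by simp
qed

lemma card_pairs: "card {q :: 'n::{finite,linorder} \<times> 'n. fst q \<le> snd q} + card {q :: 'n \<times> 'n. fst q < snd q} = CARD('n \<times> 'n)"
proof -
  have "bij_betw prod.swap {q :: 'n \<times> 'n. fst q < snd q} {q. snd q < fst q}"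
    by (rule bij_betwI[where g = prod.swap]) auto
  then have "card {q :: 'n \<times> 'n. fst q < snd q} = card {q :: 'n \<times> 'n. snd q < fst q}" by (rule bij_betw_same_card)
  moreover have "card ({q :: 'n \<times> 'n. fst q \<le> snd q} \<union> {q. snd q < fst q})
      = card {q :: 'n \<times> 'n. fst q \<le> snd q} + card {q :: 'n \<times> 'n. snd q < fst q}"
    by (rule card_Un_disjoint) auto
  moreover have "{q :: 'n \<times> 'n. fst q \<le> snd q} \<union> {q. snd q < fst q} = UNIV" by auto
  ultimately show ?thesis by simp
qed

lemma weyl_monom_growth:
  fixes k :: nat
  shows "\<exists>X :: (('n::{finite,linorder} \<times> 'n) multiset \<times> ('n \<times> 'n \<Rightarrow>\<^sub>0 nat)) set.
    finite X \<and> card X \<le> (2 * CARD('n) + 1) ^ CARD('n \<times> 'n) * (k + 1) ^ CARD('n \<times> 'n) \<and>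
    (\<forall>m. tdeg m \<le> k \<longrightarrow> (\<exists>a. weyl_monom m - (\<Sum>x\<in>X. weyl_const (a x) * word_basis x) \<in> so_weyl_ideal))"
proof -
  define p where "p = card {q :: 'n \<times> 'n. fst q < snd q}"
  define p' where "p' = card {q :: 'n \<times> 'n. fst q \<le> snd q}"
  have pp: "p' + p = CARD('n \<times> 'n)" unfolding p_def p'_def by (rule card_pairs)
  obtain B :: "('n \<times> 'n \<Rightarrow>\<^sub>0 nat) set" where B: "B \<subseteq> {m. tdeg m \<le> k}" "card B \<le> ((2 * CARD('n) + 1) * k + 1) ^ p"
    "\<And>f. f \<in> polys_le k \<Longrightarrow> \<exists>a. f - (\<Sum>m\<in>B. mconst (a m) * Poly_Mapping.single m 1) \<in> so_ideal"
    using so_ideal_growth[of k] unfolding p_def by blast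
  have finB: "finite B" using B(1) finite_tdeg_le by (rule finite_subset)
  let ?X = "(pair_multisets (Suc k) :: ('n \<times> 'n) multiset set) \<times> B"
  have "card B \<le> ((2 * CARD('n) + 1) * (k + 1)) ^ p"
    by (rule order_trans[OF B(2)]) (intro power_mono, simp_all)
  then have cB: "card B \<le> (2 * CARD('n) + 1) ^ p * (k + 1) ^ p" by (simp only: power_mult_distrib)
  have "card ?X \<le> (k + 1) ^ p' * ((2 * CARD('n) + 1) ^ p * (k + 1) ^ p)"
    unfolding card_cartesian_product p'_def by (rule mult_le_mono[OF card_pair_multisets(2) cB])
  also have "\<dots> = (2 * CARD('n) + 1) ^ p * (k + 1) ^ (p' + p)" by (simp only: power_add mult_ac)
  also have "\<dots> \<le> (2 * CARD('n) + 1) ^ CARD('n \<times> 'n) * (k + 1) ^ CARD('n \<times> 'n)"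
    unfolding pp[symmetric] by (intro mult_le_mono power_increasing order_refl) auto
  finally have card: "card ?X \<le> (2 * CARD('n) + 1) ^ CARD('n \<times> 'n) * (k + 1) ^ CARD('n \<times> 'n)" .
  have "\<exists>a. weyl_monom m - (\<Sum>x\<in>?X. weyl_const (a x) * word_basis x) \<in> so_weyl_ideal" if "tdeg m \<le> k" for m
  proof (rule words_span[OF B(3) finB])
    show "weyl_monom m \<in> words (polys_le k) (Suc k)"
      by (rule words_mono[OF weyl_monom_words]) (use that polys_le_mono in auto)
  qed
  then show ?thesis using card card_pair_multisets(1) finB by (intro exI[of _ ?X] conjI allI impI) auto
qed

section \<open>The characteristic variety\<close>

lemma left_ideal_hull_vanishes:
  "(\<And>p. p \<in> S \<Longrightarrow> meval a p = 0) \<Longrightarrow> q \<in> left_ideal hull S \<Longrightarrow> meval a q = 0"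
proof -
  assume "\<And>p. p \<in> S \<Longrightarrow> meval a p = 0" and q: "q \<in> left_ideal hull S"
  then have "left_ideal hull S \<subseteq> {p. meval a p = 0}"
    by (intro hull_left_ideal_minimal) (auto simp: left_ideal_def meval_add meval_mult)
  with q show ?thesis by auto
qed

lemma inv_normal_ordered: "inv normal_ordered (normal_ordered p) = p"
  by (rule inv_f_f[OF inj_normal_ordered])

lemma xi_degree_le_tdeg: "Poly_Mapping.lookup m (Inr i) \<le> xi_degree m"
  unfolding xi_degree_def by (rule member_le_sum) auto

text \<open>A monomial that is leading, for an order refining the \<open>\<xi>\<close>-degree, in some element of the
  ideal is on the characteristic variety a combination of smaller ones. So the remaining ones
  suffice, and these are linearly independent modulo the ideal.\<close>

lemma char_variety_growth:
  fixes I :: "'v::finite weyl set" and word :: "'x \<Rightarrow> 'v weyl"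
  assumes I: "left_ideal I" and X: "finite X"
    and span: "\<And>m. tdeg m \<le> k \<Longrightarrow> \<exists>a. weyl_monom m - (\<Sum>x\<in>X. weyl_const (a x) * word x) \<in> I"
  shows "\<exists>G :: ('v + 'v) mpoly set. finite G \<and> card G \<le> card X \<and>
      (\<forall>p\<in>polys_le k. \<exists>c. \<forall>a\<in>char_variety I. meval a p = (\<Sum>g\<in>G. c g * meval a g))"
proof -
  define Mon where "Mon = {m :: 'v + 'v \<Rightarrow>\<^sub>0 nat. tdeg m \<le> k}"
  have finMon: "finite Mon" unfolding Mon_def by (rule finite_tdeg_le)
  obtain h where h: "bij_betw h Mon {0..<card Mon}" using ex_bij_betw_finite_nat[OF finMon] by blast
  \<comment> \<open>The \<xi>-degree decides first; ties are broken by an arbitrary enumeration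
    \<open>h\<close> of the finitely many monomials, encoded as the remainder modulo
    \<open>card Mon\<close>.\<close>
  define ord where "ord m = xi_degree m * card Mon + h m" for m
  have hlt: "h m < card Mon" if "m \<in> Mon" for m
    using bij_betwE[OF h] that by auto
  have ord_inj: "m = m'" if "m \<in> Mon" "m' \<in> Mon" "ord m = ord m'" for m m'
  proof -
    have "ord m mod card Mon = ord m' mod card Mon" using that(3) by simp
    then have "h m = h m'" using hlt that(1,2) by (simp add: ord_def)
    then show ?thesis using bij_betw_imp_inj_on[OF h] that(1,2) by (simp add: inj_on_def)
  qed
  have ord_xi: "xi_degree m \<le> xi_degree m'" if "m \<in> Mon" "m' \<in> Mon" "ord m \<le> ord m'" for m m'
  proof -
    have "ord m div card Mon \<le> ord m' div card Mon" using that(3) by (rule div_le_mono)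
    then show ?thesis using hlt[OF that(1)] hlt[OF that(2)] by (simp add: ord_def)
  qed
  \<comment> \<open>The standard monomials: those not leading in any element of the ideal whose
    terms all lie in \<open>Mon\<close>.\<close>
  define Std where "Std = {m \<in> Mon. \<not> (\<exists>p. Poly_Mapping.keys p \<subseteq> Mon \<and> normal_ordered p \<in> I \<and>
      m \<in> Poly_Mapping.keys p \<and> (\<forall>m'\<in>Poly_Mapping.keys p. ord m' \<le> ord m))}"
  have finStd: "finite Std" using finMon by (simp add: Std_def)
  have "card Std \<le> card X"
  proof (rule ccontr)
    assume "\<not> card Std \<le> card X"
    then have lt: "card X < card Std" by simp
    have "\<exists>a. weyl_monom m - (\<Sum>x\<in>X. weyl_const (a x) * word x) \<in> I" if "m \<in> Std" for m
      using that by (intro span) (simp add: Std_def Mon_def)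
    then obtain b where b: "\<And>m. m \<in> Std \<Longrightarrow> weyl_monom m - (\<Sum>x\<in>X. weyl_const (b m x) * word x) \<in> I" by metis
    from homogeneous_system_solution[OF X finStd lt, of b] obtain c where
      c: "\<exists>m\<in>Std. c m \<noteq> 0" "\<And>x. x \<in> X \<Longrightarrow> (\<Sum>m\<in>Std. c m * b m x) = 0" by blast
    \<comment> \<open>More standard monomials than spanning elements would give a combination of
      them in the ideal, and its leading monomial would not be standard.\<close>
    define p where "p = (\<Sum>m\<in>Std. Poly_Mapping.single m (c m))"
    have lookup_p: "Poly_Mapping.lookup p m = (if m \<in> Std then c m else 0)" for m
      using finStd by (simp add: p_def lookup_sum lookup_single when_def)
    have keys_p: "Poly_Mapping.keys p \<subseteq> Std"
    proof
      fix m assume "m \<in> Poly_Mapping.keys p"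
      then show "m \<in> Std" unfolding in_keys_iff lookup_p by (rule contrapos_np) simp
    qed
    have no_sum: "normal_ordered (\<Sum>m\<in>A. f m) = (\<Sum>m\<in>A. normal_ordered (f m))" for A and f :: "_ \<Rightarrow> ('v + 'v) mpoly"
      by (induction A rule: infinite_finite_induct) (simp_all add: normal_ordered_add, simp_all add: normal_ordered_def)
    have "normal_ordered p = (\<Sum>m\<in>Std. weyl_const (c m) * weyl_monom m)"
      by (simp add: p_def no_sum normal_ordered_single)
    also have "\<dots> = (\<Sum>m\<in>Std. weyl_const (c m) * (weyl_monom m - (\<Sum>x\<in>X. weyl_const (b m x) * word x)))
        + (\<Sum>m\<in>Std. \<Sum>x\<in>X. weyl_const (c m * b m x) * word x)"
      by (simp add: right_diff_distrib sum_subtractf sum_distrib_left weyl_const_mult mult.assoc)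
    also have "(\<Sum>m\<in>Std. \<Sum>x\<in>X. weyl_const (c m * b m x) * word x) = (\<Sum>x\<in>X. weyl_const (\<Sum>m\<in>Std. c m * b m x) * word x)"
    proof -
      have s: "weyl_const (\<Sum>m\<in>A. g m) = (\<Sum>m\<in>A. weyl_const (g m))" for A and g :: "('v + 'v \<Rightarrow>\<^sub>0 nat) \<Rightarrow> complex"
        by (induction A rule: infinite_finite_induct) (simp_all add: weyl_const_add)
      show ?thesis by (subst sum.swap) (simp add: s sum_distrib_right)
    qed
    also have "\<dots> = 0" by (simp add: c(2))
    finally have pI: "normal_ordered p \<in> I"
      using left_ideal_sum[OF I, of Std] left_ideal_mult[OF I b] by simp
    obtain m0 where "m0 \<in> Std" "c m0 \<noteq> 0" using c(1) by blast
    then have "m0 \<in> Poly_Mapping.keys p" by (simp add: in_keys_iff lookup_p)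
    then have "Max (ord ` Poly_Mapping.keys p) \<in> ord ` Poly_Mapping.keys p" by (intro Max_in) auto
    then obtain m where m: "m \<in> Poly_Mapping.keys p" "Max (ord ` Poly_Mapping.keys p) = ord m" by blast
    then have max: "ord m' \<le> ord m" if "m' \<in> Poly_Mapping.keys p" for m'
      using Max_ge[of "ord ` Poly_Mapping.keys p" "ord m'"] that by simp
    have "m \<in> Std" using m keys_p by auto
    moreover have "Poly_Mapping.keys p \<subseteq> Mon" using keys_p by (auto simp: Std_def)
    ultimately show False using m(1) pI max unfolding Std_def by blast
  qed
  define mono where "mono m = (Poly_Mapping.single m 1 :: ('v + 'v) mpoly)" for m
  define spanned where "spanned p \<longleftrightarrow> (\<exists>c. \<forall>a\<in>char_variety I. meval a p = (\<Sum>m\<in>Std. c m * meval a (mono m)))" for p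
  have sp_add: "spanned (p + q)" if pq: "spanned p" "spanned q" for p q
  proof -
    obtain c d where "\<forall>a\<in>char_variety I. meval a p = (\<Sum>m\<in>Std. c m * meval a (mono m))"
      "\<forall>a\<in>char_variety I. meval a q = (\<Sum>m\<in>Std. d m * meval a (mono m))" using pq by (auto simp: spanned_def)
    then show ?thesis unfolding spanned_def
      by (intro exI[of _ "\<lambda>m. c m + d m"]) (simp add: meval_add distrib_right sum.distrib)
  qed
  have sp_const: "spanned (mconst r * p)" if p: "spanned p" for p r
  proof -
    obtain c where "\<forall>a\<in>char_variety I. meval a p = (\<Sum>m\<in>Std. c m * meval a (mono m))" using p by (auto simp: spanned_def)
    then show ?thesis unfolding spanned_def
      by (intro exI[of _ "\<lambda>m. r * c m"]) (simp add: meval_mult sum_distrib_left mult.assoc)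
  qed
  have sp_0: "spanned 0" unfolding spanned_def by (intro exI[of _ "\<lambda>_. 0"]) simp
  have sp_sum: "spanned (\<Sum>m\<in>A. f m)" if "\<And>m. m \<in> A \<Longrightarrow> spanned (f m)" for A and f :: "_ \<Rightarrow> ('v + 'v) mpoly"
    using that by (induction A rule: infinite_finite_induct) (auto intro: sp_0 sp_add)
  have sp_mono: "spanned (mono m)" if "m \<in> Mon" for m
    using that
  proof (induction "ord m" arbitrary: m rule: less_induct)
    case less
    show ?case
    proof (cases "m \<in> Std")
      case True
      have "meval a (mono m) = (\<Sum>k\<in>Std. (if k = m then 1 else 0) * meval a (mono k))" for a
      proof -
        have "(\<Sum>k\<in>Std. (if k = m then 1 else 0) * meval a (mono k)) = (\<Sum>k\<in>Std. if k = m then meval a (mono k) else 0)"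
          by (rule sum.cong) auto
        then show ?thesis using True finStd by simp
      qed
      then show ?thesis unfolding spanned_def by (intro exI[of _ "\<lambda>k. if k = m then 1 else 0"]) simp
    next
      case False
      then obtain p where p: "Poly_Mapping.keys p \<subseteq> Mon" "normal_ordered p \<in> I" "m \<in> Poly_Mapping.keys p"
        "\<And>m'. m' \<in> Poly_Mapping.keys p \<Longrightarrow> ord m' \<le> ord m"
        using less.prems unfolding Std_def by blast
      define c where "c m' = Poly_Mapping.lookup p m'" for m'
      have cm: "c m \<noteq> 0" using p(3) by (simp add: c_def in_keys_iff)
      \<comment> \<open>\<open>m\<close> is leading for an order refining the \<xi>-degree, so it is
        among the terms kept by \<open>in01\<close>.\<close>
      have "Max (xi_degree ` Poly_Mapping.keys p) = xi_degree m"
        by (rule Max_eqI) (use p ord_xi less.prems in auto)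
      then have in01: "in01 (normal_ordered p) = (\<Sum>m'\<in>{m' \<in> Poly_Mapping.keys p. xi_degree m' = xi_degree m}. Poly_Mapping.single m' (c m'))"
        by (simp add: in01_def inv_normal_ordered c_def)
      let ?T = "{m' \<in> Poly_Mapping.keys p. xi_degree m' = xi_degree m} - {m}"
      \<comment> \<open>The initial form vanishes on the variety; solved for \<open>m\<close> it
        expresses \<open>mono m\<close> through smaller monomials of the same \<xi>-degree.\<close>
      define q where "q = mconst (- 1 / c m) * (\<Sum>m'\<in>?T. mconst (c m') * mono m')"
      have split: "in01 (normal_ordered p) = Poly_Mapping.single m (c m) + (\<Sum>m'\<in>?T. Poly_Mapping.single m' (c m'))"
        unfolding in01 by (rule sum.remove) (use p in auto)
      have single: "Poly_Mapping.single m' r = mconst r * mono m'" for m' r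
        by (simp add: mono_def mconst_def mult_single)
      have eq: "meval a (mono m) = meval a q" if a: "a \<in> char_variety I" for a
      proof -
        have "in01 (normal_ordered p) \<in> char_ideal I"
          unfolding char_ideal_def using p(2) by (intro hull_inc) auto
        then have "meval a (in01 (normal_ordered p)) = 0" using a by (auto simp: char_variety_def zero_set_def)
        then have "c m * meval a (mono m) + meval a (\<Sum>m'\<in>?T. mconst (c m') * mono m') = 0"
          unfolding split single by (simp add: meval_add meval_mult)
        then show ?thesis using cm
          by (simp add: q_def meval_mult field_simps eq_neg_iff_add_eq_0)
      qed
      have "spanned (mono m')" if m': "m' \<in> ?T" for m'
      proof (rule less.hyps)
        show "m' \<in> Mon" using m' p(1) by auto
        have "ord m' \<le> ord m" using m' p(4) by auto
        moreover have "ord m' \<noteq> ord m" using m' p(1) less.prems ord_inj[of m' m] by auto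
        ultimately show "ord m' < ord m" by simp
      qed
      then have "spanned q" unfolding q_def by (intro sp_const sp_sum) auto
      then show ?thesis unfolding spanned_def using eq by simp
    qed
  qed
  have keys_mono: "Poly_Mapping.keys (mono m) = {m}" for m by (simp add: mono_def)
  have inj: "inj_on mono Std"
  proof (rule inj_onI)
    fix m m' assume "mono m = mono m'"
    then have "Poly_Mapping.keys (mono m) = Poly_Mapping.keys (mono m')" by (rule arg_cong)
    then show "m = m'" unfolding keys_mono by (rule singleton_inject)
  qed
  have "\<exists>c. \<forall>a\<in>char_variety I. meval a p = (\<Sum>g\<in>mono ` Std. c g * meval a g)" if p: "p \<in> polys_le k" for p
  proof -
    have "spanned (\<Sum>m\<in>Poly_Mapping.keys p. mconst (Poly_Mapping.lookup p m) * mono m)"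
      using p by (intro sp_sum sp_const sp_mono) (auto simp: polys_le_def Mon_def)
    then have "spanned p" unfolding mono_def by (simp only: mpoly_eq_sum[symmetric])
    then obtain c where c: "\<forall>a\<in>char_variety I. meval a p = (\<Sum>m\<in>Std. c m * meval a (mono m))" by (auto simp: spanned_def)
    show ?thesis
      by (rule exI[of _ "\<lambda>g. c (the_inv_into Std mono g)"])
         (simp add: c sum.reindex[OF inj] the_inv_into_f_f[OF inj])
  qed
  moreover have "card (mono ` Std) \<le> card X" using \<open>card Std \<le> card X\<close> by (simp add: card_image[OF inj])
  ultimately show ?thesis using finStd by (intro exI[of _ "mono ` Std"]) auto
qed

text \<open>On the zero section all \<xi> vanish, so an initial form can be nonzero there only if
  its \<xi>-degree is 0. The operator is then multiplication by a polynomial, and the ideal contains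
  no such operator except 0.\<close>

lemma zero_section_in_char_variety:
  "{a. \<forall>w. w \<notin> range Inl \<longrightarrow> a w = 0} \<subseteq> char_variety (so_weyl_ideal :: ('n::finite \<times> 'n) weyl set)"
proof
  fix a :: "('n \<times> 'n) + ('n \<times> 'n) \<Rightarrow> complex"
  assume "a \<in> {a. \<forall>w. w \<notin> range Inl \<longrightarrow> a w = 0}"
  then have a: "a (Inr i) = 0" for i by auto
  have "meval a (in01 P) = 0" if P: "P \<in> so_weyl_ideal" for P :: "('n \<times> 'n) weyl"
  proof -
    define p where "p = inv normal_ordered P"
    have Pp: "P = normal_ordered p" unfolding p_def by (simp add: surj_f_inv_f[OF surj_normal_ordered])
    define r where "r = Max (xi_degree ` Poly_Mapping.keys p)"
    have "r = 0 \<Longrightarrow> P = 0"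
    proof -
      assume r: "r = 0"
      have xi: "Poly_Mapping.lookup m (Inr i) = 0" if m: "m \<in> Poly_Mapping.keys p" for m i
      proof -
        have "xi_degree m \<le> r" unfolding r_def using m by (intro Max_ge) auto
        then show ?thesis using xi_degree_le_tdeg[of m i] r by simp
      qed
      define q where "q = (\<Sum>m\<in>Poly_Mapping.keys p. mconst (Poly_Mapping.lookup p m) * Poly_Mapping.single (pm_left m) 1)"
      have "weyl_apply P f = q * f" for f
        unfolding Pp normal_ordered_def weyl_apply_sum q_def sum_distrib_right
        by (rule sum.cong[OF refl])
           (simp add: weyl_apply_mult weyl_apply_const weyl_monom_def xi cprod_1 weyl_apply_xmonom mult.assoc)
      then show "P = 0" using multiplication_notin_so_weyl_ideal[OF P] by blast
    qed
    then consider "P = 0" | "r \<noteq> 0" by blast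
    then show ?thesis
    proof cases
      case 1
      have "normal_ordered 0 = (0 :: ('n \<times> 'n) weyl)" by (simp add: normal_ordered_def)
      then have "inv normal_ordered P = 0" using 1 inv_normal_ordered[of "0 :: (('n \<times> 'n) + ('n \<times> 'n)) mpoly"] by simp
      then show ?thesis by (simp add: in01_def)
    next
      case 2
      have "meval a (Poly_Mapping.single m x) = 0" if m: "xi_degree m = r" for m x
      proof -
        obtain i where "Poly_Mapping.lookup m (Inr i) \<noteq> 0"
          using m 2 unfolding xi_degree_def by (metis sum.neutral)
        then have "(\<Prod>j\<in>UNIV. a j ^ Poly_Mapping.lookup m j) = 0"
          by (intro prod_zero bexI[of _ "Inr i"]) (simp_all add: a)
        then show ?thesis by (simp add: meval_single)
      qed
      then show ?thesis by (simp add: in01_def p_def[symmetric] r_def[symmetric] meval_sum)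
    qed
  qed
  then show "a \<in> char_variety so_weyl_ideal"
    unfolding char_variety_def char_ideal_def zero_set_def
    by (auto intro: left_ideal_hull_vanishes[of "in01 ` so_weyl_ideal"])
qed

lemma holonomic_so_weyl_ideal: "holonomic (so_weyl_ideal :: ('n::{finite,linorder} \<times> 'n) weyl set)"
  unfolding holonomic_def
proof (intro conjI)
  show "left_ideal so_weyl_ideal" by (rule left_ideal_so_weyl_ideal)
  show "so_weyl_ideal \<noteq> (UNIV :: ('n \<times> 'n) weyl set)"
    using one_notin_so_weyl_ideal by blast
  show "krull_dim (char_variety (so_weyl_ideal :: ('n \<times> 'n) weyl set)) = enat CARD('n \<times> 'n)"
  proof (rule krull_dim_eqI[where C = "(2 * CARD('n) + 1) ^ CARD('n \<times> 'n)" and S = "range Inl"])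
    show "card (range Inl :: (('n \<times> 'n) + ('n \<times> 'n)) set) = CARD('n \<times> 'n)"
      by (rule card_image) (simp add: inj_on_def)
    show "{a. \<forall>w. w \<notin> range Inl \<longrightarrow> a w = 0} \<subseteq> char_variety (so_weyl_ideal :: ('n \<times> 'n) weyl set)"
      by (rule zero_section_in_char_variety)
    fix k
    obtain X :: "(('n \<times> 'n) multiset \<times> ('n \<times> 'n \<Rightarrow>\<^sub>0 nat)) set" where X: "finite X"
      "card X \<le> (2 * CARD('n) + 1) ^ CARD('n \<times> 'n) * (k + 1) ^ CARD('n \<times> 'n)"
      "\<And>m. tdeg m \<le> k \<Longrightarrow> \<exists>a. weyl_monom m - (\<Sum>x\<in>X. weyl_const (a x) * word_basis x) \<in> so_weyl_ideal"
      using weyl_monom_growth[of k] by blast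
    from char_variety_growth[OF left_ideal_so_weyl_ideal X(1,3)] X(2)
    show "\<exists>G :: (('n \<times> 'n) + ('n \<times> 'n)) mpoly set. finite G \<and>
        card G \<le> (2 * CARD('n) + 1) ^ CARD('n \<times> 'n) * (k + 1) ^ CARD('n \<times> 'n) \<and>
        (\<forall>p\<in>polys_le k. \<exists>c. \<forall>a\<in>char_variety (so_weyl_ideal :: ('n \<times> 'n) weyl set). meval a p = (\<Sum>g\<in>G. c g * meval a g))"
      by (meson le_trans)
  qed
qed

section \<open>The generators in the form of the theorem\<close>

lemma dop_gram_cols: "dop (gram_cols i j) = (if i = j then 1 else 0) - (\<Sum>k\<in>UNIV. weyl_d (k, i) * weyl_d (k, j))"
  by (simp add: gram_cols_def dop_diff dop_sum dop_mult dop_var)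

lemma dop_gram_rows: "dop (gram_rows i j) = (if i = j then 1 else 0) - (\<Sum>k\<in>UNIV. weyl_d (i, k) * weyl_d (j, k))"
  by (simp add: gram_rows_def dop_diff dop_sum dop_mult dop_var)

lemma dop_det_ymat: "dop (det ymat) = cdet (\<lambda>i j. weyl_d (i, j))"
  by (simp add: det_def cdet_def dop_sum dop_mult dop_of_int dop_prod ymat_def dop_var)

text \<open>The remaining index pairs follow from the antisymmetry of \<open>lie_gen\<close> and the
  symmetry of the Gram equations.\<close>

lemma so_weyl_ideal_eq:
  "so_weyl_ideal = left_ideal hull (
      {lie_gen i j |i j. i < j} \<union> {dop (gram_cols i j) |i j. i \<le> j} \<union> {dop (gram_rows i j) |i j. i \<le> j}
    \<union> {1 - dop (det ymat)} :: ('n::{finite,linorder} \<times> 'n) weyl set)"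
    (is "_ = left_ideal hull ?S")
proof
  have H: "left_ideal (left_ideal hull ?S)" by (rule left_ideal_hull)
  have S: "s \<in> left_ideal hull ?S" if "s \<in> ?S" for s using that by (rule hull_inc)
  have "lie_gen i j \<in> left_ideal hull ?S" for i j
  proof (cases i j rule: linorder_cases)
    case less
    then show ?thesis by (intro S) auto
  next
    case equal
    then show ?thesis using left_ideal_0[OF H] by (simp add: lie_gen_def)
  next
    case greater
    then have "lie_gen j i \<in> left_ideal hull ?S" by (intro S) auto
    from left_ideal_uminus[OF H this] show ?thesis by (simp add: wop_skew[symmetric])
  qed
  moreover have "dop (gram_cols i j) \<in> left_ideal hull ?S" for i j
  proof (cases "i \<le> j")
    case True
    then show ?thesis by (intro S) auto
  next
    case False
    then have "j \<le> i" by simp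
    then have "dop (gram_cols j i) \<in> left_ideal hull ?S" by (intro S) auto
    then show ?thesis by (simp only: gram_cols_sym[of i j])
  qed
  moreover have "dop (gram_rows i j) \<in> left_ideal hull ?S" for i j
  proof (cases "i \<le> j")
    case True
    then show ?thesis by (intro S) auto
  next
    case False
    then have "j \<le> i" by simp
    then have "dop (gram_rows j i) \<in> left_ideal hull ?S" by (intro S) auto
    then show ?thesis by (simp only: gram_rows_sym[of i j])
  qed
  moreover have "dop (1 - det ymat) \<in> left_ideal hull ?S" by (rule S) (simp add: dop_diff)
  ultimately show "so_weyl_ideal \<subseteq> left_ideal hull ?S"
    unfolding so_gen_ideal_eq by (intro hull_left_ideal_minimal[OF H]) blast
  have "1 - dop (det ymat) \<in> (so_weyl_ideal :: ('n \<times> 'n) weyl set)" using dop_in[OF det_in] by (simp add: dop_diff)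
  then have "?S \<subseteq> so_weyl_ideal"
    using lie_gen_in dop_in[OF gram_cols_in] dop_in[OF gram_rows_in] by blast
  then show "left_ideal hull ?S \<subseteq> so_weyl_ideal" by (rule hull_left_ideal_minimal[OF left_ideal_so_weyl_ideal])
qed

theorem corollary1:
  fixes I :: "('n::{finite,linorder} \<times> 'n) weyl set"
  assumes I_def: "I = left_ideal hull (
      {(\<Sum>k\<in>UNIV. weyl_x (k, i) * weyl_d (k, j) - weyl_x (k, j) * weyl_d (k, i)) |i j. i < j}
    \<union> {(if i = j then 1 else 0) - (\<Sum>k\<in>UNIV. weyl_d (k, i) * weyl_d (k, j)) |i j. i \<le> j}
    \<union> {(if i = j then 1 else 0) - (\<Sum>k\<in>UNIV. weyl_d (i, k) * weyl_d (j, k)) |i j. i \<le> j}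
    \<union> {1 - cdet (\<lambda>i j. weyl_d (i, j))})"
  shows "maximal_left_ideal I \<and> holonomic I"
proof -
  have "I = so_weyl_ideal"
    unfolding I_def so_weyl_ideal_eq lie_gen_def dop_gram_cols dop_gram_rows dop_det_ymat ..
  then show ?thesis using maximal_so_weyl_ideal holonomic_so_weyl_ideal by blast
qed

end
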